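(* Let $f^1:\tilde X\to X^1$ and $f^2:\tilde X\to X^2$ be coverings of graphs of objects (with respect to a fixed triple $(\mathcal{C},\mathcal{M}_1,\mathcal{M}_2)$), with underlying graphs $G_1:=G_{X^1}$ and $G_2:=G_{X^2}$ both finite, and $T:=G_{\tilde X}$ a tree. Let $\Gamma_1$ and $\Gamma_2$ be the groups of deck transformations for $f^1$ and $f^2$, and suppose that $\Gamma_1,\Gamma_2\leqslant H\leqslant\operatorname{Aut}(\tilde X)$. Suppose also that $H$ has finite edge isotropy groups. Then $X^1$ and $X^2$ have a common finite cover $X$, and there exists $g\in\mathscr{S}(H)$ that fits into a commutative diagram of coverings; that is, there are a finite graph of objects $X$, coverings $\mu^1:X\to X^1$, $\mu^2:X\to X^2$, $\nu^1:\tilde X\to X$, $\nu^2:\tilde X\to X$, and $g\in\mathscr{S}(H)$ such that $$f^1=\mu^1\nu^1,\qquad f^2=\mu^2\nu^2,\qquad \nu^1=\nu^2 g.$$ Furthermore, $X$ has underlying graph $G$ with vertex set bounded by $$|V(G)|\leq (d!)^2\bigl(\operatorname{LCM}_{e\in E(T)}|H(e)|\bigr)^{2d}\,V^2\exp\bigl(2\sqrt{V\log V}\bigr),$$ where $V:=|V(G_1)\sqcup V(G_2)|$, $d$ is the maximum degree of vertices in $T$, and $\operatorname{LCM}$ denotes the lowest common multiple.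
   Context: Graphs. A graph $G$ consists of a vertex set $V(G)$, an edge set $E(G)$ (of oriented edges), maps $\partial_0,\partial_1:E(G)\to V(G)$ (initial and terminal vertex), and an involution $e\mapsto\overline{e}$ on $E(G)$ with $e\neq\overline{e}$, $\partial_0 e=\partial_1\overline{e}$ and $\partial_0\overline{e}=\partial_1 e$. Graph morphisms preserve $\partial_0,\partial_1$ and edge inversion; automorphisms are morphisms from a graph to itself bijective on vertices and edges. For $v\in V(G)$, $\mathrm{star}(v)=\{e\in E(G)\mid\partial_0e=v\}$, and the degree of $v$ is $|\mathrm{star}(v)|$. A graph morphism $\alpha:G_1\to G_2$ is a covering if it is surjective and the induced maps $\mathrm{star}(v)\to\mathrm{star}(\alpha(v))$ are bijections for all $v\in V(G_1)$. Graphs of objects. Let $\mathcal{C}$ be a category and let $\mathcal{M}_1\subset\mathcal{M}_2\subset\mathrm{Hom}(\mathcal{C})$ be such that $(\mathrm{Ob}(\mathcal{C}),\mathcal{M}_1)$ and $(\mathrm{Ob}(\mathcal{C}),\mathcal{M}_2)$ are subcategories, with $(\mathrm{Ob}(\mathcal{C}),\mathcal{M}_1)$ a groupoid (all its morphisms are invertible within it). A graph of objects $X$ with respect to $(\mathcal{C},\mathcal{M}_1,\mathcal{M}_2)$ consists of: a graph $G_X$; objects $X_v\in\mathrm{Ob}(\mathcal{C})$ for $v\in V(G_X)$; objects $X_e\in\mathrm{Ob}(\mathcal{C})$ for $e\in E(G_X)$ with $X_e=X_{\overline{e}}$; and morphisms $\phi^e_0:X_e\to X_{\partial_0e}$ and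 $\phi^e_1:X_e\to X_{\partial_1e}$ in $\mathcal{M}_2$ for $e\in E(G_X)$, such that $\phi^e_0=\phi^{\overline{e}}_1$ and $\phi^e_1=\phi^{\overline{e}}_0$. $X$ is finite if $G_X$ is finite. A morphism $f:X\to Y$ of graphs of objects (with respect to the same triple) consists of a graph morphism $\hat f:G_X\to G_Y$, morphisms $f_v:X_v\to Y_{\hat f(v)}$ in $\mathcal{M}_1$ for $v\in V(G_X)$, and morphisms $f_e:X_e\to Y_{\hat f(e)}$ in $\mathcal{M}_1$ for $e\in E(G_X)$, such that $f_e=f_{\overline{e}}$ and, for every edge $e$ from $u$ to $v$, $f_u\phi^e_0=\phi^{\hat f(e)}_0f_e$ and $f_v\phi^e_1=\phi^{\hat f(e)}_1f_e$. Composition is componentwise. $f$ is a covering (and $X$ is a cover of $Y$) if $\hat f$ is a covering of graphs. A morphism $f:X\to X$ is an automorphism if $\hat f$ is a graph automorphism; $\operatorname{Aut}(X)$ is the group of automorphisms. Deck transformations. If $f:\tilde X\to X$ is a covering of graphs of objects with $G_{\tilde X}$ a tree, then for each deck transformation $\gamma$ of the graph covering $\hat f:G_{\tilde X}\to G_X$ there is a unique automorphism $\rho(\gamma)\in\operatorname{Aut}(\tilde X)$ with $\widehat{\rho(\gamma)}=\gamma$, $f_v=f_{\gamma(v)}\rho(\gamma)_v$ and $f_e=f_{\gamma(e)}\rho(\gamma)_e$ for all vertices $v$ and edges $e$; the group of all $\rho(\gamma)$ is the group of deck transformations of $f$. Isotropy groups. For $H\leqslant\operatorname{Aut}(X)$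 and $e\in E(G_X)$, the isotropy group of $e$ in $H$ is $H(e):=\{h_e\mid h\in H,\ \hat h(e)=e\}\leqslant\operatorname{Aut}_{\mathcal{M}_1}(X_e)$ (the group of morphisms $X_e\to X_e$ in $\mathcal{M}_1$). $H$ has finite edge isotropy groups if $H(e)$ is finite for every $e\in E(G_X)$. (In the theorem, the isomorphism type of $H(e)$ depends only on the $H$-orbit of $e$, and there are finitely many such orbits, so the lowest common multiple is finite.) Symmetry-restricted closure. For $H\leqslant\operatorname{Aut}(X)$, $\mathscr{S}(H)\leqslant\operatorname{Aut}(X)$ is the subgroup of automorphisms $g$ such that: (1) for all $e\in E(G_X)$ there exists $h\in H$ with $\hat g(e)=\hat h(e)$ and $g_e=h_e$; (2) for all $v\in V(G_X)$ there exists $h\in H$ with $\hat g(v)=\hat h(v)$ and $g_v=h_v$. *)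

theory Defs
  imports Complex_Main "HOL-Algebra.Group" "Graph_Theory.Graph_Theory"
begin

section \<open>Graphs with edge inversion\<close>

record ('v, 'e) sgraph =
  dig :: "('v, 'e) pre_digraph"
  rev_edge :: "'e \<Rightarrow> 'e"

abbreviation gverts :: "('v, 'e) sgraph \<Rightarrow> 'v set" where
  "gverts G \<equiv> verts (dig G)"

abbreviation gedges :: "('v, 'e) sgraph \<Rightarrow> 'e set" where
  "gedges G \<equiv> arcs (dig G)"

abbreviation src :: "('v, 'e) sgraph \<Rightarrow> 'e \<Rightarrow> 'v" where
  "src G \<equiv> tail (dig G)"

abbreviation tgt :: "('v, 'e) sgraph \<Rightarrow> 'e \<Rightarrow> 'v" where
  "tgt G \<equiv> head (dig G)"

abbreviation star :: "('v, 'e) sgraph \<Rightarrow> 'v \<Rightarrow> 'e set" where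
  "star G v \<equiv> out_arcs (dig G) v"

text \<open>
  The locale \<^locale>\<open>bidirected_digraph\<close> says that \<^const>\<open>rev_edge\<close> is a fixed-point-free
  involution on the edges that exchanges tail and head; in addition it normalises
  \<^const>\<open>rev_edge\<close> to be the identity outside the edge set. Loops, multiple edges and
  infinite graphs are allowed.
\<close>

definition is_graph :: "('v, 'e) sgraph \<Rightarrow> bool" where
  "is_graph G \<longleftrightarrow> bidirected_digraph (dig G) (rev_edge G)"

definition finite_graph :: "('v, 'e) sgraph \<Rightarrow> bool" where
  "finite_graph G \<longleftrightarrow> finite (gverts G) \<and> finite (gedges G)"

text \<open>
  The library's \<open>tree\<close> is unsuitable here: for it the walk along \<open>e\<close> and back along its
  inverse is already a cycle. A circuit must not backtrack, cyclically.
\<close>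

definition circuit :: "('v, 'e) sgraph \<Rightarrow> 'e list \<Rightarrow> bool" where
  "circuit G p \<longleftrightarrow> pre_digraph.cycle (dig G) p \<and>
     (\<forall>i < length p. p ! (Suc i mod length p) \<noteq> rev_edge G (p ! i))"

definition is_tree :: "('v, 'e) sgraph \<Rightarrow> bool" where
  "is_tree G \<longleftrightarrow> is_graph G \<and> connected (dig G) \<and> (\<nexists>p. circuit G p)"

text \<open>
  \<^const>\<open>Max\<close> needs finitely many degrees, all finite; this holds for every graph covering
  a finite graph, even an infinite one.
\<close>

definition max_degree :: "('v, 'e) sgraph \<Rightarrow> nat" where
  "max_degree G = Max ((\<lambda>v. card (star G v)) ` gverts G)"

text \<open>
  All maps below are extensional (\<^const>\<open>undefined\<close> off their domain), so that equality
  of morphisms is equality in HOL and automorphisms form a group in the sense of HOL-Algebra.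
\<close>

record ('v, 'e, 'w, 'f) graph_map =
  vmap :: "'v \<Rightarrow> 'w"
  emap :: "'e \<Rightarrow> 'f"

definition graph_hom ::
  "('v, 'e) sgraph \<Rightarrow> ('w, 'f) sgraph \<Rightarrow> ('v, 'e, 'w, 'f) graph_map \<Rightarrow> bool" where
  "graph_hom G1 G2 \<alpha> \<longleftrightarrow>
     vmap \<alpha> \<in> gverts G1 \<rightarrow>\<^sub>E gverts G2 \<and>
     emap \<alpha> \<in> gedges G1 \<rightarrow>\<^sub>E gedges G2 \<and>
     (\<forall>e \<in> gedges G1.
        src G2 (emap \<alpha> e) = vmap \<alpha> (src G1 e) \<and>
        tgt G2 (emap \<alpha> e) = vmap \<alpha> (tgt G1 e) \<and>
        emap \<alpha> (rev_edge G1 e) = rev_edge G2 (emap \<alpha> e))"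

definition graph_comp ::
  "('u, 'd) sgraph \<Rightarrow> ('v, 'e, 'w, 'f) graph_map \<Rightarrow> ('u, 'd, 'v, 'e) graph_map \<Rightarrow>
   ('u, 'd, 'w, 'f) graph_map" where
  "graph_comp G \<beta> \<alpha> =
     \<lparr> vmap = compose (gverts G) (vmap \<beta>) (vmap \<alpha>),
       emap = compose (gedges G) (emap \<beta>) (emap \<alpha>) \<rparr>"

definition graph_aut :: "('v, 'e) sgraph \<Rightarrow> ('v, 'e, 'v, 'e) graph_map \<Rightarrow> bool" where
  "graph_aut G \<alpha> \<longleftrightarrow> graph_hom G G \<alpha> \<and>
     bij_betw (vmap \<alpha>) (gverts G) (gverts G) \<and> bij_betw (emap \<alpha>) (gedges G) (gedges G)"

definition graph_covering ::
  "('v, 'e) sgraph \<Rightarrow> ('w, 'f) sgraph \<Rightarrow> ('v, 'e, 'w, 'f) graph_map \<Rightarrow> bool" where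
  "graph_covering G1 G2 \<alpha> \<longleftrightarrow> graph_hom G1 G2 \<alpha> \<and>
     vmap \<alpha> ` gverts G1 = gverts G2 \<and> emap \<alpha> ` gedges G1 = gedges G2 \<and>
     (\<forall>v \<in> gverts G1. bij_betw (emap \<alpha>) (star G1 v) (star G2 (vmap \<alpha> v)))"

definition graph_deck ::
  "('v, 'e) sgraph \<Rightarrow> ('v, 'e, 'w, 'f) graph_map \<Rightarrow> ('v, 'e, 'v, 'e) graph_map \<Rightarrow> bool" where
  "graph_deck G \<alpha> \<gamma> \<longleftrightarrow> graph_aut G \<gamma> \<and> graph_comp G \<alpha> \<gamma> = \<alpha>"


section \<open>Categories\<close>

record ('o, 'm) cat =
  Ob :: "'o set"
  Mor :: "'m set"
  Dom :: "'m \<Rightarrow> 'o"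
  Cod :: "'m \<Rightarrow> 'o"
  Comp :: "'m \<Rightarrow> 'm \<Rightarrow> 'm"  (infixr \<open>\<cdot>\<index>\<close> 70)
  Ident :: "'o \<Rightarrow> 'm"

text \<open>\<open>g \<cdot> f\<close> means \<open>f\<close> first, and is only meaningful if \<^term>\<open>Cod C f = Dom C g\<close>.\<close>

locale category =
  fixes C :: "('o, 'm) cat" (structure)
  assumes Dom_closed: "f \<in> Mor C \<Longrightarrow> Dom C f \<in> Ob C"
    and Cod_closed: "f \<in> Mor C \<Longrightarrow> Cod C f \<in> Ob C"
    and Ident_closed: "a \<in> Ob C \<Longrightarrow> Ident C a \<in> Mor C"
    and Dom_Ident: "a \<in> Ob C \<Longrightarrow> Dom C (Ident C a) = a"
    and Cod_Ident: "a \<in> Ob C \<Longrightarrow> Cod C (Ident C a) = a"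
    and Comp_closed: "\<lbrakk>f \<in> Mor C; g \<in> Mor C; Cod C f = Dom C g\<rbrakk> \<Longrightarrow> g \<cdot> f \<in> Mor C"
    and Dom_Comp: "\<lbrakk>f \<in> Mor C; g \<in> Mor C; Cod C f = Dom C g\<rbrakk> \<Longrightarrow> Dom C (g \<cdot> f) = Dom C f"
    and Cod_Comp: "\<lbrakk>f \<in> Mor C; g \<in> Mor C; Cod C f = Dom C g\<rbrakk> \<Longrightarrow> Cod C (g \<cdot> f) = Cod C g"
    and Comp_Ident: "f \<in> Mor C \<Longrightarrow> f \<cdot> Ident C (Dom C f) = f"
    and Ident_Comp: "f \<in> Mor C \<Longrightarrow> Ident C (Cod C f) \<cdot> f = f"
    and Comp_assoc: "\<lbrakk>f \<in> Mor C; g \<in> Mor C; h \<in> Mor C; Cod C f = Dom C g; Cod C g = Dom C h\<rbrakk>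
      \<Longrightarrow> (h \<cdot> g) \<cdot> f = h \<cdot> (g \<cdot> f)"

definition wide_subcategory :: "('o, 'm) cat \<Rightarrow> 'm set \<Rightarrow> bool" where
  "wide_subcategory C M \<longleftrightarrow> M \<subseteq> Mor C \<and> (\<forall>a \<in> Ob C. Ident C a \<in> M) \<and>
     (\<forall>f \<in> M. \<forall>g \<in> M. Cod C f = Dom C g \<longrightarrow> g \<cdot>\<^bsub>C\<^esub> f \<in> M)"

definition wide_subgroupoid :: "('o, 'm) cat \<Rightarrow> 'm set \<Rightarrow> bool" where
  "wide_subgroupoid C M \<longleftrightarrow> wide_subcategory C M \<and>
     (\<forall>f \<in> M. \<exists>g \<in> M. Dom C g = Cod C f \<and> Cod C g = Dom C f \<and>
        g \<cdot>\<^bsub>C\<^esub> f = Ident C (Dom C f) \<and> f \<cdot>\<^bsub>C\<^esub> g = Ident C (Cod C f))"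

locale category_triple = category C for C :: "('o, 'm) cat" (structure) +
  fixes M1 M2 :: "'m set"
  assumes M1_subset_M2: "M1 \<subseteq> M2"
    and groupoid_M1: "wide_subgroupoid C M1"
    and subcategory_M2: "wide_subcategory C M2"

definition arrows :: "('o, 'm) cat \<Rightarrow> 'm set \<Rightarrow> 'o \<Rightarrow> 'o \<Rightarrow> 'm set" where
  "arrows C M a b = {f \<in> M. Dom C f = a \<and> Cod C f = b}"


section \<open>Graphs of objects\<close>

record ('v, 'e, 'o, 'm) goo =
  ugraph :: "('v, 'e) sgraph"
  vobj :: "'v \<Rightarrow> 'o"
  eobj :: "'e \<Rightarrow> 'o"
  \<phi>0 :: "'e \<Rightarrow> 'm"
  \<phi>1 :: "'e \<Rightarrow> 'm"

definition graph_of_objects :: "('o, 'm) cat \<Rightarrow> 'm set \<Rightarrow> ('v, 'e, 'o, 'm) goo \<Rightarrow> bool" where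
  "graph_of_objects C M2 X \<longleftrightarrow> (let G = ugraph X in
     is_graph G \<and>
     (\<forall>v \<in> gverts G. vobj X v \<in> Ob C) \<and>
     (\<forall>e \<in> gedges G.
        eobj X e \<in> Ob C \<and> eobj X e = eobj X (rev_edge G e) \<and>
        \<phi>0 X e \<in> arrows C M2 (eobj X e) (vobj X (src G e)) \<and>
        \<phi>1 X e \<in> arrows C M2 (eobj X e) (vobj X (tgt G e)) \<and>
        \<phi>0 X e = \<phi>1 X (rev_edge G e) \<and> \<phi>1 X e = \<phi>0 X (rev_edge G e)))"

text \<open>The underlying graph map \<open>umap f\<close> is usually written \<open>f\<close> with a hat.\<close>

record ('v, 'e, 'w, 'f, 'm) goo_map =
  umap :: "('v, 'e, 'w, 'f) graph_map"
  vmor :: "'v \<Rightarrow> 'm"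
  emor :: "'e \<Rightarrow> 'm"

definition goo_hom ::
  "('o, 'm) cat \<Rightarrow> 'm set \<Rightarrow> ('v, 'e, 'o, 'm) goo \<Rightarrow> ('w, 'f, 'o, 'm) goo \<Rightarrow>
   ('v, 'e, 'w, 'f, 'm) goo_map \<Rightarrow> bool" where
  "goo_hom C M1 X Y f \<longleftrightarrow> (let G = ugraph X; fv = vmap (umap f); fe = emap (umap f) in
     graph_hom G (ugraph Y) (umap f) \<and>
     vmor f \<in> (\<Pi>\<^sub>E v \<in> gverts G. arrows C M1 (vobj X v) (vobj Y (fv v))) \<and>
     emor f \<in> (\<Pi>\<^sub>E e \<in> gedges G. arrows C M1 (eobj X e) (eobj Y (fe e))) \<and>
     (\<forall>e \<in> gedges G.
        emor f e = emor f (rev_edge G e) \<and>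
        vmor f (src G e) \<cdot>\<^bsub>C\<^esub> \<phi>0 X e = \<phi>0 Y (fe e) \<cdot>\<^bsub>C\<^esub> emor f e \<and>
        vmor f (tgt G e) \<cdot>\<^bsub>C\<^esub> \<phi>1 X e = \<phi>1 Y (fe e) \<cdot>\<^bsub>C\<^esub> emor f e))"

text \<open>\<open>goo_comp C X g f\<close> is \<open>g\<close> after \<open>f\<close>, where \<open>X\<close> is the domain of \<open>f\<close>.\<close>

definition goo_comp ::
  "('o, 'm) cat \<Rightarrow> ('u, 'd, 'o, 'm) goo \<Rightarrow> ('v, 'e, 'w, 'f, 'm) goo_map \<Rightarrow>
   ('u, 'd, 'v, 'e, 'm) goo_map \<Rightarrow> ('u, 'd, 'w, 'f, 'm) goo_map" where
  "goo_comp C X g f =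
     \<lparr> umap = graph_comp (ugraph X) (umap g) (umap f),
       vmor = (\<lambda>v \<in> gverts (ugraph X). vmor g (vmap (umap f) v) \<cdot>\<^bsub>C\<^esub> vmor f v),
       emor = (\<lambda>e \<in> gedges (ugraph X). emor g (emap (umap f) e) \<cdot>\<^bsub>C\<^esub> emor f e) \<rparr>"

definition goo_id :: "('o, 'm) cat \<Rightarrow> ('v, 'e, 'o, 'm) goo \<Rightarrow> ('v, 'e, 'v, 'e, 'm) goo_map" where
  "goo_id C X =
     \<lparr> umap = \<lparr> vmap = (\<lambda>v \<in> gverts (ugraph X). v), emap = (\<lambda>e \<in> gedges (ugraph X). e) \<rparr>,
       vmor = (\<lambda>v \<in> gverts (ugraph X). Ident C (vobj X v)),
       emor = (\<lambda>e \<in> gedges (ugraph X). Ident C (eobj X e)) \<rparr>"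

definition goo_covering ::
  "('o, 'm) cat \<Rightarrow> 'm set \<Rightarrow> ('v, 'e, 'o, 'm) goo \<Rightarrow> ('w, 'f, 'o, 'm) goo \<Rightarrow>
   ('v, 'e, 'w, 'f, 'm) goo_map \<Rightarrow> bool" where
  "goo_covering C M1 X Y f \<longleftrightarrow>
     goo_hom C M1 X Y f \<and> graph_covering (ugraph X) (ugraph Y) (umap f)"

definition goo_Aut ::
  "('o, 'm) cat \<Rightarrow> 'm set \<Rightarrow> ('v, 'e, 'o, 'm) goo \<Rightarrow> ('v, 'e, 'v, 'e, 'm) goo_map monoid" where
  "goo_Aut C M1 X =
     \<lparr> carrier = {f. goo_hom C M1 X X f \<and> graph_aut (ugraph X) (umap f)},
       monoid.mult = goo_comp C X,
       one = goo_id C X \<rparr>"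

text \<open>
  \<open>is_deck_lift C M1 X f \<gamma> g\<close> says that \<open>g\<close> has the defining property of the automorphism
  \<open>\<rho>(\<gamma>)\<close> of \<open>X\<close> attached to the deck transformation \<open>\<gamma>\<close> of the graph covering underlying \<open>f\<close>.
  For a covering \<open>f\<close> there is exactly one such \<open>g\<close> for each \<open>\<gamma>\<close>, so that
  \<open>deck_transformations\<close> below is the set of all \<open>\<rho>(\<gamma>)\<close>.
\<close>

definition is_deck_lift ::
  "('o, 'm) cat \<Rightarrow> 'm set \<Rightarrow> ('v, 'e, 'o, 'm) goo \<Rightarrow> ('v, 'e, 'w, 'f, 'm) goo_map \<Rightarrow>
   ('v, 'e, 'v, 'e) graph_map \<Rightarrow> ('v, 'e, 'v, 'e, 'm) goo_map \<Rightarrow> bool" where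
  "is_deck_lift C M1 X f \<gamma> g \<longleftrightarrow>
     g \<in> carrier (goo_Aut C M1 X) \<and> umap g = \<gamma> \<and>
     (\<forall>v \<in> gverts (ugraph X). vmor f v = vmor f (vmap \<gamma> v) \<cdot>\<^bsub>C\<^esub> vmor g v) \<and>
     (\<forall>e \<in> gedges (ugraph X). emor f e = emor f (emap \<gamma> e) \<cdot>\<^bsub>C\<^esub> emor g e)"

definition deck_transformations ::
  "('o, 'm) cat \<Rightarrow> 'm set \<Rightarrow> ('v, 'e, 'o, 'm) goo \<Rightarrow> ('v, 'e, 'w, 'f, 'm) goo_map \<Rightarrow>
   ('v, 'e, 'v, 'e, 'm) goo_map set" where
  "deck_transformations C M1 X f =
     {g. \<exists>\<gamma>. graph_deck (ugraph X) (umap f) \<gamma> \<and> is_deck_lift C M1 X f \<gamma> g}"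

definition isotropy :: "('v, 'e, 'v, 'e, 'm) goo_map set \<Rightarrow> 'e \<Rightarrow> 'm set" where
  "isotropy H e = {emor h e | h. h \<in> H \<and> emap (umap h) e = e}"

definition finite_edge_isotropy ::
  "('v, 'e, 'o, 'm) goo \<Rightarrow> ('v, 'e, 'v, 'e, 'm) goo_map set \<Rightarrow> bool" where
  "finite_edge_isotropy X H \<longleftrightarrow> (\<forall>e \<in> gedges (ugraph X). finite (isotropy H e))"

definition sym_restricted_closure ::
  "('o, 'm) cat \<Rightarrow> 'm set \<Rightarrow> ('v, 'e, 'o, 'm) goo \<Rightarrow> ('v, 'e, 'v, 'e, 'm) goo_map set \<Rightarrow>
   ('v, 'e, 'v, 'e, 'm) goo_map set" where
  "sym_restricted_closure C M1 X H = {g \<in> carrier (goo_Aut C M1 X).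
     (\<forall>e \<in> gedges (ugraph X). \<exists>h \<in> H. emap (umap g) e = emap (umap h) e \<and> emor g e = emor h e) \<and>
     (\<forall>v \<in> gverts (ugraph X). \<exists>h \<in> H. vmap (umap g) v = vmap (umap h) v \<and> vmor g v = vmor h v)}"

end

theory Submission
  imports Defs "HOL-Computational_Algebra.Primes" "HOL-Combinatorics.Permutations"
begin

text \<open>
For an element \<open>h\<close> of \<open>H\<close> and a vertex \<open>v\<close> of the tree \<open>T\<close>, the composite of \<open>h\<close> with the second
covering \<open>f2\<close> is compared with the first covering \<open>f1\<close> on the star of \<open>v\<close>. An edge \<open>e\<close> of the star
yields its type: the edges \<open>f1 e\<close> and \<open>f2 (h e)\<close> together with the morphism from the object of the
former to that of the latter. The germ of \<open>h\<close> at \<open>v\<close> consists of the vertices \<open>f1 v\<close> and \<open>f2 (h v)\<close>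
and of the set of types of the star. Vertex isotropy may be infinite, but a germ only records
edge components, so finite edge isotropy leaves finitely many germs.

Germs are glued as in the proof of Leighton's theorem for plain graphs. The vertices are copies of
germs, the darts at a germ are its types, and a dart is glued to a dart of the reversed type
(\<open>glue_germs\<close>). The result is a finite graph of objects that maps to both quotients by maps that are
bijective on stars. Gluing is possible if every type occurs as often as its reverse, and the number
of copies is chosen for this. Let \<open>c\<close> be a common multiple of the numbers \<open>\<sigma> w\<close> of germs into a
vertex \<open>w\<close> of the second quotient, and take \<open>c / \<sigma> w\<close> copies of each germ into \<open>w\<close>. Precomposition
with elements of \<open>H\<close> shows that all types over one edge \<open>e2\<close> starting at \<open>w\<close> lie in equally many
germs, and each germ into \<open>w\<close> contains exactly one of them. Hence each occurs \<open>c / N e2\<close> times, where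
\<open>N e2\<close> is the number of types over \<open>e2\<close>, and reversal shows that \<open>N\<close> agrees on \<open>e2\<close> and its inverse
(\<open>germs_labelling\<close>).

Since \<open>T\<close> is a tree, \<open>f1\<close> lifts to the glued graph, and the common cover is the image of the lift.
Composing the lift with the map to the second quotient gives a map from \<open>T\<close> that differs from \<open>f2\<close>
by an automorphism \<open>g\<close> of \<open>T\<close> (\<open>common_cover_of_glued\<close>). Every germ comes from an element of \<open>H\<close>, and
\<open>H\<close> contains both deck groups, so \<open>g\<close> agrees on each vertex and on each edge with an element of \<open>H\<close>
(\<open>closure_vertex\<close>, \<open>closure_edge\<close>).

The glued graph has \<open>c\<close> times as many vertices as the second quotient, so a small \<open>c\<close> is wanted. The
number \<open>\<sigma> w\<close> is the number of vertices of the first quotient in the \<open>H\<close>-class of \<open>w\<close>, times the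
number of germs at one vertex. The latter divides \<open>d! * L ^ d\<close> because the germs of a vertex
stabiliser act freely on a set whose size is a divisor of this (\<open>germs_at_finite_dvd\<close>). As for the former, the sizes of
adjacent classes have a ratio of two numbers that are at most \<open>d\<close>; hence all class sizes have the
same multiplicity at primes beyond \<open>d\<close>, and one of them times a product of at most \<open>(d + 1) / 2\<close>
prime powers, each at most \<open>V\<close>, is a common multiple. Finally \<open>V ^ (d / 2) \<le> d! * exp (sqrt V)\<close> is
a single term of the exponential series.
\<close>

section \<open>Graph homomorphisms and lifting from trees\<close>

lemma is_graphD:
  assumes "is_graph G" "e \<in> gedges G"
  shows "src G e \<in> gverts G" "tgt G e \<in> gverts G" "rev_edge G e \<in> gedges G"
    "rev_edge G e \<noteq> e" "src G (rev_edge G e) = tgt G e" "tgt G (rev_edge G e) = src G e"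
proof -
  interpret bidirected_digraph "dig G" "rev_edge G" using assms(1) by (simp add: is_graph_def)
  show "src G e \<in> gverts G" "tgt G e \<in> gverts G" "rev_edge G e \<in> gedges G"
    "rev_edge G e \<noteq> e" "src G (rev_edge G e) = tgt G e" "tgt G (rev_edge G e) = src G e"
    using assms(2) arev_neq by auto
qed

lemma rev_rev_edge: "is_graph G \<Longrightarrow> rev_edge G (rev_edge G e) = e"
  unfolding is_graph_def by (simp add: bidirected_digraph.arev_arev)

lemma is_graph_wf: "is_graph G \<Longrightarrow> wf_digraph (dig G)"
  unfolding is_graph_def bidirected_digraph_def by blast

lemma graph_homD:
  assumes "graph_hom G1 G2 \<alpha>"
  shows "v \<in> gverts G1 \<Longrightarrow> vmap \<alpha> v \<in> gverts G2"
    "e \<in> gedges G1 \<Longrightarrow> emap \<alpha> e \<in> gedges G2"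
    "e \<in> gedges G1 \<Longrightarrow> src G2 (emap \<alpha> e) = vmap \<alpha> (src G1 e)"
    "e \<in> gedges G1 \<Longrightarrow> tgt G2 (emap \<alpha> e) = vmap \<alpha> (tgt G1 e)"
    "e \<in> gedges G1 \<Longrightarrow> emap \<alpha> (rev_edge G1 e) = rev_edge G2 (emap \<alpha> e)"
  using assms unfolding graph_hom_def by (auto simp: PiE_def Pi_def)

lemma graph_hom_ext:
  assumes "graph_hom G1 G2 \<alpha>" "graph_hom G1 G3 \<beta>"
    and "\<And>v. v \<in> gverts G1 \<Longrightarrow> vmap \<alpha> v = vmap \<beta> v"
    and "\<And>e. e \<in> gedges G1 \<Longrightarrow> emap \<alpha> e = emap \<beta> e"
  shows "\<alpha> = \<beta>"
proof (rule graph_map.equality)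
  show "vmap \<alpha> = vmap \<beta>" "emap \<alpha> = emap \<beta>"
    using assms unfolding graph_hom_def by (auto intro!: extensionalityI simp: PiE_def)
qed simp

lemma graph_comp_apply [simp]:
  "v \<in> gverts G \<Longrightarrow> vmap (graph_comp G \<beta> \<alpha>) v = vmap \<beta> (vmap \<alpha> v)"
  "e \<in> gedges G \<Longrightarrow> emap (graph_comp G \<beta> \<alpha>) e = emap \<beta> (emap \<alpha> e)"
  by (simp_all add: graph_comp_def compose_def)

lemma graph_hom_comp:
  assumes "is_graph G1" "graph_hom G1 G2 \<alpha>" "graph_hom G2 G3 \<beta>"
  shows "graph_hom G1 G3 (graph_comp G1 \<beta> \<alpha>)"
  using assms(2,3) is_graphD[OF assms(1)]
  by (auto simp: graph_hom_def graph_comp_def compose_def PiE_def Pi_def)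

text \<open>
A covering without surjectivity. Lifting only needs this much, and lifts to a graph whose
components are unknown only have this much.
\<close>

definition local_iso ::
  "('v, 'e) sgraph \<Rightarrow> ('w, 'f) sgraph \<Rightarrow> ('v, 'e, 'w, 'f) graph_map \<Rightarrow> bool" where
  "local_iso G1 G2 \<alpha> \<longleftrightarrow> graph_hom G1 G2 \<alpha> \<and>
     (\<forall>v \<in> gverts G1. bij_betw (emap \<alpha>) (star G1 v) (star G2 (vmap \<alpha> v)))"

lemma local_iso_of_covering: "graph_covering G1 G2 \<alpha> \<Longrightarrow> local_iso G1 G2 \<alpha>"
  by (simp add: graph_covering_def local_iso_def)

lemma local_iso_comp:
  assumes "is_graph G1" "local_iso G1 G2 \<alpha>" "local_iso G2 G3 \<beta>"
  shows "local_iso G1 G3 (graph_comp G1 \<beta> \<alpha>)"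
  unfolding local_iso_def
proof (intro conjI ballI)
  show "graph_hom G1 G3 (graph_comp G1 \<beta> \<alpha>)"
    using assms by (auto simp: local_iso_def intro: graph_hom_comp)
  fix v assume v: "v \<in> gverts G1"
  have "bij_betw (emap \<beta> \<circ> emap \<alpha>) (star G1 v) (star G3 (vmap \<beta> (vmap \<alpha> v)))"
    using assms v by (intro bij_betw_trans[of _ _ "star G2 (vmap \<alpha> v)"])
      (auto simp: local_iso_def graph_hom_def PiE_def Pi_def)
  then show "bij_betw (emap (graph_comp G1 \<beta> \<alpha>)) (star G1 v)
      (star G3 (vmap (graph_comp G1 \<beta> \<alpha>) v))"
    using v by (subst bij_betw_cong[of _ _ "emap \<beta> \<circ> emap \<alpha>"]) auto
qed

lemma local_iso_cancel:
  assumes "is_graph G1" "graph_hom G1 G2 \<gamma>" "local_iso G2 G3 \<beta>"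
    "local_iso G1 G3 (graph_comp G1 \<beta> \<gamma>)"
  shows "local_iso G1 G2 \<gamma>"
  unfolding local_iso_def
proof (intro conjI ballI)
  show "graph_hom G1 G2 \<gamma>" by fact
  fix v assume v: "v \<in> gverts G1"
  have *: "bij_betw (emap (graph_comp G1 \<beta> \<gamma>)) (star G1 v) (star G3 (vmap \<beta> (vmap \<gamma> v)))"
    using assms(4) v by (auto simp: local_iso_def)
  have **: "bij_betw (emap \<beta> \<circ> emap \<gamma>) (star G1 v) (star G3 (vmap \<beta> (vmap \<gamma> v)))"
    using * by (subst bij_betw_cong[of _ _ "emap (graph_comp G1 \<beta> \<gamma>)"]) auto
  have b: "bij_betw (emap \<beta>) (star G2 (vmap \<gamma> v)) (star G3 (vmap \<beta> (vmap \<gamma> v)))"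
    using assms(2,3) v by (auto simp: local_iso_def graph_homD)
  have "emap \<gamma> ` star G1 v \<subseteq> star G2 (vmap \<gamma> v)"
    using graph_homD[OF assms(2)] by auto
  then show "bij_betw (emap \<gamma>) (star G1 v) (star G2 (vmap \<gamma> v))"
    using bij_betw_comp_iff2[OF b] ** by auto
qed

text \<open>
If a vertex is repeated, a shorter closed walk can be cut out. Otherwise the walk is a cycle, and
since it is not a circuit it backtracks cyclically. A backtrack from the last edge to the first is
removed by stripping both, which again leaves a shorter closed walk.
\<close>

lemma tree_closed_walk_backtracks:
  assumes "is_tree G" "pre_digraph.awalk (dig G) u p u" "p \<noteq> []"
  shows "\<exists>q e r. p = q @ e # rev_edge G e # r"
  using assms(2,3)
proof (induction p arbitrary: u rule: length_induct)
  case (1 p)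
  have g: "is_graph G" using assms(1) by (simp add: is_tree_def)
  interpret wf_digraph "dig G" using is_graph_wf[OF g] .
  obtain e es where p: "p = e # es" using 1 by (cases p) auto
  show ?case
  proof (cases "distinct (tl (awalk_verts u p))")
    case True
    then have "cycle p" using 1 by (auto simp: cycle_def)
    then obtain i where i: "i < length p" "p ! (Suc i mod length p) = rev_edge G (p ! i)"
      using assms(1) unfolding is_tree_def circuit_def by blast
    show ?thesis
    proof (cases "Suc i < length p")
      case True
      then have "p = take i p @ p ! i # p ! Suc i # drop (Suc (Suc i)) p"
        by (simp add: Cons_nth_drop_Suc)
      then show ?thesis using i True by (metis mod_less)
    next
      case False
      then have il: "Suc i = length p" using i by simp
      have e: "e = rev_edge G (last p)"
        using i(2) il p by (metis diff_Suc_1 last_conv_nth mod_self nth_Cons_0 list.distinct(1))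
      have ein: "e \<in> gedges G" using 1 p by (auto simp: awalk_Cons_iff)
      have "es \<noteq> []"
        using e p is_graphD(4)[OF g ein] by auto
      then obtain es' l where es: "es = es' @ [l]" by (metis rev_exhaust)
      have l: "l = rev_edge G e" using e p es rev_rev_edge[OF g] by simp
      show ?thesis
      proof (cases "es' = []")
        case True
        then show ?thesis using p es l by force
      next
        case False
        have a: "awalk (tgt G e) es' (awlast (tgt G e) es')" "src G l = awlast (tgt G e) es'"
          using 1(2) p es by (auto simp: awalk_Cons_iff)
        have "src G l = tgt G e" using l is_graphD(5)[OF g ein] by simp
        then have "awalk (tgt G e) es' (tgt G e)" using a by simp
        moreover have "length es' < length p" using p es by simp
        ultimately obtain q f r where "es' = q @ f # rev_edge G f # r" using 1(1) False by blast
        then have "p = (e # q) @ f # rev_edge G f # (r @ [l])" using p es by simp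
        then show ?thesis by blast
      qed
    qed
  next
    case False
    then have nd: "\<not> distinct (awalk_verts (tgt G e) es)" using p by simp
    have "awalk (tgt G e) es u" using 1(2) p by (auto simp: awalk_Cons_iff)
    from awalk_not_distinct_decomp[OF this nd] obtain q r s w where
      d: "es = q @ r @ s" "awalk w r w" "r \<noteq> []" by auto
    have "length r < length p" using d p by simp
    then obtain q' f r' where "r = q' @ f # rev_edge G f # r'" using 1(1) d by blast
    then have "p = (e # q @ q') @ f # rev_edge G f # (r' @ s)" using p d by simp
    then show ?thesis by blast
  qed
qed

lemma tree_walk_exists:
  assumes "is_tree G" "u \<in> gverts G" "v \<in> gverts G"
  shows "\<exists>p. pre_digraph.awalk (dig G) u p v"
proof -
  have b: "bidirected_digraph (dig G) (rev_edge G)"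
    using assms(1) by (auto simp: is_tree_def is_graph_def)
  interpret bidirected_digraph "dig G" "rev_edge G" by (fact b)
  have "strongly_connected (dig G)"
    using symmetric_connected_imp_strongly_connected sym_arcs assms(1) by (auto simp: is_tree_def)
  then show ?thesis using assms reachable_awalk by (auto simp: strongly_connected_def)
qed

lemma tree_induct [consumes 3, case_names base edge]:
  assumes "is_tree G" "u \<in> gverts G" "v \<in> gverts G"
    and "P u" "\<And>e. e \<in> gedges G \<Longrightarrow> P (src G e) \<Longrightarrow> P (tgt G e)"
  shows "P v"
proof -
  have g: "is_graph G" using assms(1) by (simp add: is_tree_def)
  interpret wf_digraph "dig G" using is_graph_wf[OF g] .
  obtain p where "awalk u p v" using tree_walk_exists[OF assms(1-3)] by blast
  then show ?thesis using assms(4)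
    by (induction p arbitrary: u) (auto simp: awalk_simps assms(5))
qed

definition lift_edge ::
  "('v, 'e) sgraph \<Rightarrow> ('v, 'e, 'w, 'f) graph_map \<Rightarrow> 'v \<Rightarrow> 'f \<Rightarrow> 'e" where
  "lift_edge A \<beta> a b = (THE f. f \<in> star A a \<and> emap \<beta> f = b)"

lemma lift_edge_eqI:
  assumes "local_iso A B \<beta>" "a \<in> gverts A" "f \<in> star A a" "emap \<beta> f = b"
  shows "lift_edge A \<beta> a b = f"
  unfolding lift_edge_def
proof (rule the_equality)
  fix f' assume "f' \<in> star A a \<and> emap \<beta> f' = b"
  then show "f' = f" using assms
    by (auto simp: local_iso_def bij_betw_def inj_on_def)
qed (use assms in auto)

lemma lift_edge:
  assumes "local_iso A B \<beta>" "a \<in> gverts A" "b \<in> star B (vmap \<beta> a)"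
  shows "lift_edge A \<beta> a b \<in> gedges A" "src A (lift_edge A \<beta> a b) = a"
    "emap \<beta> (lift_edge A \<beta> a b) = b"
proof -
  have "b \<in> emap \<beta> ` star A a" using assms by (auto simp: local_iso_def bij_betw_def)
  then obtain f where f: "f \<in> star A a" "emap \<beta> f = b" by blast
  then show "lift_edge A \<beta> a b \<in> gedges A" "src A (lift_edge A \<beta> a b) = a"
    "emap \<beta> (lift_edge A \<beta> a b) = b"
    using lift_edge_eqI[OF assms(1,2) f] by auto
qed

text \<open>
The end of the lift along \<open>\<beta>\<close>, started at \<open>a\<close>, of the image of a walk under \<open>\<alpha>\<close>.
\<close>

fun lift_end where
  "lift_end A \<beta> \<alpha> a [] = a"
| "lift_end A \<beta> \<alpha> a (e # p) = lift_end A \<beta> \<alpha> (tgt A (lift_edge A \<beta> a (emap \<alpha> e))) p"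

lemma lift_end_append:
  "lift_end A \<beta> \<alpha> a (p @ q) = lift_end A \<beta> \<alpha> (lift_end A \<beta> \<alpha> a p) q"
  by (induction p arbitrary: a) auto

context
  fixes T :: "('v, 'e) sgraph" and A :: "('w, 'f) sgraph" and B :: "('x, 'g) sgraph" and \<alpha> \<beta>
  assumes tree: "is_tree T" and grA: "is_graph A"
    and hom: "graph_hom T B \<alpha>" and loc: "local_iso A B \<beta>"
begin

private lemma T_graph: "is_graph T"
  using tree by (simp add: is_tree_def)

interpretation wf_digraph "dig T" using is_graph_wf[OF T_graph] .

private lemma step:
  assumes "a \<in> gverts A" "e \<in> gedges T" "vmap \<beta> a = vmap \<alpha> (src T e)"
  defines "f \<equiv> lift_edge A \<beta> a (emap \<alpha> e)"
  shows "f \<in> gedges A" "src A f = a" "emap \<beta> f = emap \<alpha> e" "tgt A f \<in> gverts A"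
    "vmap \<beta> (tgt A f) = vmap \<alpha> (tgt T e)"
proof -
  have "emap \<alpha> e \<in> star B (vmap \<beta> a)" using assms graph_homD[OF hom] by auto
  from lift_edge[OF loc assms(1) this]
  show *: "f \<in> gedges A" "src A f = a" "emap \<beta> f = emap \<alpha> e" by (auto simp: f_def)
  show "tgt A f \<in> gverts A" using * is_graphD[OF grA] by auto
  show "vmap \<beta> (tgt A f) = vmap \<alpha> (tgt T e)"
    using * graph_homD[OF hom] loc graph_homD[of A B \<beta>] assms(2)
    by (metis local_iso_def)
qed

private lemma lift_end_in:
  assumes "awalk u p v" "a \<in> gverts A" "vmap \<beta> a = vmap \<alpha> u"
  shows "lift_end A \<beta> \<alpha> a p \<in> gverts A" "vmap \<beta> (lift_end A \<beta> \<alpha> a p) = vmap \<alpha> v"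
  using assms by (induction p arbitrary: u a) (auto simp: awalk_simps step)

private lemma backtrack:
  assumes "a \<in> gverts A" "e \<in> gedges T" "vmap \<beta> a = vmap \<alpha> (src T e)"
  shows "lift_end A \<beta> \<alpha> a [e, rev_edge T e] = a"
proof -
  define f where "f = lift_edge A \<beta> a (emap \<alpha> e)"
  note s = step[OF assms, folded f_def]
  have b: "graph_hom A B \<beta>" using loc by (simp add: local_iso_def)
  have "lift_edge A \<beta> (tgt A f) (emap \<alpha> (rev_edge T e)) = rev_edge A f"
    by (rule lift_edge_eqI[OF loc])
      (use s is_graphD[OF grA, of f] graph_homD[OF b] graph_homD[OF hom] assms in auto)
  then show ?thesis using s is_graphD[OF grA, of f] by (simp add: f_def[symmetric])
qed

text \<open>
Closed walks in a tree reduce to the empty walk by deleting backtracks, and such a deletion does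
not move the end of the lift.
\<close>

private lemma lift_closed:
  assumes "awalk u p u" "a \<in> gverts A" "vmap \<beta> a = vmap \<alpha> u"
  shows "lift_end A \<beta> \<alpha> a p = a"
  using assms(1)
proof (induction p rule: length_induct)
  case (1 p)
  show ?case
  proof (cases "p = []")
    case False
    then obtain q e r where p: "p = q @ e # rev_edge T e # r"
      using tree_closed_walk_backtracks[OF tree 1(2)] by blast
    have w: "awalk u q (src T e)" "e \<in> gedges T" "awalk (tgt T (rev_edge T e)) r u"
      using 1(2) p by (auto simp: awalk_Cons_iff)
    have w3: "awalk (src T e) r u" using w is_graphD(6)[OF T_graph] by simp
    have "awalk u (q @ r) u" using w(1) w3 awalk_appendI by blast
    moreover have "length (q @ r) < length p" using p by simp
    ultimately have "lift_end A \<beta> \<alpha> a (q @ r) = a" using 1(1) by blast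
    moreover have "lift_end A \<beta> \<alpha> (lift_end A \<beta> \<alpha> a q) [e, rev_edge T e] = lift_end A \<beta> \<alpha> a q"
      using lift_end_in[OF w(1) assms(2,3)] w by (intro backtrack) auto
    ultimately show ?thesis using p
      by (simp add: lift_end_append)
  qed simp
qed

private lemma walk_rev:
  assumes "awalk u p v"
  shows "\<exists>q. awalk v q u"
  using tree_walk_exists[OF tree] assms awalk_hd_in_verts awalk_last_in_verts by blast

private lemma lift_end_unique:
  assumes "awalk u p v" "awalk u q v" "a \<in> gverts A" "vmap \<beta> a = vmap \<alpha> u"
  shows "lift_end A \<beta> \<alpha> a p = lift_end A \<beta> \<alpha> a q"
proof -
  obtain r where r: "awalk v r u" using walk_rev[OF assms(1)] by blast
  define b where "b = lift_end A \<beta> \<alpha> a p"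
  have b: "b \<in> gverts A" "vmap \<beta> b = vmap \<alpha> v"
    using lift_end_in[OF assms(1,3,4)] by (auto simp: b_def)
  have "lift_end A \<beta> \<alpha> a (p @ r) = a"
    using assms(1) r awalk_appendI assms(3,4) by (intro lift_closed) auto
  then have "lift_end A \<beta> \<alpha> b r = a" by (simp add: lift_end_append b_def)
  moreover have "lift_end A \<beta> \<alpha> b (r @ q) = b"
    using awalk_appendI[OF r assms(2)] b by (intro lift_closed) auto
  ultimately show ?thesis by (simp add: lift_end_append b_def)
qed

text \<open>
A vertex is sent to the end of the lift of any walk from \<open>r\<close> to it. The choice of the walk does not
matter, because closed walks lift to closed walks.
\<close>

theorem tree_lift_exists:
  assumes r: "r \<in> gverts T" "a \<in> gverts A" "vmap \<beta> a = vmap \<alpha> r"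
  shows "\<exists>\<gamma>. graph_hom T A \<gamma> \<and> graph_comp T \<beta> \<gamma> = \<alpha> \<and> vmap \<gamma> r = a"
proof -
  define w where "w v = (SOME p. awalk r p v)" for v
  have w: "awalk r (w v) v" if "v \<in> gverts T" for v
    unfolding w_def using tree_walk_exists[OF tree r(1) that] by (rule someI_ex)
  define V where "V v = lift_end A \<beta> \<alpha> a (w v)" for v
  define E where "E e = lift_edge A \<beta> (V (src T e)) (emap \<alpha> e)" for e
  define \<gamma> where "\<gamma> = \<lparr>vmap = restrict V (gverts T), emap = restrict E (gedges T)\<rparr>"
  have V: "V v \<in> gverts A" "vmap \<beta> (V v) = vmap \<alpha> v" if "v \<in> gverts T" for v
    using lift_end_in[OF w[OF that] r(2,3)] by (auto simp: V_def)
  have E: "E e \<in> gedges A" "src A (E e) = V (src T e)" "emap \<beta> (E e) = emap \<alpha> e"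
    "tgt A (E e) = V (tgt T e)" if e: "e \<in> gedges T" for e
  proof -
    note s = is_graphD[OF T_graph e]
    show "E e \<in> gedges A" "src A (E e) = V (src T e)" "emap \<beta> (E e) = emap \<alpha> e"
      using step[OF V(1)[OF s(1)] e V(2)[OF s(1)]] by (auto simp: E_def)
    have "awalk r (w (src T e) @ [e]) (tgt T e)"
      using w[OF s(1)] e awalk_appendI arc_implies_awalk
      by (auto simp: awalk_simps intro!: awalk_appendI)
    from lift_end_unique[OF this w[OF s(2)] r(2,3)]
    show "tgt A (E e) = V (tgt T e)" by (simp add: lift_end_append V_def E_def)
  qed
  have b: "graph_hom A B \<beta>" using loc by (simp add: local_iso_def)
  have R: "E (rev_edge T e) = rev_edge A (E e)" if e: "e \<in> gedges T" for e
  proof -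
    note s = is_graphD[OF T_graph e] and t = is_graphD[OF grA E(1)[OF e]]
    show ?thesis
      unfolding E_def[of "rev_edge T e"]
      by (rule lift_edge_eqI[OF loc])
        (use s t E[OF e] V graph_homD[OF hom] graph_homD[OF b] e in auto)
  qed
  have "graph_hom T A \<gamma>"
    using V E R is_graphD[OF T_graph] by (auto simp: graph_hom_def \<gamma>_def)
  moreover have "graph_comp T \<beta> \<gamma> = \<alpha>"
    by (rule graph_hom_ext[OF graph_hom_comp[OF T_graph \<open>graph_hom T A \<gamma>\<close> b] hom])
      (use V E in \<open>auto simp: \<gamma>_def\<close>)
  moreover have "V r = a"
    using lift_closed[OF w[OF r(1)] r(2,3)] by (simp add: V_def)
  ultimately show ?thesis using r(1) by (auto simp: \<gamma>_def)
qed

end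

theorem tree_lift_unique:
  assumes "is_tree T" "local_iso A B \<beta>" "graph_hom T A \<gamma>" "graph_hom T A \<delta>"
    and "graph_comp T \<beta> \<gamma> = graph_comp T \<beta> \<delta>"
    and "r \<in> gverts T" "vmap \<gamma> r = vmap \<delta> r"
  shows "\<gamma> = \<delta>"
proof -
  have g: "is_graph T" using assms(1) by (simp add: is_tree_def)
  have e: "emap \<gamma> e = emap \<delta> e"
    if "e \<in> gedges T" "vmap \<gamma> (src T e) = vmap \<delta> (src T e)" for e
  proof -
    have "emap \<beta> (emap \<gamma> e) = emap \<beta> (emap \<delta> e)"
      using assms(5) that(1) by (metis graph_comp_apply(2))
    moreover have "inj_on (emap \<beta>) (star A (vmap \<gamma> (src T e)))"
      using assms(2) graph_homD(1)[OF assms(3)] is_graphD(1)[OF g that(1)]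
      by (auto simp: local_iso_def bij_betw_def)
    ultimately show ?thesis
      using graph_homD[OF assms(3)] graph_homD[OF assms(4)] that by (auto dest: inj_onD)
  qed
  have v: "vmap \<gamma> v = vmap \<delta> v" if "v \<in> gverts T" for v
    using assms(1,6) that
  proof (induction rule: tree_induct)
    case (edge f)
    then show ?case
      using e[OF edge] graph_homD(4)[OF assms(3)] graph_homD(4)[OF assms(4)] by metis
  qed (fact assms(7))
  show ?thesis
    by (rule graph_hom_ext[OF assms(3,4)]) (use v e is_graphD[OF g] in auto)
qed

definition graph_id :: "('v, 'e) sgraph \<Rightarrow> ('v, 'e, 'v, 'e) graph_map" where
  "graph_id G = \<lparr>vmap = (\<lambda>v \<in> gverts G. v), emap = (\<lambda>e \<in> gedges G. e)\<rparr>"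

lemma graph_hom_id: "is_graph G \<Longrightarrow> graph_hom G G (graph_id G)"
  by (auto simp: graph_hom_def graph_id_def is_graphD)

lemma graph_comp_id: "graph_hom G G2 \<alpha> \<Longrightarrow> is_graph G \<Longrightarrow> graph_comp G \<alpha> (graph_id G) = \<alpha>"
  by (rule graph_hom_ext[of G G2 _ G2]) (auto simp: graph_id_def intro: graph_hom_comp graph_hom_id[unfolded graph_id_def])

lemma graph_comp_assoc:
  assumes "graph_hom G G1 \<alpha>"
  shows "graph_comp G (graph_comp G1 \<gamma> \<beta>) \<alpha> = graph_comp G \<gamma> (graph_comp G \<beta> \<alpha>)"
  unfolding graph_comp_def using assms by (auto simp: compose_def graph_homD fun_eq_iff)

text \<open>
Each of the two maps lifts along the other. The composites of these lifts are lifts of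
\<open>\<alpha>\<close> and \<open>\<beta>\<close> along themselves with a fixed point, so uniqueness makes them the identity.
\<close>

theorem tree_lift_aut:
  assumes T: "is_tree T" and \<alpha>: "local_iso T B \<alpha>" and \<beta>: "local_iso T B \<beta>"
    and r: "r \<in> gverts T" "a \<in> gverts T" "vmap \<beta> a = vmap \<alpha> r"
  shows "\<exists>\<gamma>. graph_aut T \<gamma> \<and> graph_comp T \<beta> \<gamma> = \<alpha> \<and> vmap \<gamma> r = a"
proof -
  have g: "is_graph T" using T by (simp add: is_tree_def)
  have ah: "graph_hom T B \<alpha>" and bh: "graph_hom T B \<beta>" using \<alpha> \<beta> by (auto simp: local_iso_def)
  obtain \<gamma> where \<gamma>: "graph_hom T T \<gamma>" "graph_comp T \<beta> \<gamma> = \<alpha>" "vmap \<gamma> r = a"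
    using tree_lift_exists[OF T g ah \<beta> r] by blast
  obtain \<delta> where \<delta>: "graph_hom T T \<delta>" "graph_comp T \<alpha> \<delta> = \<beta>" "vmap \<delta> a = r"
    using tree_lift_exists[OF T g bh \<alpha> r(2,1)] r(3) by auto
  have 1: "graph_comp T \<delta> \<gamma> = graph_id T"
  proof (rule tree_lift_unique[OF T \<alpha> graph_hom_comp[OF g \<gamma>(1) \<delta>(1)] graph_hom_id[OF g] _ r(1)])
    show "graph_comp T \<alpha> (graph_comp T \<delta> \<gamma>) = graph_comp T \<alpha> (graph_id T)"
      using graph_comp_assoc[OF \<gamma>(1), of \<alpha> \<delta>] \<gamma>(2) \<delta>(2) graph_comp_id[OF ah g] by simp
  qed (use r(1) \<gamma>(3) \<delta>(3) in \<open>simp add: graph_id_def\<close>)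
  have 2: "graph_comp T \<gamma> \<delta> = graph_id T"
  proof (rule tree_lift_unique[OF T \<beta> graph_hom_comp[OF g \<delta>(1) \<gamma>(1)] graph_hom_id[OF g] _ r(2)])
    show "graph_comp T \<beta> (graph_comp T \<gamma> \<delta>) = graph_comp T \<beta> (graph_id T)"
      using graph_comp_assoc[OF \<delta>(1), of \<beta> \<gamma>] \<gamma>(2) \<delta>(2) graph_comp_id[OF bh g] by simp
  qed (use r(2) \<gamma>(3) \<delta>(3) in \<open>simp add: graph_id_def\<close>)
  have "vmap \<delta> (vmap \<gamma> v) = v" "vmap \<gamma> (vmap \<delta> v) = v" if "v \<in> gverts T" for v
    using arg_cong[OF 1, of "\<lambda>x. vmap x v"] arg_cong[OF 2, of "\<lambda>x. vmap x v"] that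
    by (auto simp: graph_id_def)
  then have "bij_betw (vmap \<gamma>) (gverts T) (gverts T)"
    using graph_homD(1)[OF \<gamma>(1)] graph_homD(1)[OF \<delta>(1)]
    by (intro bij_betwI[where g = "vmap \<delta>"]) auto
  moreover have "emap \<delta> (emap \<gamma> v) = v" "emap \<gamma> (emap \<delta> v) = v" if "v \<in> gedges T" for v
    using arg_cong[OF 1, of "\<lambda>x. emap x v"] arg_cong[OF 2, of "\<lambda>x. emap x v"] that
    by (auto simp: graph_id_def)
  then have "bij_betw (emap \<gamma>) (gedges T) (gedges T)"
    using graph_homD(2)[OF \<gamma>(1)] graph_homD(2)[OF \<delta>(1)]
    by (intro bij_betwI[where g = "emap \<delta>"]) auto
  ultimately show ?thesis using \<gamma> by (auto simp: graph_aut_def)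
qed

section \<open>Groupoid morphisms, lifts and deck transformations of graphs of objects\<close>

context category_triple
begin

abbreviation iso :: "'o \<Rightarrow> 'o \<Rightarrow> 'm set" where
  "iso \<equiv> arrows C M1"

lemma M2_Mor: "M2 \<subseteq> Mor C"
  using subcategory_M2 by (auto simp: wide_subcategory_def)

lemma iso_Mor: "f \<in> iso a b \<Longrightarrow> f \<in> arrows C (Mor C) a b"
  using M2_Mor M1_subset_M2 by (auto simp: arrows_def)

lemma M2_arrow_Mor: "f \<in> arrows C M2 a b \<Longrightarrow> f \<in> arrows C (Mor C) a b"
  using M2_Mor by (auto simp: arrows_def)

lemma arrow_assoc:
  assumes "f \<in> arrows C (Mor C) a b" "g \<in> arrows C (Mor C) b c" "h \<in> arrows C (Mor C) c d"
  shows "(h \<cdot> g) \<cdot> f = h \<cdot> (g \<cdot> f)"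
  using assms by (auto simp: arrows_def intro: Comp_assoc)

lemma arrow_comp:
  "\<lbrakk>f \<in> arrows C (Mor C) a b; g \<in> arrows C (Mor C) b c\<rbrakk> \<Longrightarrow> g \<cdot> f \<in> arrows C (Mor C) a c"
  by (auto simp: arrows_def Comp_closed Dom_Comp Cod_Comp)

lemma iso_comp: "\<lbrakk>f \<in> iso a b; g \<in> iso b c\<rbrakk> \<Longrightarrow> g \<cdot> f \<in> iso a c"
  using groupoid_M1 iso_Mor[of f a b] iso_Mor[of g b c] arrow_comp[of f a b g c]
  by (auto simp: arrows_def wide_subgroupoid_def wide_subcategory_def)

lemma iso_id: "a \<in> Ob C \<Longrightarrow> Ident C a \<in> iso a a"
  using groupoid_M1
  by (auto simp: arrows_def wide_subgroupoid_def wide_subcategory_def Dom_Ident Cod_Ident)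

lemma arrow_id:
  "f \<in> arrows C (Mor C) a b \<Longrightarrow> f \<cdot> Ident C a = f"
  "f \<in> arrows C (Mor C) a b \<Longrightarrow> Ident C b \<cdot> f = f"
  using Comp_Ident Ident_Comp by (auto simp: arrows_def)

text \<open>
The inverse is taken inside \<open>M1\<close>, since components of morphisms of graphs of objects must lie there.
\<close>

definition minv :: "'m \<Rightarrow> 'm" where
  "minv f = (SOME g. g \<in> M1 \<and> Dom C g = Cod C f \<and> Cod C g = Dom C f \<and>
     g \<cdot> f = Ident C (Dom C f) \<and> f \<cdot> g = Ident C (Cod C f))"

lemma minv:
  assumes "f \<in> iso a b"
  shows "minv f \<in> iso b a" "minv f \<cdot> f = Ident C a" "f \<cdot> minv f = Ident C b"
proof -
  have f: "f \<in> M1" "Dom C f = a" "Cod C f = b" using assms by (auto simp: arrows_def)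
  have "\<exists>g. g \<in> M1 \<and> Dom C g = Cod C f \<and> Cod C g = Dom C f \<and>
     g \<cdot> f = Ident C (Dom C f) \<and> f \<cdot> g = Ident C (Cod C f)"
    using groupoid_M1 f(1) by (auto simp: wide_subgroupoid_def)
  from someI_ex[OF this, folded minv_def] f
  show "minv f \<in> iso b a" "minv f \<cdot> f = Ident C a" "f \<cdot> minv f = Ident C b"
    by (auto simp: arrows_def)
qed

lemma minv_comp_cancel:
  assumes "f \<in> iso b c" "g \<in> arrows C (Mor C) a b"
  shows "minv f \<cdot> (f \<cdot> g) = g"
  using arrow_assoc[OF assms(2) iso_Mor[OF assms(1)] iso_Mor[OF minv(1)[OF assms(1)]]]
    minv(2)[OF assms(1)] arrow_id(2)[OF assms(2)] by simp

lemma comp_minv_cancel: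
  assumes "f \<in> iso b c" "g \<in> arrows C (Mor C) a c"
  shows "f \<cdot> (minv f \<cdot> g) = g"
  using arrow_assoc[OF assms(2) iso_Mor[OF minv(1)[OF assms(1)]] iso_Mor[OF assms(1)]]
    minv(3)[OF assms(1)] arrow_id(2)[OF assms(2)] by simp

lemma iso_cancel_left:
  assumes "f \<in> iso b c" "g \<in> arrows C (Mor C) a b" "h \<in> arrows C (Mor C) a b" "f \<cdot> g = f \<cdot> h"
  shows "g = h"
proof -
  have "g = minv f \<cdot> (f \<cdot> g)" using minv_comp_cancel[OF assms(1,2)] by simp
  also have "\<dots> = h" unfolding assms(4) using minv_comp_cancel[OF assms(1,3)] .
  finally show ?thesis .
qed

lemma iso_cancel_right:
  assumes "f \<in> iso a b" "g \<in> arrows C (Mor C) b c" "h \<in> arrows C (Mor C) b c" "g \<cdot> f = h \<cdot> f"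
  shows "g = h"
proof -
  note m = iso_Mor[OF minv(1)[OF assms(1)]] and f = iso_Mor[OF assms(1)]
  have "g = (g \<cdot> f) \<cdot> minv f"
    using arrow_assoc[OF m f assms(2)] minv(3)[OF assms(1)] arrow_id(1)[OF assms(2)] by simp
  also have "\<dots> = h"
    using arrow_assoc[OF m f assms(3)] minv(3)[OF assms(1)] arrow_id(1)[OF assms(3)] assms(4) by simp
  finally show ?thesis .
qed

lemma gooD:
  assumes "graph_of_objects C M2 X"
  shows "is_graph (ugraph X)"
    "v \<in> gverts (ugraph X) \<Longrightarrow> vobj X v \<in> Ob C"
    "e \<in> gedges (ugraph X) \<Longrightarrow> eobj X e \<in> Ob C"
    "e \<in> gedges (ugraph X) \<Longrightarrow> eobj X (rev_edge (ugraph X) e) = eobj X e"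
    "e \<in> gedges (ugraph X) \<Longrightarrow> \<phi>0 X e \<in> arrows C M2 (eobj X e) (vobj X (src (ugraph X) e))"
    "e \<in> gedges (ugraph X) \<Longrightarrow> \<phi>1 X e \<in> arrows C M2 (eobj X e) (vobj X (tgt (ugraph X) e))"
    "e \<in> gedges (ugraph X) \<Longrightarrow> \<phi>1 X e = \<phi>0 X (rev_edge (ugraph X) e)"
proof -
  have V: "\<forall>v \<in> gverts (ugraph X). vobj X v \<in> Ob C" and G: "is_graph (ugraph X)"
    and E: "\<forall>e \<in> gedges (ugraph X).
      eobj X e \<in> Ob C \<and> eobj X e = eobj X (rev_edge (ugraph X) e) \<and>
      \<phi>0 X e \<in> arrows C M2 (eobj X e) (vobj X (src (ugraph X) e)) \<and>
      \<phi>1 X e \<in> arrows C M2 (eobj X e) (vobj X (tgt (ugraph X) e)) \<and>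
      \<phi>0 X e = \<phi>1 X (rev_edge (ugraph X) e) \<and> \<phi>1 X e = \<phi>0 X (rev_edge (ugraph X) e)"
    using assms unfolding graph_of_objects_def Let_def by blast+
  show "is_graph (ugraph X)" by fact
  show "vobj X v \<in> Ob C" if "v \<in> gverts (ugraph X)" using V that by blast
  assume e: "e \<in> gedges (ugraph X)"
  note E = bspec[OF E e]
  show "eobj X e \<in> Ob C" using E by blast
  show "eobj X (rev_edge (ugraph X) e) = eobj X e" using E by (elim conjE) (rule sym)
  show "\<phi>0 X e \<in> arrows C M2 (eobj X e) (vobj X (src (ugraph X) e))" using E by blast
  show "\<phi>1 X e \<in> arrows C M2 (eobj X e) (vobj X (tgt (ugraph X) e))" using E by blast
  show "\<phi>1 X e = \<phi>0 X (rev_edge (ugraph X) e)" using E by (elim conjE) assumption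
qed

lemma goo_homD:
  assumes "goo_hom C M1 X Y f"
  shows "graph_hom (ugraph X) (ugraph Y) (umap f)"
    "v \<in> gverts (ugraph X) \<Longrightarrow> vmor f v \<in> iso (vobj X v) (vobj Y (vmap (umap f) v))"
    "e \<in> gedges (ugraph X) \<Longrightarrow> emor f e \<in> iso (eobj X e) (eobj Y (emap (umap f) e))"
    "e \<in> gedges (ugraph X) \<Longrightarrow> emor f (rev_edge (ugraph X) e) = emor f e"
    "e \<in> gedges (ugraph X) \<Longrightarrow>
       vmor f (src (ugraph X) e) \<cdot> \<phi>0 X e = \<phi>0 Y (emap (umap f) e) \<cdot> emor f e"
proof -
  have G: "graph_hom (ugraph X) (ugraph Y) (umap f)"
    and V: "vmor f \<in> (\<Pi>\<^sub>E v \<in> gverts (ugraph X). iso (vobj X v) (vobj Y (vmap (umap f) v)))"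
    and E: "emor f \<in> (\<Pi>\<^sub>E e \<in> gedges (ugraph X). iso (eobj X e) (eobj Y (emap (umap f) e)))"
    and c: "\<forall>e \<in> gedges (ugraph X). emor f e = emor f (rev_edge (ugraph X) e) \<and>
        vmor f (src (ugraph X) e) \<cdot> \<phi>0 X e = \<phi>0 Y (emap (umap f) e) \<cdot> emor f e \<and>
        vmor f (tgt (ugraph X) e) \<cdot> \<phi>1 X e = \<phi>1 Y (emap (umap f) e) \<cdot> emor f e"
    using assms unfolding goo_hom_def Let_def by blast+
  show "graph_hom (ugraph X) (ugraph Y) (umap f)" by fact
  show "vmor f v \<in> iso (vobj X v) (vobj Y (vmap (umap f) v))" if "v \<in> gverts (ugraph X)"
    using PiE_mem[OF V that] .
  assume e: "e \<in> gedges (ugraph X)"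
  show "emor f e \<in> iso (eobj X e) (eobj Y (emap (umap f) e))" using PiE_mem[OF E e] .
  show "emor f (rev_edge (ugraph X) e) = emor f e" using bspec[OF c e] by (elim conjE) (rule sym)
  show "vmor f (src (ugraph X) e) \<cdot> \<phi>0 X e = \<phi>0 Y (emap (umap f) e) \<cdot> emor f e"
    using bspec[OF c e] by blast
qed

text \<open>
The square at the terminal vertex of an edge is the square at the initial vertex of its inverse, so
only the latter has to be checked.
\<close>

lemma goo_homI:
  assumes "graph_of_objects C M2 X" "graph_of_objects C M2 Y"
    and hom: "graph_hom (ugraph X) (ugraph Y) (umap f)"
    and "vmor f \<in> extensional (gverts (ugraph X))" "emor f \<in> extensional (gedges (ugraph X))"
    and "\<And>v. v \<in> gverts (ugraph X) \<Longrightarrow> vmor f v \<in> iso (vobj X v) (vobj Y (vmap (umap f) v))"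
    and "\<And>e. e \<in> gedges (ugraph X) \<Longrightarrow> emor f e \<in> iso (eobj X e) (eobj Y (emap (umap f) e))"
    and r: "\<And>e. e \<in> gedges (ugraph X) \<Longrightarrow> emor f (rev_edge (ugraph X) e) = emor f e"
    and c: "\<And>e. e \<in> gedges (ugraph X) \<Longrightarrow>
       vmor f (src (ugraph X) e) \<cdot> \<phi>0 X e = \<phi>0 Y (emap (umap f) e) \<cdot> emor f e"
  shows "goo_hom C M1 X Y f"
proof -
  have "vmor f (tgt (ugraph X) e) \<cdot> \<phi>1 X e = \<phi>1 Y (emap (umap f) e) \<cdot> emor f e"
    if e: "e \<in> gedges (ugraph X)" for e
    using c[of "rev_edge (ugraph X) e"] r[OF e] is_graphD[OF gooD(1)[OF assms(1)] e]
      gooD(7)[OF assms(1) e] gooD(7)[OF assms(2) graph_homD(2)[OF hom e]] graph_homD(5)[OF hom e]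
    by simp
  then show ?thesis using assms unfolding goo_hom_def Let_def by (auto simp: PiE_def)
qed

lemma goo_hom_ext:
  assumes "goo_hom C M1 X Y f" "goo_hom C M1 X Z g" "umap f = umap g"
    and "\<And>v. v \<in> gverts (ugraph X) \<Longrightarrow> vmor f v = vmor g v"
    and "\<And>e. e \<in> gedges (ugraph X) \<Longrightarrow> emor f e = emor g e"
  shows "f = g"
proof (rule goo_map.equality)
  show "vmor f = vmor g" "emor f = emor g"
    using assms unfolding goo_hom_def Let_def by (auto intro!: extensionalityI simp: PiE_def)
qed (use assms in simp_all)

lemma goo_comp_apply [simp]:
  "umap (goo_comp C X g f) = graph_comp (ugraph X) (umap g) (umap f)"
  "v \<in> gverts (ugraph X) \<Longrightarrow> vmor (goo_comp C X g f) v = vmor g (vmap (umap f) v) \<cdot> vmor f v"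
  "e \<in> gedges (ugraph X) \<Longrightarrow> emor (goo_comp C X g f) e = emor g (emap (umap f) e) \<cdot> emor f e"
  by (simp_all add: goo_comp_def)

lemma goo_hom_comp:
  assumes "graph_of_objects C M2 X" "graph_of_objects C M2 Y" "graph_of_objects C M2 Z"
    and f: "goo_hom C M1 X Y f" and g: "goo_hom C M1 Y Z g"
  shows "goo_hom C M1 X Z (goo_comp C X g f)"
proof (rule goo_homI[OF assms(1,3)])
  let ?X = "ugraph X"
  note fh = goo_homD[OF f] and gh = goo_homD[OF g]
  note fg = graph_homD[OF fh(1)] and gg = graph_homD[OF gh(1)] and grX = is_graphD[OF gooD(1)[OF assms(1)]]
  show "graph_hom ?X (ugraph Z) (umap (goo_comp C X g f))"
    using graph_hom_comp[OF gooD(1)[OF assms(1)] fh(1) gh(1)] by simp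
  show "vmor (goo_comp C X g f) \<in> extensional (gverts ?X)"
    "emor (goo_comp C X g f) \<in> extensional (gedges ?X)" by (simp_all add: goo_comp_def)
  show "vmor (goo_comp C X g f) v \<in> iso (vobj X v) (vobj Z (vmap (umap (goo_comp C X g f)) v))"
    if "v \<in> gverts ?X" for v
    using iso_comp[OF fh(2)[OF that] gh(2)[OF fg(1)[OF that]]] that by simp
  fix e assume e: "e \<in> gedges ?X"
  note fe = fg(2)[OF e]
  show "emor (goo_comp C X g f) e \<in> iso (eobj X e) (eobj Z (emap (umap (goo_comp C X g f)) e))"
    using iso_comp[OF fh(3)[OF e] gh(3)[OF fe]] e by simp
  show "emor (goo_comp C X g f) (rev_edge ?X e) = emor (goo_comp C X g f) e"
    using e grX(3)[OF e] fh(4)[OF e] gh(4)[OF fe] fg(5)[OF e] by simp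
  let ?u = "src ?X e"
  have u: "?u \<in> gverts ?X" using grX e by simp
  note a1 = M2_arrow_Mor[OF gooD(5)[OF assms(1) e]]
    and a2 = iso_Mor[OF fh(2)[OF u]]
    and a3 = iso_Mor[OF gh(2)[OF fg(1)[OF u]]]
    and b1 = iso_Mor[OF fh(3)[OF e]]
    and b2 = M2_arrow_Mor[OF gooD(5)[OF assms(2) fe]]
    and c2 = iso_Mor[OF gh(3)[OF fe]]
    and c3 = M2_arrow_Mor[OF gooD(5)[OF assms(3) gg(2)[OF fe]]]
  have s: "src (ugraph Y) (emap (umap f) e) = vmap (umap f) ?u" using fg(3)[OF e] .
  have s': "src (ugraph Z) (emap (umap g) (emap (umap f) e)) = vmap (umap g) (vmap (umap f) ?u)"
    using gg(3)[OF fe] s by simp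
  have "(vmor g (vmap (umap f) ?u) \<cdot> vmor f ?u) \<cdot> \<phi>0 X e
      = vmor g (vmap (umap f) ?u) \<cdot> (\<phi>0 Y (emap (umap f) e) \<cdot> emor f e)"
    using arrow_assoc[OF a1 a2 a3] fh(5)[OF e] by simp
  also have "\<dots> = (\<phi>0 Z (emap (umap g) (emap (umap f) e)) \<cdot> emor g (emap (umap f) e)) \<cdot> emor f e"
    using arrow_assoc[OF b1 b2[unfolded s] a3] gh(5)[OF fe] s by simp
  also have "\<dots> = \<phi>0 Z (emap (umap g) (emap (umap f) e)) \<cdot> (emor g (emap (umap f) e) \<cdot> emor f e)"
    using arrow_assoc[OF b1 c2 c3] .
  finally show "vmor (goo_comp C X g f) ?u \<cdot> \<phi>0 X e
      = \<phi>0 Z (emap (umap (goo_comp C X g f)) e) \<cdot> emor (goo_comp C X g f) e"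
    using u e by simp
qed

lemma goo_comp_assoc:
  assumes "graph_of_objects C M2 X" "graph_of_objects C M2 Y" "graph_of_objects C M2 Z" "graph_of_objects C M2 W"
    and f: "goo_hom C M1 X Y f" and g: "goo_hom C M1 Y Z g" and h: "goo_hom C M1 Z W h"
  shows "goo_comp C X (goo_comp C Y h g) f = goo_comp C X h (goo_comp C X g f)"
proof (rule goo_hom_ext)
  note fh = goo_homD[OF f] and gh = goo_homD[OF g] and hh = goo_homD[OF h]
  note fg = graph_homD[OF fh(1)] and gg = graph_homD[OF gh(1)]
  show "goo_hom C M1 X W (goo_comp C X (goo_comp C Y h g) f)"
    "goo_hom C M1 X W (goo_comp C X h (goo_comp C X g f))"
    by (rule goo_hom_comp[OF assms(1,2,4) f goo_hom_comp[OF assms(2-4) g h]],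
        rule goo_hom_comp[OF assms(1,3,4) goo_hom_comp[OF assms(1-3) f g] h])
  show "umap (goo_comp C X (goo_comp C Y h g) f) = umap (goo_comp C X h (goo_comp C X g f))"
    using graph_comp_assoc[OF fh(1)] by simp
  show "vmor (goo_comp C X (goo_comp C Y h g) f) v = vmor (goo_comp C X h (goo_comp C X g f)) v"
    if "v \<in> gverts (ugraph X)" for v
    using that fg(1)[OF that] gg(1)
      arrow_assoc[OF iso_Mor[OF fh(2)[OF that]] iso_Mor[OF gh(2)[OF fg(1)[OF that]]]
        iso_Mor[OF hh(2)[OF gg(1)[OF fg(1)[OF that]]]]] by simp
  show "emor (goo_comp C X (goo_comp C Y h g) f) e = emor (goo_comp C X h (goo_comp C X g f)) e"
    if "e \<in> gedges (ugraph X)" for e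
    using that fg(2)[OF that] gg(2)
      arrow_assoc[OF iso_Mor[OF fh(3)[OF that]] iso_Mor[OF gh(3)[OF fg(2)[OF that]]]
        iso_Mor[OF hh(3)[OF gg(2)[OF fg(2)[OF that]]]]] by simp
qed

lemma umap_goo_id: "umap (goo_id C X) = graph_id (ugraph X)"
  by (simp add: goo_id_def graph_id_def)

lemma goo_hom_id:
  assumes "graph_of_objects C M2 X"
  shows "goo_hom C M1 X X (goo_id C X)"
proof (rule goo_homI[OF assms assms])
  note gr = gooD(1)[OF assms]
  show "graph_hom (ugraph X) (ugraph X) (umap (goo_id C X))"
    using graph_hom_id[OF gr] by (simp add: umap_goo_id)
  fix e assume e: "e \<in> gedges (ugraph X)"
  show "vmor (goo_id C X) (src (ugraph X) e) \<cdot> \<phi>0 X e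
      = \<phi>0 X (emap (umap (goo_id C X)) e) \<cdot> emor (goo_id C X) e"
    using e is_graphD[OF gr e] arrow_id[OF M2_arrow_Mor[OF gooD(5)[OF assms e]]] by (simp add: goo_id_def)
qed (auto simp: goo_id_def is_graphD[OF gooD(1)[OF assms]] gooD[OF assms] iso_id)

lemma goo_comp_id:
  assumes "graph_of_objects C M2 X" "graph_of_objects C M2 Y" "goo_hom C M1 X Y f"
  shows "goo_comp C X f (goo_id C X) = f" "goo_comp C X (goo_id C Y) f = f"
proof -
  note fh = goo_homD[OF assms(3)] and fg = graph_homD[OF goo_homD(1)[OF assms(3)]]
  show "goo_comp C X f (goo_id C X) = f"
  proof (rule goo_hom_ext[OF goo_hom_comp[OF assms(1,1,2) goo_hom_id[OF assms(1)] assms(3)] assms(3)])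
    show "umap (goo_comp C X f (goo_id C X)) = umap f"
      using graph_comp_id[OF fh(1) gooD(1)[OF assms(1)]] by (simp add: umap_goo_id)
    show "vmor (goo_comp C X f (goo_id C X)) v = vmor f v" if "v \<in> gverts (ugraph X)" for v
      using arrow_id(1)[OF iso_Mor[OF fh(2)[OF that]]] that by simp (simp add: goo_id_def)
    show "emor (goo_comp C X f (goo_id C X)) e = emor f e" if "e \<in> gedges (ugraph X)" for e
      using arrow_id(1)[OF iso_Mor[OF fh(3)[OF that]]] that by simp (simp add: goo_id_def)
  qed
  have u: "graph_comp (ugraph X) (graph_id (ugraph Y)) (umap f) = umap f"
    by (rule graph_hom_ext[OF graph_hom_comp[OF gooD(1)[OF assms(1)] fh(1) graph_hom_id[OF gooD(1)[OF assms(2)]]] fh(1)])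
      (use fg in \<open>auto simp: graph_id_def\<close>)
  show "goo_comp C X (goo_id C Y) f = f"
  proof (rule goo_hom_ext[OF goo_hom_comp[OF assms(1,2,2,3) goo_hom_id[OF assms(2)]] assms(3)])
    show "umap (goo_comp C X (goo_id C Y) f) = umap f" using u by (simp add: umap_goo_id)
    show "vmor (goo_comp C X (goo_id C Y) f) v = vmor f v" if "v \<in> gverts (ugraph X)" for v
      using arrow_id(2)[OF iso_Mor[OF fh(2)[OF that]]] that fg(1)[OF that] by simp (simp add: goo_id_def)
    show "emor (goo_comp C X (goo_id C Y) f) e = emor f e" if "e \<in> gedges (ugraph X)" for e
      using arrow_id(2)[OF iso_Mor[OF fh(3)[OF that]]] that fg(2)[OF that] by simp (simp add: goo_id_def)
  qed
qed

text \<open>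
Once a lift \<open>\<gamma>\<close> of the underlying graph map of \<open>a\<close> along \<open>f\<close> is given, invertibility of the
components of \<open>f\<close> forces the components of a lift of \<open>a\<close>.
\<close>

definition goo_lift :: "('u, 'd, 'o, 'm) goo \<Rightarrow> ('v, 'e, 'w, 'f, 'm) goo_map \<Rightarrow>
    ('u, 'd, 'w, 'f, 'm) goo_map \<Rightarrow> ('u, 'd, 'v, 'e) graph_map \<Rightarrow> ('u, 'd, 'v, 'e, 'm) goo_map" where
  "goo_lift X f a \<gamma> =
     \<lparr>umap = \<gamma>,
      vmor = (\<lambda>v \<in> gverts (ugraph X). minv (vmor f (vmap \<gamma> v)) \<cdot> vmor a v),
      emor = (\<lambda>e \<in> gedges (ugraph X). minv (emor f (emap \<gamma> e)) \<cdot> emor a e)\<rparr>"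

lemma goo_lift:
  assumes X: "graph_of_objects C M2 X" and Y: "graph_of_objects C M2 Y" and Z: "graph_of_objects C M2 Z"
    and a: "goo_hom C M1 X Z a" and f: "goo_hom C M1 Y Z f"
    and \<gamma>: "graph_hom (ugraph X) (ugraph Y) \<gamma>" "graph_comp (ugraph X) (umap f) \<gamma> = umap a"
  shows "goo_hom C M1 X Y (goo_lift X f a \<gamma>)" "goo_comp C X f (goo_lift X f a \<gamma>) = a"
proof -
  let ?X = "ugraph X"
  note ah = goo_homD[OF a] and fh = goo_homD[OF f] and gh = graph_homD[OF \<gamma>(1)]
    and gr = is_graphD[OF gooD(1)[OF X]]
  have vv: "vmap (umap f) (vmap \<gamma> v) = vmap (umap a) v" if "v \<in> gverts ?X" for v
    using \<gamma>(2) that by (metis graph_comp_apply(1))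
  have ee: "emap (umap f) (emap \<gamma> e) = emap (umap a) e" if "e \<in> gedges ?X" for e
    using \<gamma>(2) that by (metis graph_comp_apply(2))
  have fv: "vmor f (vmap \<gamma> v) \<in> iso (vobj Y (vmap \<gamma> v)) (vobj Z (vmap (umap a) v))" if "v \<in> gverts ?X" for v
    using fh(2)[OF gh(1)[OF that]] vv[OF that] by simp
  have fe: "emor f (emap \<gamma> e) \<in> iso (eobj Y (emap \<gamma> e)) (eobj Z (emap (umap a) e))" if "e \<in> gedges ?X" for e
    using fh(3)[OF gh(2)[OF that]] ee[OF that] by simp
  show h: "goo_hom C M1 X Y (goo_lift X f a \<gamma>)"
  proof (rule goo_homI[OF X Y])
    show "vmor (goo_lift X f a \<gamma>) v \<in> iso (vobj X v) (vobj Y (vmap (umap (goo_lift X f a \<gamma>)) v))"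
      if "v \<in> gverts ?X" for v
      using iso_comp[OF ah(2)[OF that] minv(1)[OF fv[OF that]]] that by (simp add: goo_lift_def)
    fix e assume e: "e \<in> gedges ?X"
    show "emor (goo_lift X f a \<gamma>) e \<in> iso (eobj X e) (eobj Y (emap (umap (goo_lift X f a \<gamma>)) e))"
      using iso_comp[OF ah(3)[OF e] minv(1)[OF fe[OF e]]] e by (simp add: goo_lift_def)
    show "emor (goo_lift X f a \<gamma>) (rev_edge ?X e) = emor (goo_lift X f a \<gamma>) e"
      using e gr(3)[OF e] gh(5)[OF e] ah(4)[OF e] fh(4)[OF gh(2)[OF e]] by (simp add: goo_lift_def)
    let ?u = "src ?X e"
    have u: "?u \<in> gverts ?X" using gr(1)[OF e] .
    let ?fu = "vmor f (vmap \<gamma> ?u)" and ?fe = "emor f (emap \<gamma> e)"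
    let ?pX = "\<phi>0 X e" and ?pY = "\<phi>0 Y (emap \<gamma> e)" and ?pZ = "\<phi>0 Z (emap (umap a) e)"
    note iu = fv[OF u] and ie = fe[OF e]
    have pX: "?pX \<in> arrows C (Mor C) (eobj X e) (vobj X ?u)"
      using M2_arrow_Mor[OF gooD(5)[OF X e]] .
    have pY: "?pY \<in> arrows C (Mor C) (eobj Y (emap \<gamma> e)) (vobj Y (vmap \<gamma> ?u))"
      using M2_arrow_Mor[OF gooD(5)[OF Y gh(2)[OF e]]] gh(3)[OF e] by simp
    note au = iso_Mor[OF ah(2)[OF u]] and ae = iso_Mor[OF ah(3)[OF e]]
    note mu = iso_Mor[OF minv(1)[OF iu]] and me = iso_Mor[OF minv(1)[OF ie]]
    have mae: "minv ?fe \<cdot> emor a e \<in> arrows C (Mor C) (eobj X e) (eobj Y (emap \<gamma> e))"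
      using arrow_comp[OF ae me] .
    have com: "?fu \<cdot> ?pY = ?pZ \<cdot> ?fe"
      using fh(5)[OF gh(2)[OF e]] gh(3)[OF e] ee[OF e] by simp
    have pZ: "?pZ \<in> arrows C (Mor C) (eobj Z (emap (umap a) e)) (vobj Z (vmap (umap a) ?u))"
      using M2_arrow_Mor[OF gooD(5)[OF Z graph_homD(2)[OF ah(1) e]]] graph_homD(3)[OF ah(1) e] by simp
    have "?fu \<cdot> (?pY \<cdot> (minv ?fe \<cdot> emor a e)) = ?pZ \<cdot> (?fe \<cdot> (minv ?fe \<cdot> emor a e))"
      using arrow_assoc[OF mae pY iso_Mor[OF iu]] arrow_assoc[OF mae iso_Mor[OF ie] pZ] com by simp
    also have "\<dots> = ?pZ \<cdot> emor a e" using comp_minv_cancel[OF ie ae] by simp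
    also have "\<dots> = vmor a ?u \<cdot> ?pX" using ah(5)[OF e] by simp
    finally have "?pY \<cdot> (minv ?fe \<cdot> emor a e) = minv ?fu \<cdot> (vmor a ?u \<cdot> ?pX)"
      using minv_comp_cancel[OF iu arrow_comp[OF mae pY]] by simp
    also have "\<dots> = (minv ?fu \<cdot> vmor a ?u) \<cdot> ?pX"
      using arrow_assoc[OF pX au mu] by simp
    finally show "vmor (goo_lift X f a \<gamma>) ?u \<cdot> \<phi>0 X e
        = \<phi>0 Y (emap (umap (goo_lift X f a \<gamma>)) e) \<cdot> emor (goo_lift X f a \<gamma>) e"
      using e u by (simp add: goo_lift_def)
  qed (use \<gamma> in \<open>simp_all add: goo_lift_def\<close>)
  show "goo_comp C X f (goo_lift X f a \<gamma>) = a"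
  proof (rule goo_hom_ext[OF goo_hom_comp[OF X Y Z h f] a])
    show "umap (goo_comp C X f (goo_lift X f a \<gamma>)) = umap a" using \<gamma>(2) by (simp add: goo_lift_def)
    show "vmor (goo_comp C X f (goo_lift X f a \<gamma>)) v = vmor a v" if "v \<in> gverts ?X" for v
      using comp_minv_cancel[OF fv[OF that] iso_Mor[OF ah(2)[OF that]]] that by (simp add: goo_lift_def)
    show "emor (goo_comp C X f (goo_lift X f a \<gamma>)) e = emor a e" if "e \<in> gedges ?X" for e
      using comp_minv_cancel[OF fe[OF that] iso_Mor[OF ah(3)[OF that]]] that by (simp add: goo_lift_def)
  qed
qed

lemma graph_aut_inverse:
  assumes "is_graph G" "graph_aut G \<alpha>"
  shows "\<exists>\<gamma>. graph_aut G \<gamma> \<and> graph_comp G \<alpha> \<gamma> = graph_id G"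
proof -
  have h: "graph_hom G G \<alpha>" and bv: "bij_betw (vmap \<alpha>) (gverts G) (gverts G)"
    and be: "bij_betw (emap \<alpha>) (gedges G) (gedges G)"
    using assms(2) by (auto simp: graph_aut_def)
  note gr = is_graphD[OF assms(1)] and gh = graph_homD[OF h]
  let ?v = "inv_into (gverts G) (vmap \<alpha>)" and ?e = "inv_into (gedges G) (emap \<alpha>)"
  define \<gamma> where "\<gamma> = \<lparr>vmap = restrict ?v (gverts G), emap = restrict ?e (gedges G)\<rparr>"
  have v: "?v v \<in> gverts G" "vmap \<alpha> (?v v) = v" if "v \<in> gverts G" for v
    using bv that by (auto simp: bij_betw_def f_inv_into_f inv_into_into)
  have e: "?e v \<in> gedges G" "emap \<alpha> (?e v) = v" if "v \<in> gedges G" for v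
    using be that by (auto simp: bij_betw_def f_inv_into_f inv_into_into)
  have vi: "?v (vmap \<alpha> v) = v" if "v \<in> gverts G" for v
    using bv that by (auto simp: bij_betw_def)
  have ei: "?e (emap \<alpha> v) = v" if "v \<in> gedges G" for v
    using be that by (auto simp: bij_betw_def)
  have gam: "graph_hom G G \<gamma>"
  proof -
    have "src G (?e a) = ?v (src G a)" "tgt G (?e a) = ?v (tgt G a)" "?e (rev_edge G a) = rev_edge G (?e a)"
      if a: "a \<in> gedges G" for a
      using gh(3-5)[OF e(1)[OF a]] e(2)[OF a]
        vi[OF gr(1)[OF e(1)[OF a]]] vi[OF gr(2)[OF e(1)[OF a]]] ei[OF gr(3)[OF e(1)[OF a]]] by simp_all
    then show ?thesis using v e gr by (auto simp: graph_hom_def \<gamma>_def)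
  qed
  moreover have "bij_betw (vmap \<gamma>) (gverts G) (gverts G)" "bij_betw (emap \<gamma>) (gedges G) (gedges G)"
    using bij_betw_inv_into[OF bv] bij_betw_inv_into[OF be] by (auto simp: \<gamma>_def bij_betw_restrict_eq)
  moreover have "graph_comp G \<alpha> \<gamma> = graph_id G"
    by (rule graph_hom_ext[OF graph_hom_comp[OF assms(1) gam h] graph_hom_id[OF assms(1)]])
      (use v e in \<open>auto simp: graph_id_def \<gamma>_def\<close>)
  ultimately show ?thesis by (auto simp: graph_aut_def)
qed

text \<open>
A right inverse of \<open>f\<close> is a lift of the identity along \<open>f\<close>; in a monoid, right inverses for all
elements are two-sided.
\<close>

lemma group_goo_Aut:
  assumes X: "graph_of_objects C M2 X"
  shows "group (goo_Aut C M1 X)"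
proof -
  let ?A = "goo_Aut C M1 X" and ?G = "ugraph X"
  note gr = gooD(1)[OF X]
  have car: "f \<in> carrier ?A \<longleftrightarrow> goo_hom C M1 X X f \<and> graph_aut ?G (umap f)" for f
    by (simp add: goo_Aut_def)
  have closed: "goo_comp C X f g \<in> carrier ?A" if "f \<in> carrier ?A" "g \<in> carrier ?A" for f g
  proof -
    have f: "goo_hom C M1 X X f" "graph_aut ?G (umap f)" and g: "goo_hom C M1 X X g" "graph_aut ?G (umap g)"
      using that car by auto
    have "bij_betw (vmap (umap f) \<circ> vmap (umap g)) (gverts ?G) (gverts ?G)"
      "bij_betw (emap (umap f) \<circ> emap (umap g)) (gedges ?G) (gedges ?G)"
      using f g by (auto simp: graph_aut_def intro: bij_betw_trans)
    then have "bij_betw (vmap (graph_comp ?G (umap f) (umap g))) (gverts ?G) (gverts ?G)"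
      "bij_betw (emap (graph_comp ?G (umap f) (umap g))) (gedges ?G) (gedges ?G)"
      by (auto cong: bij_betw_cong)
    then show ?thesis
      using goo_hom_comp[OF X X X g(1) f(1)] goo_homD(1)[OF goo_hom_comp[OF X X X g(1) f(1)]]
      by (simp add: car graph_aut_def)
  qed
  have one: "goo_id C X \<in> carrier ?A"
    using goo_hom_id[OF X] graph_hom_id[OF gr]
    by (simp add: car graph_aut_def umap_goo_id) (auto simp: bij_betw_def graph_id_def inj_on_def)
  have assoc: "goo_comp C X (goo_comp C X f g) h = goo_comp C X f (goo_comp C X g h)"
    if "f \<in> carrier ?A" "g \<in> carrier ?A" "h \<in> carrier ?A" for f g h
    by (rule goo_comp_assoc[OF X X X X]) (use that car in auto)
  have id: "goo_comp C X (goo_id C X) f = f" "goo_comp C X f (goo_id C X) = f" if "f \<in> carrier ?A" for f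
    using goo_comp_id[OF X X, of f] that car by auto
  have rinv: "\<exists>g \<in> carrier ?A. goo_comp C X f g = goo_id C X" if f: "f \<in> carrier ?A" for f
  proof -
    have f': "goo_hom C M1 X X f" "graph_aut ?G (umap f)" using f car by auto
    obtain \<gamma> where g: "graph_aut ?G \<gamma>" "graph_comp ?G (umap f) \<gamma> = graph_id ?G"
      using graph_aut_inverse[OF gr f'(2)] by blast
    have gh: "graph_hom ?G ?G \<gamma>" using g(1) by (simp add: graph_aut_def)
    have "graph_comp ?G (umap f) \<gamma> = umap (goo_id C X)" using g(2) by (simp add: umap_goo_id)
    note l = goo_lift[OF X X X goo_hom_id[OF X] f'(1) gh this]
    from l(1) have "goo_lift X f (goo_id C X) \<gamma> \<in> carrier ?A"
      using g(1) by (simp add: car) (simp add: goo_lift_def)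
    then show ?thesis using l(2) by blast
  qed
  have ops: "monoid.mult ?A = goo_comp C X" "one ?A = goo_id C X" by (simp_all add: goo_Aut_def)
  show ?thesis
  proof (rule groupI, unfold ops)
    fix x assume x: "x \<in> carrier ?A"
    obtain y where y: "y \<in> carrier ?A" "goo_comp C X x y = goo_id C X" using rinv[OF x] by blast
    obtain z where z: "z \<in> carrier ?A" "goo_comp C X y z = goo_id C X" using rinv[OF y(1)] by blast
    have "goo_comp C X y x = goo_comp C X (goo_comp C X y x) (goo_comp C X y z)"
      using id closed x y z by simp
    also have "\<dots> = goo_comp C X y (goo_comp C X (goo_comp C X x y) z)"
      using assoc closed x y(1) z(1) by simp
    also have "\<dots> = goo_id C X" using y z id by simp
    finally show "\<exists>y \<in> carrier ?A. goo_comp C X y x = goo_id C X" using y(1) by blast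
  qed (use closed one assoc id in auto)
qed

lemma deck_transformationD:
  assumes "graph_of_objects C M2 X" "graph_of_objects C M2 Y" "goo_hom C M1 X Y f"
    and "g \<in> deck_transformations C M1 X f"
  shows "goo_hom C M1 X X g" "goo_comp C X f g = f"
proof -
  have g: "g \<in> carrier (goo_Aut C M1 X)" "graph_comp (ugraph X) (umap f) (umap g) = umap f"
    "\<forall>v \<in> gverts (ugraph X). vmor f v = vmor f (vmap (umap g) v) \<cdot> vmor g v"
    "\<forall>e \<in> gedges (ugraph X). emor f e = emor f (emap (umap g) e) \<cdot> emor g e"
    using assms(4) by (auto simp: deck_transformations_def is_deck_lift_def graph_deck_def)
  then show h: "goo_hom C M1 X X g" by (simp add: goo_Aut_def)
  show "goo_comp C X f g = f"
    by (rule goo_hom_ext[OF goo_hom_comp[OF assms(1,1,2) h assms(3)] assms(3)]) (use g in auto)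
qed

lemma deck_transformation_apply:
  assumes "graph_of_objects C M2 X" "graph_of_objects C M2 Y" "goo_hom C M1 X Y f"
    and "g \<in> deck_transformations C M1 X f"
  shows "v \<in> gverts (ugraph X) \<Longrightarrow> vmap (umap f) (vmap (umap g) v) = vmap (umap f) v"
    "e \<in> gedges (ugraph X) \<Longrightarrow> emap (umap f) (emap (umap g) e) = emap (umap f) e"
    "v \<in> gverts (ugraph X) \<Longrightarrow> vmor f (vmap (umap g) v) \<cdot> vmor g v = vmor f v"
    "e \<in> gedges (ugraph X) \<Longrightarrow> emor f (emap (umap g) e) \<cdot> emor g e = emor f e"
proof -
  note c = deck_transformationD(2)[OF assms]
  have u: "graph_comp (ugraph X) (umap f) (umap g) = umap f"
    using goo_comp_apply(1)[of X f g] unfolding c by (rule sym)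
  show "vmap (umap f) (vmap (umap g) v) = vmap (umap f) v" if "v \<in> gverts (ugraph X)"
    using graph_comp_apply(1)[OF that, of "umap f" "umap g"] unfolding u by (rule sym)
  show "emap (umap f) (emap (umap g) e) = emap (umap f) e" if "e \<in> gedges (ugraph X)"
    using graph_comp_apply(2)[OF that, of "umap f" "umap g"] unfolding u by (rule sym)
  show "vmor f (vmap (umap g) v) \<cdot> vmor g v = vmor f v" if "v \<in> gverts (ugraph X)"
    using goo_comp_apply(2)[OF that, of f g] unfolding c by (rule sym)
  show "emor f (emap (umap g) e) \<cdot> emor g e = emor f e" if "e \<in> gedges (ugraph X)"
    using goo_comp_apply(3)[OF that, of f g] unfolding c by (rule sym)
qed

lemma deck_transitive:
  assumes X: "graph_of_objects C M2 X" and Y: "graph_of_objects C M2 Y"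
    and f: "goo_covering C M1 X Y f" and T: "is_tree (ugraph X)"
    and v: "v \<in> gverts (ugraph X)" "v' \<in> gverts (ugraph X)" "vmap (umap f) v = vmap (umap f) v'"
  shows "\<exists>g \<in> deck_transformations C M1 X f. vmap (umap g) v = v'"
proof -
  have fh: "goo_hom C M1 X Y f" and fl: "local_iso (ugraph X) (ugraph Y) (umap f)"
    using f by (auto simp: goo_covering_def local_iso_of_covering)
  obtain \<gamma> where g: "graph_aut (ugraph X) \<gamma>" "graph_comp (ugraph X) (umap f) \<gamma> = umap f" "vmap \<gamma> v = v'"
    using tree_lift_aut[OF T fl fl v(1,2)] v(3) by auto
  have gh: "graph_hom (ugraph X) (ugraph X) \<gamma>" using g(1) by (simp add: graph_aut_def)
  define l where "l = goo_lift X f f \<gamma>"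
  have ul: "umap l = \<gamma>" by (simp add: l_def goo_lift_def)
  note L = goo_lift[OF X X Y fh fh gh g(2), folded l_def]
  have "l \<in> carrier (goo_Aut C M1 X)" using L(1) g(1) ul by (simp add: goo_Aut_def)
  moreover have "vmor f u = vmor f (vmap \<gamma> u) \<cdot> vmor l u" if "u \<in> gverts (ugraph X)" for u
    using goo_comp_apply(2)[OF that, of f l] L(2) ul by simp
  moreover have "emor f u = emor f (emap \<gamma> u) \<cdot> emor l u" if "u \<in> gedges (ugraph X)" for u
    using goo_comp_apply(3)[OF that, of f l] L(2) ul by simp
  ultimately have "is_deck_lift C M1 X f \<gamma> l" using ul by (simp add: is_deck_lift_def)
  then have "l \<in> deck_transformations C M1 X f"
    using g by (auto simp: deck_transformations_def graph_deck_def)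
  then show ?thesis using g(3) ul by blast
qed

text \<open>
A deck transformation that matches the initial vertices also matches the edges, because the covering
is injective on stars.
\<close>

lemma deck_transitive_edge:
  assumes X: "graph_of_objects C M2 X" and Y: "graph_of_objects C M2 Y"
    and f: "goo_covering C M1 X Y f" and T: "is_tree (ugraph X)"
    and e: "e \<in> gedges (ugraph X)" "e' \<in> gedges (ugraph X)" "emap (umap f) e = emap (umap f) e'"
  shows "\<exists>g \<in> deck_transformations C M1 X f. emap (umap g) e = e'"
proof -
  let ?G = "ugraph X"
  have fh: "goo_hom C M1 X Y f" and fl: "local_iso ?G (ugraph Y) (umap f)"
    using f by (auto simp: goo_covering_def local_iso_of_covering)
  note gr = is_graphD[OF gooD(1)[OF X]] and fg = graph_homD[OF goo_homD(1)[OF fh]]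
  have "vmap (umap f) (src ?G e) = vmap (umap f) (src ?G e')" using fg e by metis
  then obtain g where g: "g \<in> deck_transformations C M1 X f" "vmap (umap g) (src ?G e) = src ?G e'"
    using deck_transitive[OF X Y f T gr(1)[OF e(1)] gr(1)[OF e(2)]] by blast
  note d = deck_transformationD[OF X Y fh g(1)]
  note gg = graph_homD[OF goo_homD(1)[OF d(1)]]
  have "emap (umap f) (emap (umap g) e) = emap (umap f) e"
    using d(2) goo_comp_apply(1)[of X f g] graph_comp_apply(2)[OF e(1)] by metis
  moreover have "inj_on (emap (umap f)) (star ?G (src ?G e'))"
    using fl gr(1)[OF e(2)] by (auto simp: local_iso_def bij_betw_def)
  ultimately have "emap (umap g) e = e'"
    using e gg(2)[OF e(1)] gg(3)[OF e(1)] g(2) by (auto dest!: inj_onD)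
  then show ?thesis using g(1) by blast
qed

end

section \<open>Pairing of darts, coverings and images\<close>

text \<open>
One bijection is fixed for each pair of opposite types; the involution uses it on one of the two
types and its inverse on the other.
\<close>

lemma matching_involution:
  assumes "finite D"
    and inv: "\<And>d. d \<in> D \<Longrightarrow> bar (bar (tp d)) = tp d" "\<And>d. d \<in> D \<Longrightarrow> bar (tp d) \<noteq> tp d"
    and card: "\<And>d. d \<in> D \<Longrightarrow> card {x \<in> D. tp x = tp d} = card {x \<in> D. tp x = bar (tp d)}"
  shows "\<exists>\<iota>. \<forall>d \<in> D. \<iota> d \<in> D \<and> \<iota> (\<iota> d) = d \<and> tp (\<iota> d) = bar (tp d)"
proof -
  define F where "F \<epsilon> = {x \<in> D. tp x = \<epsilon>}" for \<epsilon>
  have "\<exists>b. bij_betw b (F (tp d)) (F (bar (tp d)))" if "d \<in> D" for d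
    using card[OF that] assms(1) by (intro finite_same_card_bij) (auto simp: F_def)
  note ex = this
  define b where "b \<epsilon> = (SOME b. bij_betw b (F \<epsilon>) (F (bar \<epsilon>)))" for \<epsilon>
  have b: "bij_betw (b (tp d)) (F (tp d)) (F (bar (tp d)))" if "d \<in> D" for d
    unfolding b_def using ex[OF that] by (rule someI_ex)
  \<comment> \<open>the preferred type of a pair; invariant under \<open>bar\<close>\<close>
  define R where "R \<epsilon> = (SOME x. x \<in> {\<epsilon>, bar \<epsilon>})" for \<epsilon>
  have R: "R (tp d) = tp d \<or> R (tp d) = bar (tp d)" for d
    unfolding R_def by (rule someI2[of _ "tp d"]) auto
  have Rbar: "R (bar (tp d)) = R (tp d)" if "d \<in> D" for d
    unfolding R_def using inv(1)[OF that] by (simp add: insert_commute)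
  define \<iota> where "\<iota> d = (if R (tp d) = tp d then b (tp d) d
      else inv_into (F (bar (tp d))) (b (bar (tp d))) d)" for d
  have "\<iota> d \<in> D \<and> \<iota> (\<iota> d) = d \<and> tp (\<iota> d) = bar (tp d)" if d: "d \<in> D" for d
  proof (cases "R (tp d) = tp d")
    case True
    have i: "\<iota> d = b (tp d) d" using True by (simp add: \<iota>_def)
    have dF: "d \<in> F (tp d)" using d by (simp add: F_def)
    then have *: "\<iota> d \<in> F (bar (tp d))" using b[OF d] i by (auto simp: bij_betw_def)
    then have t: "tp (\<iota> d) = bar (tp d)" "\<iota> d \<in> D" by (auto simp: F_def)
    have "R (tp (\<iota> d)) \<noteq> tp (\<iota> d)" using t Rbar[OF d] True inv(2)[OF d] by metis
    then have "\<iota> (\<iota> d) = inv_into (F (tp d)) (b (tp d)) (\<iota> d)"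
      using t inv(1)[OF d] unfolding \<iota>_def[of "\<iota> d"] by simp
    also have "\<dots> = d" using i dF b[OF d] by (simp add: bij_betw_def)
    finally show ?thesis using t by simp
  next
    case False
    have R': "R (tp d) = bar (tp d)" using R[of d] False by simp
    have dF: "d \<in> F (bar (bar (tp d)))" using d inv(1)[OF d] by (simp add: F_def)
    have "card (F (tp d)) > 0" using d assms(1) by (auto simp: F_def card_gt_0_iff)
    then have "F (bar (tp d)) \<noteq> {}" using card[OF d] unfolding F_def by (metis card.empty less_numeral_extra(3))
    then obtain d' where d': "d' \<in> D" "tp d' = bar (tp d)" by (auto simp: F_def)
    note b' = b[OF d'(1), unfolded d'(2)]
    have i: "\<iota> d = inv_into (F (bar (tp d))) (b (bar (tp d))) d" using False by (simp add: \<iota>_def)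
    have *: "\<iota> d \<in> F (bar (tp d))" "b (bar (tp d)) (\<iota> d) = d"
      unfolding i using b' dF by (auto simp: bij_betw_def inv_into_into f_inv_into_f)
    then have t: "tp (\<iota> d) = bar (tp d)" "\<iota> d \<in> D" by (auto simp: F_def)
    have "R (tp (\<iota> d)) = tp (\<iota> d)" using t(1) Rbar[OF d] R' by simp
    then have "\<iota> (\<iota> d) = b (bar (tp d)) (\<iota> d)" using t(1) unfolding \<iota>_def[of "\<iota> d"] by simp
    then show ?thesis using * t by simp
  qed
  then show ?thesis by blast
qed

lemma graph_aut_covering:
  assumes "is_graph G" "graph_aut G \<alpha>"
  shows "graph_covering G G \<alpha>"
proof -
  have h: "graph_hom G G \<alpha>" and bv: "bij_betw (vmap \<alpha>) (gverts G) (gverts G)"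
    and be: "bij_betw (emap \<alpha>) (gedges G) (gedges G)"
    using assms(2) by (auto simp: graph_aut_def)
  note gh = graph_homD[OF h]
  have "bij_betw (emap \<alpha>) (star G v) (star G (vmap \<alpha> v))" if v: "v \<in> gverts G" for v
  proof (rule bij_betw_imageI)
    show "inj_on (emap \<alpha>) (star G v)" using be by (auto simp: bij_betw_def inj_on_def)
    show "emap \<alpha> ` star G v = star G (vmap \<alpha> v)"
    proof (intro equalityI subsetI)
      fix e assume e: "e \<in> star G (vmap \<alpha> v)"
      then have "e \<in> emap \<alpha> ` gedges G" using bij_betw_imp_surj_on[OF be] by simp
      then obtain e' where e': "e' \<in> gedges G" "emap \<alpha> e' = e" by blast
      then have "vmap \<alpha> (src G e') = vmap \<alpha> v" using e gh(3)[OF e'(1)] by simp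
      then have "src G e' = v"
        using bv v is_graphD(1)[OF assms(1) e'(1)] by (auto simp: bij_betw_def inj_on_def)
      then show "e \<in> emap \<alpha> ` star G v" using e' by auto
    qed (use gh in auto)
  qed
  then show ?thesis using h bv be by (auto simp: graph_covering_def bij_betw_def)
qed

lemma covering_of_local_iso:
  assumes "local_iso G2 G3 \<beta>" "graph_hom G1 G2 \<alpha>" "graph_covering G1 G3 (graph_comp G1 \<beta> \<alpha>)"
  shows "graph_covering G2 G3 \<beta>"
proof -
  have h: "graph_hom G2 G3 \<beta>" using assms(1) by (simp add: local_iso_def)
  have "gverts G3 \<subseteq> vmap \<beta> ` gverts G2"
  proof
    fix v assume "v \<in> gverts G3"
    then have "v \<in> vmap (graph_comp G1 \<beta> \<alpha>) ` gverts G1"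
      using assms(3) by (simp add: graph_covering_def del: graph_comp_apply)
    then obtain u where "u \<in> gverts G1" "v = vmap (graph_comp G1 \<beta> \<alpha>) u" by blast
    then show "v \<in> vmap \<beta> ` gverts G2" using graph_homD(1)[OF assms(2)] by auto
  qed
  moreover have "gedges G3 \<subseteq> emap \<beta> ` gedges G2"
  proof
    fix v assume "v \<in> gedges G3"
    then have "v \<in> emap (graph_comp G1 \<beta> \<alpha>) ` gedges G1"
      using assms(3) by (simp add: graph_covering_def del: graph_comp_apply)
    then obtain u where "u \<in> gedges G1" "v = emap (graph_comp G1 \<beta> \<alpha>) u" by blast
    then show "v \<in> emap \<beta> ` gedges G2" using graph_homD(2)[OF assms(2)] by auto
  qed
  ultimately show ?thesis
    using assms(1) graph_homD(1,2)[OF h] by (auto simp: graph_covering_def local_iso_def)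
qed

lemma covering_comp:
  assumes "is_graph G1" "graph_covering G1 G2 \<alpha>" "graph_covering G2 G3 \<beta>"
  shows "graph_covering G1 G3 (graph_comp G1 \<beta> \<alpha>)"
proof -
  have "vmap (graph_comp G1 \<beta> \<alpha>) ` gverts G1 = vmap \<beta> ` vmap \<alpha> ` gverts G1"
    "emap (graph_comp G1 \<beta> \<alpha>) ` gedges G1 = emap \<beta> ` emap \<alpha> ` gedges G1"
    by (simp_all add: image_image)
  then show ?thesis
    using local_iso_comp[OF assms(1) local_iso_of_covering[OF assms(2)] local_iso_of_covering[OF assms(3)]]
      assms(2,3) by (simp add: graph_covering_def local_iso_def)
qed

text \<open>
The inversion is cut off because \<^const>\<open>is_graph\<close> requires it to be the identity off the edges.
\<close>

definition sgraph_restrict :: "('v, 'e) sgraph \<Rightarrow> 'v set \<Rightarrow> 'e set \<Rightarrow> ('v, 'e) sgraph" where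
  "sgraph_restrict G V E =
     \<lparr>dig = \<lparr>verts = V, arcs = E, tail = tail (dig G), head = head (dig G)\<rparr>,
      rev_edge = (\<lambda>e. if e \<in> E then rev_edge G e else e)\<rparr>"

lemma sgraph_restrict_simps [simp]:
  "gverts (sgraph_restrict G V E) = V" "gedges (sgraph_restrict G V E) = E"
  "src (sgraph_restrict G V E) = src G" "tgt (sgraph_restrict G V E) = tgt G"
  "e \<in> E \<Longrightarrow> rev_edge (sgraph_restrict G V E) e = rev_edge G e"
  by (simp_all add: sgraph_restrict_def)

lemma is_graphI:
  assumes "\<And>e. e \<in> gedges G \<Longrightarrow> src G e \<in> gverts G" "\<And>e. e \<in> gedges G \<Longrightarrow> tgt G e \<in> gverts G"
    "\<And>e. e \<notin> gedges G \<Longrightarrow> rev_edge G e = e"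
    "\<And>e. e \<in> gedges G \<Longrightarrow> rev_edge G e \<noteq> e"
    "\<And>e. e \<in> gedges G \<Longrightarrow> rev_edge G (rev_edge G e) = e"
    "\<And>e. e \<in> gedges G \<Longrightarrow> src G (rev_edge G e) = tgt G e"
  shows "is_graph G"
proof -
  interpret wf_digraph "dig G" by unfold_locales (use assms in auto)
  show ?thesis unfolding is_graph_def by (rule bidirected_digraphI) (use assms in auto)
qed

lemma is_graph_restrict:
  assumes "is_graph G" "E \<subseteq> gedges G"
    and "\<And>e. e \<in> E \<Longrightarrow> src G e \<in> V" "\<And>e. e \<in> E \<Longrightarrow> rev_edge G e \<in> E"
  shows "is_graph (sgraph_restrict G V E)"
proof (rule is_graphI)
  fix e assume "e \<in> gedges (sgraph_restrict G V E)"
  then have e: "e \<in> E" "e \<in> gedges G" using assms(2) by auto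
  have "src G (rev_edge G e) \<in> V" using assms(3,4) e by blast
  then show "tgt (sgraph_restrict G V E) e \<in> gverts (sgraph_restrict G V E)"
    using is_graphD(5)[OF assms(1) e(2)] by simp
  show "rev_edge (sgraph_restrict G V E) e \<noteq> e" using e is_graphD(4)[OF assms(1)] by simp
  show "rev_edge (sgraph_restrict G V E) (rev_edge (sgraph_restrict G V E) e) = e"
    using e assms(4) rev_rev_edge[OF assms(1)] by simp
  show "src (sgraph_restrict G V E) (rev_edge (sgraph_restrict G V E) e) = tgt (sgraph_restrict G V E) e"
    using e is_graphD(5)[OF assms(1)] by simp
qed (use assms in \<open>auto simp: sgraph_restrict_def\<close>)

definition goo_restrict :: "('v, 'e, 'o, 'm) goo \<Rightarrow> 'v set \<Rightarrow> 'e set \<Rightarrow> ('v, 'e, 'o, 'm) goo" where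
  "goo_restrict X V E = X\<lparr>ugraph := sgraph_restrict (ugraph X) V E\<rparr>"

lemma goo_restrict_simps [simp]:
  "ugraph (goo_restrict X V E) = sgraph_restrict (ugraph X) V E"
  "vobj (goo_restrict X V E) = vobj X" "eobj (goo_restrict X V E) = eobj X"
  "\<phi>0 (goo_restrict X V E) = \<phi>0 X" "\<phi>1 (goo_restrict X V E) = \<phi>1 X"
  by (simp_all add: goo_restrict_def)

definition goo_map_restrict :: "('v, 'e, 'w, 'f, 'm) goo_map \<Rightarrow> 'v set \<Rightarrow> 'e set \<Rightarrow> ('v, 'e, 'w, 'f, 'm) goo_map" where
  "goo_map_restrict \<mu> V E =
     \<lparr>umap = \<lparr>vmap = restrict (vmap (umap \<mu>)) V, emap = restrict (emap (umap \<mu>)) E\<rparr>,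
      vmor = restrict (vmor \<mu>) V, emor = restrict (emor \<mu>) E\<rparr>"

context category_triple
begin

lemma graph_of_objectsI:
  assumes "is_graph (ugraph X)"
    and "\<And>v. v \<in> gverts (ugraph X) \<Longrightarrow> vobj X v \<in> Ob C"
    and "\<And>e. e \<in> gedges (ugraph X) \<Longrightarrow> eobj X e \<in> Ob C"
    and "\<And>e. e \<in> gedges (ugraph X) \<Longrightarrow> eobj X (rev_edge (ugraph X) e) = eobj X e"
    and "\<And>e. e \<in> gedges (ugraph X) \<Longrightarrow> \<phi>0 X e \<in> arrows C M2 (eobj X e) (vobj X (src (ugraph X) e))"
    and "\<And>e. e \<in> gedges (ugraph X) \<Longrightarrow> \<phi>1 X e = \<phi>0 X (rev_edge (ugraph X) e)"
  shows "graph_of_objects C M2 X"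
  unfolding graph_of_objects_def Let_def
proof (intro conjI ballI)
  fix e assume e: "e \<in> gedges (ugraph X)"
  note gr = is_graphD[OF assms(1) e]
  show "eobj X e = eobj X (rev_edge (ugraph X) e)" using assms(4)[OF e] by simp
  show "\<phi>1 X e \<in> arrows C M2 (eobj X e) (vobj X (tgt (ugraph X) e))"
    using assms(5)[OF gr(3)] assms(4,6)[OF e] gr(5) by simp
  show "\<phi>0 X e = \<phi>1 X (rev_edge (ugraph X) e)"
    using assms(6)[OF gr(3)] rev_rev_edge[OF assms(1)] by simp
qed (use assms in auto)

text \<open>
With a vertex, the image of a local isomorphism contains its whole star.
\<close>

lemma local_iso_image_closed:
  assumes "is_graph G1" "local_iso G1 G2 \<alpha>"
  shows "emap \<alpha> ` gedges G1 = {e \<in> gedges G2. src G2 e \<in> vmap \<alpha> ` gverts G1}"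
proof (intro equalityI subsetI)
  have h: "graph_hom G1 G2 \<alpha>" using assms(2) by (simp add: local_iso_def)
  show "e \<in> {e \<in> gedges G2. src G2 e \<in> vmap \<alpha> ` gverts G1}" if "e \<in> emap \<alpha> ` gedges G1" for e
    using that graph_homD[OF h] is_graphD[OF assms(1)] by auto
  fix e assume "e \<in> {e \<in> gedges G2. src G2 e \<in> vmap \<alpha> ` gverts G1}"
  then obtain v where v: "v \<in> gverts G1" "e \<in> star G2 (vmap \<alpha> v)" by auto
  then have "e \<in> emap \<alpha> ` star G1 v" using assms(2) by (auto simp: local_iso_def bij_betw_def)
  then show "e \<in> emap \<alpha> ` gedges G1" by auto
qed

text \<open>
The image of a local isomorphism is a union of whole stars, hence a graph of objects to which local
isomorphisms restrict. Over a connected source it is a connected component, and restricting to it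
turns the lift into a covering.
\<close>

lemma image_of_local_iso:
  assumes X: "graph_of_objects C M2 X" and Y: "graph_of_objects C M2 Y"
    and F: "goo_hom C M1 X Y F" "local_iso (ugraph X) (ugraph Y) (umap F)"
  defines "V \<equiv> vmap (umap F) ` gverts (ugraph X)" and "E \<equiv> emap (umap F) ` gedges (ugraph X)"
  shows "graph_of_objects C M2 (goo_restrict Y V E)"
    and "goo_covering C M1 X (goo_restrict Y V E) F"
    and "\<And>Z \<mu>. \<lbrakk>graph_of_objects C M2 Z; goo_hom C M1 Y Z \<mu>; local_iso (ugraph Y) (ugraph Z) (umap \<mu>)\<rbrakk> \<Longrightarrow>
       goo_hom C M1 (goo_restrict Y V E) Z (goo_map_restrict \<mu> V E) \<and>
       local_iso (ugraph (goo_restrict Y V E)) (ugraph Z) (umap (goo_map_restrict \<mu> V E)) \<and>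
       goo_comp C X (goo_map_restrict \<mu> V E) F = goo_comp C X \<mu> F"
proof -
  let ?R = "goo_restrict Y V E"
  note Fh = goo_homD[OF F(1)] and Fg = graph_homD[OF goo_homD(1)[OF F(1)]]
  note grX = gooD(1)[OF X] and grY = gooD(1)[OF Y]
  have Ein: "E \<subseteq> gedges (ugraph Y)" and Vin: "V \<subseteq> gverts (ugraph Y)" using Fg by (auto simp: E_def V_def)
  have E_eq: "E = {e \<in> gedges (ugraph Y). src (ugraph Y) e \<in> V}"
    unfolding E_def V_def by (rule local_iso_image_closed[OF grX F(2)])
  have Er: "rev_edge (ugraph Y) e \<in> E" if e: "e \<in> E" for e
  proof -
    obtain d where d: "d \<in> gedges (ugraph X)" "e = emap (umap F) d" using e by (auto simp: E_def)
    then have "rev_edge (ugraph Y) e = emap (umap F) (rev_edge (ugraph X) d)" using Fg(5) by simp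
    then show ?thesis using is_graphD(3)[OF grX d(1)] by (auto simp: E_def)
  qed
  have gr: "is_graph (ugraph ?R)"
    using is_graph_restrict[OF grY Ein] E_eq Er by auto
  show R: "graph_of_objects C M2 ?R"
    by (rule graph_of_objectsI[OF gr]) (use Ein Vin gooD[OF Y] Er in auto)
  have star: "star (ugraph ?R) v = star (ugraph Y) v" if "v \<in> V" for v
    using that E_eq by auto
  have FR: "graph_hom (ugraph X) (ugraph ?R) (umap F)"
    using Fh(1) unfolding graph_hom_def by (auto simp: PiE_def Pi_def E_def V_def)
  have "goo_hom C M1 X ?R F"
    by (rule goo_homI[OF X R FR]) (use Fh F(1) in \<open>auto simp: goo_hom_def Let_def PiE_def\<close>)
  moreover have "graph_covering (ugraph X) (ugraph ?R) (umap F)"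
    using FR F(2) star unfolding graph_covering_def local_iso_def by (simp add: E_def V_def)
  ultimately show "goo_covering C M1 X ?R F" by (simp add: goo_covering_def)
  fix Z \<mu> assume Z: "graph_of_objects C M2 Z" and m: "goo_hom C M1 Y Z \<mu>"
    and ml: "local_iso (ugraph Y) (ugraph Z) (umap \<mu>)"
  let ?m = "goo_map_restrict \<mu> V E"
  note mh = goo_homD[OF m] and mg = graph_homD[OF goo_homD(1)[OF m]]
  have src: "src (ugraph Y) e \<in> V" "tgt (ugraph Y) e \<in> V" if "e \<in> E" for e
    using that E_eq Er[OF that] is_graphD(5)[OF grY] by auto
  have h: "graph_hom (ugraph ?R) (ugraph Z) (umap ?m)"
    unfolding graph_hom_def using mg src Er Vin Ein by (auto simp: goo_map_restrict_def)
  have mR: "goo_hom C M1 ?R Z ?m"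
    by (rule goo_homI[OF R Z h])
      (use mh src Er Vin Ein in \<open>auto simp: goo_map_restrict_def\<close>)
  have "local_iso (ugraph ?R) (ugraph Z) (umap ?m)"
    unfolding local_iso_def
  proof (intro conjI ballI)
    fix v assume "v \<in> gverts (ugraph ?R)"
    then have v: "v \<in> V" "v \<in> gverts (ugraph Y)" using Vin by auto
    have "bij_betw (emap (umap \<mu>)) (star (ugraph Y) v) (star (ugraph Z) (vmap (umap \<mu>) v))"
      using ml v(2) by (auto simp: local_iso_def)
    moreover have "emap (umap ?m) e = emap (umap \<mu>) e" if "e \<in> star (ugraph Y) v" for e
      using that v E_eq by (auto simp: goo_map_restrict_def)
    moreover have "vmap (umap ?m) v = vmap (umap \<mu>) v" using v by (simp add: goo_map_restrict_def)
    ultimately show "bij_betw (emap (umap ?m)) (star (ugraph ?R) v) (star (ugraph Z) (vmap (umap ?m) v))"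
      unfolding star[OF v(1)] by (subst bij_betw_cong[of _ _ "emap (umap \<mu>)"]) auto
  qed (fact h)
  moreover have "goo_comp C X ?m F = goo_comp C X \<mu> F"
    unfolding goo_comp_def graph_comp_def goo_map_restrict_def
    by (auto simp: compose_def restrict_def fun_eq_iff E_def V_def)
  ultimately show "goo_hom C M1 ?R Z ?m \<and> local_iso (ugraph ?R) (ugraph Z) (umap ?m) \<and>
       goo_comp C X ?m F = goo_comp C X \<mu> F"
    using mR by blast
qed

end

section \<open>Gluing germs into a graph of objects\<close>

context category_triple
begin

text \<open>
A type is a pair of edges together with a morphism between their objects. Inverse edges carry the
same object and the same morphism.
\<close>

definition type_rev :: "('v1, 'e1) sgraph \<Rightarrow> ('v2, 'e2) sgraph \<Rightarrow> 'e1 \<times> 'e2 \<times> 'm \<Rightarrow> 'e1 \<times> 'e2 \<times> 'm" where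
  "type_rev G1 G2 \<epsilon> = (rev_edge G1 (fst \<epsilon>), rev_edge G2 (fst (snd \<epsilon>)), snd (snd \<epsilon>))"

text \<open>
Encoding the local isomorphism of stars by its set of types makes it a plain finite set. The vertex
morphism \<open>m\<close> is kept apart: many choices may be compatible with the same types, and a
finite vertex set must not depend on them.
\<close>

definition is_germ :: "('v1, 'e1, 'o, 'm) goo \<Rightarrow> ('v2, 'e2, 'o, 'm) goo \<Rightarrow>
    'v1 \<Rightarrow> 'v2 \<Rightarrow> ('e1 \<times> 'e2 \<times> 'm) set \<Rightarrow> 'm \<Rightarrow> bool" where
  "is_germ X1 X2 v1 v2 S m \<longleftrightarrow>
     v1 \<in> gverts (ugraph X1) \<and> v2 \<in> gverts (ugraph X2) \<and>
     bij_betw fst S (star (ugraph X1) v1) \<and> bij_betw (\<lambda>\<epsilon>. fst (snd \<epsilon>)) S (star (ugraph X2) v2) \<and>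
     m \<in> iso (vobj X1 v1) (vobj X2 v2) \<and>
     (\<forall>\<epsilon> \<in> S. snd (snd \<epsilon>) \<in> iso (eobj X1 (fst \<epsilon>)) (eobj X2 (fst (snd \<epsilon>))) \<and>
        m \<cdot> \<phi>0 X1 (fst \<epsilon>) = \<phi>0 X2 (fst (snd \<epsilon>)) \<cdot> snd (snd \<epsilon>))"

text \<open>
The edges are darts, that is, pairs of an index \<open>x\<close> and a type in \<open>S x\<close>, and inversion is an
involution of the darts that reverses types. The balance condition \<open>bal\<close> is what such an
involution needs. Objects are taken from \<open>X1\<close>, so the map to \<open>X1\<close> has identity components and the
map to \<open>X2\<close> has the morphisms recorded by the germs.
\<close>

theorem glue_germs:
  fixes X1 :: "('v1, 'e1, 'o, 'm) goo" and X2 :: "('v2, 'e2, 'o, 'm) goo" and n :: nat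
    and l1 :: "nat \<Rightarrow> 'v1" and l2 :: "nat \<Rightarrow> 'v2" and S :: "nat \<Rightarrow> ('e1 \<times> 'e2 \<times> 'm) set"
    and vm :: "nat \<Rightarrow> 'm"
  assumes X1: "graph_of_objects C M2 X1" and X2: "graph_of_objects C M2 X2"
    and fin: "finite (gedges (ugraph X1))"
    and germ: "\<And>x. x < n \<Longrightarrow> is_germ X1 X2 (l1 x) (l2 x) (S x) (vm x)"
    and bal: "\<And>\<epsilon>. card {x. x < n \<and> \<epsilon> \<in> S x} = card {x. x < n \<and> type_rev (ugraph X1) (ugraph X2) \<epsilon> \<in> S x}"
  shows "\<exists>(X :: (nat, nat, 'o, 'm) goo) \<mu>1 \<mu>2.
    graph_of_objects C M2 X \<and> gverts (ugraph X) = {..<n} \<and> finite (gedges (ugraph X)) \<and>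
    goo_hom C M1 X X1 \<mu>1 \<and> local_iso (ugraph X) (ugraph X1) (umap \<mu>1) \<and>
    goo_hom C M1 X X2 \<mu>2 \<and> local_iso (ugraph X) (ugraph X2) (umap \<mu>2) \<and>
    (\<forall>x<n. vmap (umap \<mu>1) x = l1 x \<and> vmap (umap \<mu>2) x = l2 x \<and>
       vmor \<mu>1 x = Ident C (vobj X1 (l1 x)) \<and> vmor \<mu>2 x = vm x) \<and>
    (\<forall>e \<in> gedges (ugraph X). (emap (umap \<mu>1) e, emap (umap \<mu>2) e, emor \<mu>2 e) \<in> S (src (ugraph X) e) \<and>
       emor \<mu>1 e = Ident C (eobj X1 (emap (umap \<mu>1) e)))"
proof -
  let ?G1 = "ugraph X1" and ?G2 = "ugraph X2"
  note g1 = gooD(1)[OF X1] and g2 = gooD(1)[OF X2]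
  let ?bar = "type_rev ?G1 ?G2"
  have barbar: "?bar (?bar \<epsilon>) = \<epsilon>" for \<epsilon>
    using rev_rev_edge[OF g1] rev_rev_edge[OF g2] by (simp add: type_rev_def)
  have finS: "finite (S x)" if "x < n" for x
  proof -
    have b: "bij_betw fst (S x) (star ?G1 (l1 x))" using germ[OF that] by (simp add: is_germ_def)
    have "finite (star ?G1 (l1 x))" by (rule finite_subset[OF _ fin]) auto
    then show ?thesis using bij_betw_finite[OF b] by simp
  qed
  have S: "fst \<epsilon> \<in> gedges ?G1" "src ?G1 (fst \<epsilon>) = l1 x" "fst (snd \<epsilon>) \<in> gedges ?G2"
    "src ?G2 (fst (snd \<epsilon>)) = l2 x" if "x < n" "\<epsilon> \<in> S x" for x \<epsilon>
  proof -
    have b: "bij_betw fst (S x) (star ?G1 (l1 x))" "bij_betw (\<lambda>\<epsilon>. fst (snd \<epsilon>)) (S x) (star ?G2 (l2 x))"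
      using germ[OF that(1)] by (auto simp: is_germ_def)
    show "fst \<epsilon> \<in> gedges ?G1" "src ?G1 (fst \<epsilon>) = l1 x" "fst (snd \<epsilon>) \<in> gedges ?G2"
      "src ?G2 (fst (snd \<epsilon>)) = l2 x"
      using bij_betwE[OF b(1)] bij_betwE[OF b(2)] that(2) by auto
  qed
  \<comment> \<open>darts, which are then numbered to obtain edges of type \<^typ>\<open>nat\<close>\<close>
  define D where "D = (SIGMA x:{..<n}. S x)"
  have finD: "finite D" unfolding D_def using finS by auto
  then obtain dec where dec: "bij_betw dec {..<card D} D"
    using ex_bij_betw_nat_finite by (metis atLeast0LessThan)
  define N where "N = card D"
  define tp where "tp e = snd (dec e)" for e
  define sr where "sr e = fst (dec e)" for e
  have decD: "dec e \<in> D" if "e < N" for e using bij_betwE[OF dec] that by (auto simp: N_def)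
  have sr: "sr e < n" "tp e \<in> S (sr e)" if "e < N" for e
    using decD[OF that] by (auto simp: D_def sr_def tp_def)
  have tp_count: "card {e \<in> {..<N}. tp e = \<epsilon>} = card {x. x < n \<and> \<epsilon> \<in> S x}" for \<epsilon>
  proof -
    have "bij_betw sr {e \<in> {..<N}. tp e = \<epsilon>} {x. x < n \<and> \<epsilon> \<in> S x}"
    proof (rule bij_betw_imageI)
      show "inj_on sr {e \<in> {..<N}. tp e = \<epsilon>}"
      proof (rule inj_onI)
        fix a b assume "a \<in> {e \<in> {..<N}. tp e = \<epsilon>}" "b \<in> {e \<in> {..<N}. tp e = \<epsilon>}" "sr a = sr b"
        then have "dec a = dec b" "a < N" "b < N" by (auto simp: sr_def tp_def prod_eq_iff)
        then show "a = b" using dec by (auto simp: bij_betw_def N_def dest: inj_onD)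
      qed
      show "sr ` {e \<in> {..<N}. tp e = \<epsilon>} = {x. x < n \<and> \<epsilon> \<in> S x}"
      proof (intro equalityI subsetI)
        fix x assume "x \<in> {x. x < n \<and> \<epsilon> \<in> S x}"
        then have "(x, \<epsilon>) \<in> dec ` {..<N}" using bij_betw_imp_surj_on[OF dec] by (auto simp: D_def N_def)
        then obtain e where "e < N" "dec e = (x, \<epsilon>)" by auto
        then have "e \<in> {e \<in> {..<N}. tp e = \<epsilon>}" "sr e = x" by (auto simp: tp_def sr_def)
        then show "x \<in> sr ` {e \<in> {..<N}. tp e = \<epsilon>}" by blast
      qed (use sr in auto)
    qed
    then show ?thesis by (rule bij_betw_same_card)
  qed
  have "\<exists>\<iota>. \<forall>d \<in> {..<N}. \<iota> d \<in> {..<N} \<and> \<iota> (\<iota> d) = d \<and> tp (\<iota> d) = ?bar (tp d)"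
  proof (rule matching_involution)
    fix d assume "d \<in> {..<N}"
    then have "fst (tp d) \<in> gedges ?G1" using sr[of d] S by auto
    then have "rev_edge ?G1 (fst (tp d)) \<noteq> fst (tp d)" using is_graphD(4)[OF g1] by blast
    then show "?bar (tp d) \<noteq> tp d" by (metis type_rev_def fst_conv)
  qed (use barbar tp_count bal in auto)
  then obtain \<iota>0 where \<iota>0: "\<And>d. d < N \<Longrightarrow> \<iota>0 d < N \<and> \<iota>0 (\<iota>0 d) = d \<and> tp (\<iota>0 d) = ?bar (tp d)"
    by auto
  define \<iota> where "\<iota> d = (if d < N then \<iota>0 d else d)" for d
  have \<iota>: "\<iota> d < N" "\<iota> (\<iota> d) = d" "tp (\<iota> d) = ?bar (tp d)" if "d < N" for d
    using \<iota>0[OF that] that by (auto simp: \<iota>_def)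
  define e1 where "e1 e = fst (tp e)" for e
  define e2 where "e2 e = fst (snd (tp e))" for e
  define t where "t e = snd (snd (tp e))" for e
  have e1: "e1 e \<in> gedges ?G1" "src ?G1 (e1 e) = l1 (sr e)" "e2 e \<in> gedges ?G2"
    "src ?G2 (e2 e) = l2 (sr e)" if "e < N" for e
    using S[OF sr[OF that]] by (auto simp: e1_def e2_def)
  have eb: "e1 (\<iota> e) = rev_edge ?G1 (e1 e)" "e2 (\<iota> e) = rev_edge ?G2 (e2 e)" "t (\<iota> e) = t e"
    if "e < N" for e using \<iota>(3)[OF that] by (auto simp: e1_def e2_def t_def type_rev_def)
  have t: "t e \<in> iso (eobj X1 (e1 e)) (eobj X2 (e2 e))"
    "vm (sr e) \<cdot> \<phi>0 X1 (e1 e) = \<phi>0 X2 (e2 e) \<cdot> t e" if "e < N" for e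
    using germ[OF sr(1)[OF that]] sr(2)[OF that] by (auto simp: is_germ_def e1_def e2_def t_def)
  define G where "G = \<lparr>dig = \<lparr>verts = {..<n}, arcs = {..<N}, tail = sr, head = (\<lambda>e. sr (\<iota> e))\<rparr>, rev_edge = \<iota>\<rparr>"
  have G: "gverts G = {..<n}" "gedges G = {..<N}" "src G = sr" "tgt G = (\<lambda>e. sr (\<iota> e))" "rev_edge G = \<iota>"
    by (auto simp: G_def)
  have grG: "is_graph G"
  proof (rule is_graphI, unfold G)
    fix e assume "e \<in> {..<N}"
    then have e: "e < N" by simp
    have "e1 (\<iota> e) \<noteq> e1 e" using eb(1)[OF e] is_graphD(4)[OF g1 e1(1)[OF e]] by simp
    then show "\<iota> e \<noteq> e" by auto
  qed (use sr \<iota> in \<open>auto simp: \<iota>_def\<close>)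
  define X where "X = \<lparr>ugraph = G, vobj = (\<lambda>x. vobj X1 (l1 x)), eobj = (\<lambda>e. eobj X1 (e1 e)),
     \<phi>0 = (\<lambda>e. \<phi>0 X1 (e1 e)), \<phi>1 = (\<lambda>e. \<phi>1 X1 (e1 e))\<rparr>"
  have X: "ugraph X = G" "vobj X = (\<lambda>x. vobj X1 (l1 x))" "eobj X = (\<lambda>e. eobj X1 (e1 e))"
     "\<phi>0 X = (\<lambda>e. \<phi>0 X1 (e1 e))" "\<phi>1 X = (\<lambda>e. \<phi>1 X1 (e1 e))" by (auto simp: X_def)
  have l: "l1 x \<in> gverts ?G1" "l2 x \<in> gverts ?G2" if "x < n" for x
    using germ[OF that] by (auto simp: is_germ_def)
  have gX: "graph_of_objects C M2 X"
  proof (rule graph_of_objectsI, unfold X G)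
    fix e assume "e \<in> {..<N}"
    then have e: "e < N" by simp
    show "\<phi>0 X1 (e1 e) \<in> arrows C M2 (eobj X1 (e1 e)) (vobj X1 (l1 (sr e)))"
      using gooD(5)[OF X1 e1(1)[OF e]] e1(2)[OF e] by simp
    show "\<phi>1 X1 (e1 e) = \<phi>0 X1 (e1 (\<iota> e))"
      using gooD(7)[OF X1 e1(1)[OF e]] eb(1)[OF e] by simp
    show "eobj X1 (e1 (\<iota> e)) = eobj X1 (e1 e)"
      using gooD(4)[OF X1 e1(1)[OF e]] eb(1)[OF e] by simp
  qed (use grG l e1 gooD[OF X1] in auto)
  have tgt: "tgt ?G1 (e1 e) = l1 (sr (\<iota> e))" "tgt ?G2 (e2 e) = l2 (sr (\<iota> e))" if "e < N" for e
    using e1(2,4)[OF \<iota>(1)[OF that]] eb(1,2)[OF that]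
      is_graphD(5)[OF g1 e1(1)[OF that]] is_graphD(5)[OF g2 e1(3)[OF that]] by auto
  define \<mu>1 where "\<mu>1 = \<lparr>umap = \<lparr>vmap = restrict l1 {..<n}, emap = restrict e1 {..<N}\<rparr>,
     vmor = (\<lambda>x \<in> {..<n}. Ident C (vobj X1 (l1 x))), emor = (\<lambda>e \<in> {..<N}. Ident C (eobj X1 (e1 e)))\<rparr>"
  define \<mu>2 where "\<mu>2 = \<lparr>umap = \<lparr>vmap = restrict l2 {..<n}, emap = restrict e2 {..<N}\<rparr>,
     vmor = restrict vm {..<n}, emor = restrict t {..<N}\<rparr>"
  have h1: "graph_hom G ?G1 (umap \<mu>1)" and h2: "graph_hom G ?G2 (umap \<mu>2)"
    unfolding graph_hom_def G using l e1 tgt eb \<iota> sr by (auto simp: \<mu>1_def \<mu>2_def)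
  have m1: "goo_hom C M1 X X1 \<mu>1"
  proof (rule goo_homI[OF gX X1], unfold X G)
    fix e assume "e \<in> {..<N}"
    then have e: "e < N" by simp
    have a: "\<phi>0 X1 (e1 e) \<in> arrows C (Mor C) (eobj X1 (e1 e)) (vobj X1 (l1 (sr e)))"
      using M2_arrow_Mor[OF gooD(5)[OF X1 e1(1)[OF e]]] e1(2)[OF e] by simp
    show "vmor \<mu>1 (sr e) \<cdot> \<phi>0 X1 (e1 e) = \<phi>0 X1 (emap (umap \<mu>1) e) \<cdot> emor \<mu>1 e"
      using arrow_id[OF a] e sr(1)[OF e] by (simp add: \<mu>1_def)
    show "emor \<mu>1 (\<iota> e) = emor \<mu>1 e"
      using e \<iota>(1)[OF e] gooD(4)[OF X1 e1(1)[OF e]] eb(1)[OF e] by (simp add: \<mu>1_def)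
  qed (use h1 l e1 gooD[OF X1] iso_id in \<open>auto simp: \<mu>1_def\<close>)
  have m2: "goo_hom C M1 X X2 \<mu>2"
  proof (rule goo_homI[OF gX X2], unfold X G)
    fix x assume "x \<in> {..<n}"
    then show "vmor \<mu>2 x \<in> iso (vobj X1 (l1 x)) (vobj X2 (vmap (umap \<mu>2) x))"
      using germ[of x] by (simp add: \<mu>2_def is_germ_def)
  next
    fix e assume "e \<in> {..<N}"
    then have e: "e < N" by simp
    show "vmor \<mu>2 (sr e) \<cdot> \<phi>0 X1 (e1 e) = \<phi>0 X2 (emap (umap \<mu>2) e) \<cdot> emor \<mu>2 e"
      using t[OF e] e sr(1)[OF e] by (simp add: \<mu>2_def)
    show "emor \<mu>2 (\<iota> e) = emor \<mu>2 e"
      using e \<iota>(1)[OF e] eb(3)[OF e] by (simp add: \<mu>2_def)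
    show "emor \<mu>2 e \<in> iso (eobj X1 (e1 e)) (eobj X2 (emap (umap \<mu>2) e))"
      using t(1)[OF e] e by (simp add: \<mu>2_def)
  qed (use h2 in \<open>auto simp: \<mu>2_def\<close>)
  have tpb: "bij_betw tp (star G x) (S x)" if x: "x < n" for x
  proof (rule bij_betw_imageI)
    show "inj_on tp (star G x)"
    proof (rule inj_onI)
      fix a b assume "a \<in> star G x" "b \<in> star G x" "tp a = tp b"
      then have "dec a = dec b" "a < N" "b < N" by (auto simp: sr_def tp_def prod_eq_iff G)
      then show "a = b" using dec by (auto simp: bij_betw_def N_def dest: inj_onD)
    qed
    show "tp ` star G x = S x"
    proof (intro equalityI subsetI)
      fix \<epsilon> assume "\<epsilon> \<in> S x"
      then have "(x, \<epsilon>) \<in> dec ` {..<N}" using x bij_betw_imp_surj_on[OF dec] by (auto simp: D_def N_def)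
      then obtain e where "e < N" "dec e = (x, \<epsilon>)" by auto
      then have "e \<in> star G x" "tp e = \<epsilon>" by (auto simp: tp_def sr_def G)
      then show "\<epsilon> \<in> tp ` star G x" by blast
    qed (use sr in \<open>auto simp: G\<close>)
  qed
  have c1: "local_iso G ?G1 (umap \<mu>1)" and c2: "local_iso G ?G2 (umap \<mu>2)"
  proof -
    have "bij_betw e1 (star G x) (star ?G1 (l1 x))" "bij_betw e2 (star G x) (star ?G2 (l2 x))" if x: "x < n" for x
      using bij_betw_trans[OF tpb[OF x], of fst] bij_betw_trans[OF tpb[OF x], of "\<lambda>\<epsilon>. fst (snd \<epsilon>)"] germ[OF x]
      by (auto simp: is_germ_def e1_def[abs_def] e2_def[abs_def] comp_def)
    note be = this
    have ee: "emap (umap \<mu>1) e = e1 e" "emap (umap \<mu>2) e = e2 e" if "e \<in> star G x" for e x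
      using that by (simp_all add: \<mu>1_def \<mu>2_def G)
    have vv: "vmap (umap \<mu>1) x = l1 x" "vmap (umap \<mu>2) x = l2 x" if "x < n" for x
      using that by (simp_all add: \<mu>1_def \<mu>2_def)
    have cc: "bij_betw (emap (umap \<mu>1)) (star G x) B1 = bij_betw e1 (star G x) B1"
      "bij_betw (emap (umap \<mu>2)) (star G x) B2 = bij_betw e2 (star G x) B2" for B1 B2 x
      by (rule bij_betw_cong, rule ee, assumption)+
    have
      "bij_betw (emap (umap \<mu>1)) (star G x) (star ?G1 (vmap (umap \<mu>1) x))"
      "bij_betw (emap (umap \<mu>2)) (star G x) (star ?G2 (vmap (umap \<mu>2) x))" if "x < n" for x
      using be[OF that] cc unfolding vv[OF that] by blast+
    then show "local_iso G ?G1 (umap \<mu>1)" "local_iso G ?G2 (umap \<mu>2)"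
      using h1 h2 by (auto simp: local_iso_def G)
  qed
  have E: "(emap (umap \<mu>1) e, emap (umap \<mu>2) e, emor \<mu>2 e) \<in> S (src G e)
      \<and> emor \<mu>1 e = Ident C (eobj X1 (emap (umap \<mu>1) e))" if "e \<in> gedges G" for e
    using sr[of e] that by (auto simp: G \<mu>1_def \<mu>2_def e1_def e2_def t_def)
  have V: "vmap (umap \<mu>1) x = l1 x \<and> vmap (umap \<mu>2) x = l2 x \<and>
       vmor \<mu>1 x = Ident C (vobj X1 (l1 x)) \<and> vmor \<mu>2 x = vm x" if "x < n" for x
    using that by (auto simp: \<mu>1_def \<mu>2_def)
  show ?thesis
  proof (intro exI[of _ X] exI[of _ \<mu>1] exI[of _ \<mu>2], unfold X(1), intro conjI allI impI ballI)
    show "finite (gedges G)" by (simp add: G)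
  qed (rule gX G(1) m1 m2 c1 c2 V[THEN conjunct1] V[THEN conjunct2, THEN conjunct1]
    V[THEN conjunct2, THEN conjunct2, THEN conjunct1] V[THEN conjunct2, THEN conjunct2, THEN conjunct2]
    E[THEN conjunct1] E[THEN conjunct2] | assumption)+
qed

end

section \<open>The two covers from the tree\<close>

context category_triple
begin

text \<open>
The cover is the image of a lift \<open>\<nu>1\<close> of \<open>f1\<close>. The composite of \<open>\<nu>1\<close> with \<open>\<mu>2\<close> and the covering
\<open>f2\<close> are two local isomorphisms from a tree, so they differ by an automorphism \<open>g\<close>; this also
shows that the composite is surjective.
\<close>

theorem common_cover_of_glued:
  fixes Xh :: "('a, 'b, 'o, 'm) goo"
  assumes T: "graph_of_objects C M2 T" and X1: "graph_of_objects C M2 X1"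
    and X2: "graph_of_objects C M2 X2" and Xh: "graph_of_objects C M2 Xh"
    and f1: "goo_covering C M1 T X1 f1" and f2: "goo_covering C M1 T X2 f2"
    and tree: "is_tree (ugraph T)"
    and m1: "goo_hom C M1 Xh X1 \<mu>1" "local_iso (ugraph Xh) (ugraph X1) (umap \<mu>1)"
    and m2: "goo_hom C M1 Xh X2 \<mu>2" "local_iso (ugraph Xh) (ugraph X2) (umap \<mu>2)"
    and r: "r \<in> gverts (ugraph T)" "x0 \<in> gverts (ugraph Xh)" "vmap (umap \<mu>1) x0 = vmap (umap f1) r"
  shows "\<exists>(X :: ('a, 'b, 'o, 'm) goo) \<mu>1' \<mu>2' \<nu>1 \<nu>2 g.
      graph_of_objects C M2 X \<and> gverts (ugraph X) \<subseteq> gverts (ugraph Xh) \<and> gedges (ugraph X) \<subseteq> gedges (ugraph Xh) \<and>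
      goo_covering C M1 X X1 \<mu>1' \<and> goo_covering C M1 X X2 \<mu>2' \<and>
      goo_covering C M1 T X \<nu>1 \<and> goo_covering C M1 T X \<nu>2 \<and>
      g \<in> carrier (goo_Aut C M1 T) \<and>
      f1 = goo_comp C T \<mu>1' \<nu>1 \<and> f2 = goo_comp C T \<mu>2' \<nu>2 \<and> \<nu>1 = goo_comp C T \<nu>2 g \<and>
      goo_hom C M1 T Xh \<nu>1 \<and> f1 = goo_comp C T \<mu>1 \<nu>1 \<and> goo_comp C T f2 g = goo_comp C T \<mu>2 \<nu>1"
proof -
  let ?T = "ugraph T" and ?G1 = "ugraph X1" and ?G2 = "ugraph X2" and ?Gh = "ugraph Xh"
  note gT = gooD(1)[OF T] and gXh = gooD(1)[OF Xh]
  have f1h: "goo_hom C M1 T X1 f1" and f1c: "graph_covering ?T ?G1 (umap f1)"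
    and f2h: "goo_hom C M1 T X2 f2" and f2c: "graph_covering ?T ?G2 (umap f2)"
    using f1 f2 by (auto simp: goo_covering_def)
  obtain F where F: "graph_hom ?T ?Gh F" "graph_comp ?T (umap \<mu>1) F = umap f1" "vmap F r = x0"
    using tree_lift_exists[OF tree gXh goo_homD(1)[OF f1h] m1(2) r] by blast
  define \<nu>1 where "\<nu>1 = goo_lift T \<mu>1 f1 F"
  have u1: "umap \<nu>1 = F" by (simp add: \<nu>1_def goo_lift_def)
  note n1 = goo_lift[OF T Xh X1 f1h m1(1) F(1,2), folded \<nu>1_def]
  have Fl: "local_iso ?T ?Gh (umap \<nu>1)"
    using local_iso_cancel[OF gT F(1) m1(2)] F(2) local_iso_of_covering[OF f1c] u1 by simp
  define V where "V = vmap (umap \<nu>1) ` gverts ?T"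
  define E where "E = emap (umap \<nu>1) ` gedges ?T"
  define X where "X = goo_restrict Xh V E"
  note im = image_of_local_iso[OF T Xh n1(1) Fl, folded V_def E_def, folded X_def]
  define \<mu>1' where "\<mu>1' = goo_map_restrict \<mu>1 V E"
  define \<mu>2' where "\<mu>2' = goo_map_restrict \<mu>2 V E"
  have r1: "goo_hom C M1 X X1 \<mu>1'" "local_iso (ugraph X) ?G1 (umap \<mu>1')" "goo_comp C T \<mu>1' \<nu>1 = f1"
    using im(3)[OF X1 m1] n1(2) by (auto simp: \<mu>1'_def)
  have r2: "goo_hom C M1 X X2 \<mu>2'" "local_iso (ugraph X) ?G2 (umap \<mu>2')" "goo_comp C T \<mu>2' \<nu>1 = goo_comp C T \<mu>2 \<nu>1"
    using im(3)[OF X2 m2] by (auto simp: \<mu>2'_def)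
  have n1c: "goo_hom C M1 T X \<nu>1" "graph_covering ?T (ugraph X) (umap \<nu>1)"
    using im(2) by (auto simp: goo_covering_def)
  have c1: "goo_covering C M1 X X1 \<mu>1'"
    using covering_of_local_iso[OF r1(2) goo_homD(1)[OF n1c(1)]] r1 f1c
    by (metis goo_comp_apply(1) goo_covering_def)
  define a where "a = goo_comp C T \<mu>2' \<nu>1"
  have ah: "goo_hom C M1 T X2 a" unfolding a_def by (rule goo_hom_comp[OF T im(1) X2 n1c(1) r2(1)])
  have al: "local_iso ?T ?G2 (umap a)"
    unfolding a_def using local_iso_comp[OF gT local_iso_of_covering[OF n1c(2)] r2(2)] by simp
  \<comment> \<open>surjectivity of \<open>f2\<close> yields the base point for lifting \<open>a\<close> along \<open>f2\<close>\<close>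
  have "vmap (umap a) r \<in> vmap (umap f2) ` gverts ?T"
    using f2c graph_homD(1)[OF goo_homD(1)[OF ah] r(1)] by (simp add: graph_covering_def)
  then obtain w where w: "w \<in> gverts ?T" "vmap (umap f2) w = vmap (umap a) r" by auto
  obtain \<gamma> where \<gamma>: "graph_aut ?T \<gamma>" "graph_comp ?T (umap f2) \<gamma> = umap a"
    using tree_lift_aut[OF tree al local_iso_of_covering[OF f2c] r(1) w] by blast
  have \<gamma>h: "graph_hom ?T ?T \<gamma>" using \<gamma>(1) by (simp add: graph_aut_def)
  define g where "g = goo_lift T f2 a \<gamma>"
  note g = goo_lift[OF T T X2 ah f2h \<gamma>h \<gamma>(2), folded g_def]
  have gA: "g \<in> carrier (goo_Aut C M1 T)" using g(1) \<gamma>(1) by (simp add: goo_Aut_def) (simp add: g_def goo_lift_def)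
  interpret A: group "goo_Aut C M1 T" by (rule group_goo_Aut[OF T])
  define k where "k = inv\<^bsub>goo_Aut C M1 T\<^esub> g"
  have kA: "k \<in> carrier (goo_Aut C M1 T)" unfolding k_def using gA by simp
  have kg: "goo_comp C T k g = goo_id C T" "goo_comp C T g k = goo_id C T"
    using A.l_inv[OF gA] A.r_inv[OF gA] by (auto simp: k_def goo_Aut_def)
  have kh: "goo_hom C M1 T T k" "graph_aut ?T (umap k)" using kA by (auto simp: goo_Aut_def)
  define \<nu>2 where "\<nu>2 = goo_comp C T \<nu>1 k"
  have n2h: "goo_hom C M1 T X \<nu>2" unfolding \<nu>2_def by (rule goo_hom_comp[OF T T im(1) kh(1) n1c(1)])
  have n2c: "graph_covering ?T (ugraph X) (umap \<nu>2)"
    unfolding \<nu>2_def using covering_comp[OF gT graph_aut_covering[OF gT kh(2)] n1c(2)] by simp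
  have "goo_comp C T \<nu>2 g = goo_comp C T \<nu>1 (goo_comp C T k g)"
    unfolding \<nu>2_def by (rule goo_comp_assoc[OF T T T im(1) g(1) kh(1) n1c(1)])
  then have n2g: "goo_comp C T \<nu>2 g = \<nu>1" using kg goo_comp_id(1)[OF T im(1) n1c(1)] by simp
  have "goo_comp C T \<mu>2' \<nu>2 = goo_comp C T a k"
    unfolding \<nu>2_def a_def using goo_comp_assoc[OF T T im(1) X2 kh(1) n1c(1) r2(1)] by simp
  also have "\<dots> = goo_comp C T f2 (goo_comp C T g k)"
    unfolding g(2)[symmetric] by (rule goo_comp_assoc[OF T T T X2 kh(1) g(1) f2h])
  also have "\<dots> = f2" using kg goo_comp_id(1)[OF T X2 f2h] by simp
  finally have f2n: "goo_comp C T \<mu>2' \<nu>2 = f2" .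
  have c2: "goo_covering C M1 X X2 \<mu>2'"
    using covering_of_local_iso[OF r2(2) goo_homD(1)[OF n2h]] r2 f2c f2n
    by (metis goo_comp_apply(1) goo_covering_def)
  have "gverts (ugraph X) \<subseteq> gverts ?Gh" "gedges (ugraph X) \<subseteq> gedges ?Gh"
    using graph_homD(1,2)[OF F(1)] u1 by (auto simp: X_def V_def E_def)
  then show ?thesis
    using im(1) c1 c2 im(2) n2h n2c gA r1(3)[symmetric] f2n[symmetric] n2g[symmetric]
      n1(1) n1(2)[symmetric] g(2)[unfolded a_def r2(3)]
    by (intro exI[of _ X] exI[of _ \<mu>1'] exI[of _ \<mu>2'] exI[of _ \<nu>1] exI[of _ \<nu>2] exI[of _ g] conjI)
      (assumption | simp only: goo_covering_def)+
qed

end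

section \<open>Arithmetic of the vertex bound\<close>

text \<open>
The images are the quotients of \<open>A\<close> by the kernels of \<open>F\<close> and \<open>G\<close>.
\<close>

lemma card_image_eq_card_image:
  assumes "\<And>x y. x \<in> A \<Longrightarrow> y \<in> A \<Longrightarrow> F x = F y \<longleftrightarrow> G x = G y"
  shows "card (F ` A) = card (G ` A)" "finite (F ` A) \<longleftrightarrow> finite (G ` A)"
proof -
  let ?P = "(\<lambda>x. (F x, G x)) ` A"
  have i: "inj_on fst ?P" "inj_on snd ?P" using assms by (auto simp: inj_on_def)
  have e: "F ` A = fst ` ?P" "G ` A = snd ` ?P" by (simp_all add: image_image)
  show "card (F ` A) = card (G ` A)" unfolding e using card_image[OF i(1)] card_image[OF i(2)] by simp
  show "finite (F ` A) \<longleftrightarrow> finite (G ` A)"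
    unfolding e using finite_image_iff[OF i(1)] finite_image_iff[OF i(2)] by simp
qed

text \<open>
The least common multiple of all numbers up to \<open>V\<close> whose prime factors are at most \<open>d\<close>.
\<close>

definition smooth_bound :: "nat \<Rightarrow> nat \<Rightarrow> nat" where
  "smooth_bound d V = (\<Prod>p | prime p \<and> p \<le> d. p ^ Max {k. p ^ k \<le> V})"

lemma finite_exponents: "prime (p::nat) \<Longrightarrow> finite {k. p ^ k \<le> V}"
proof (rule finite_subset)
  assume p: "prime p"
  show "{k. p ^ k \<le> V} \<subseteq> {..V}"
  proof
    fix k assume "k \<in> {k. p ^ k \<le> V}"
    moreover have "k < p ^ k" using power_gt_expt[of p k] prime_gt_1_nat[OF p] by simp
    ultimately show "k \<in> {..V}" by simp
  qed
qed simp

lemma smooth_bound_pos: "smooth_bound d V > 0"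
  unfolding smooth_bound_def by (rule prod_pos) (auto simp: prime_gt_0_nat)

text \<open>
Apart from 2, primes are odd and greater than 1.
\<close>

lemma card_primes_le: "2 * card {p::nat. prime p \<and> p \<le> d} \<le> d + 1"
proof -
  have "{p::nat. prime p \<and> p \<le> d} \<subseteq> (if d \<ge> 2 then {2} else {}) \<union> (\<lambda>i. 2 * i + 1) ` {1..(d - 1) div 2}"
  proof
    fix p assume "p \<in> {p. prime p \<and> p \<le> d}"
    then have p: "prime p" "p \<le> d" by auto
    show "p \<in> (if d \<ge> 2 then {2} else {}) \<union> (\<lambda>i. 2 * i + 1) ` {1..(d - 1) div 2}"
    proof (cases "p = 2")
      case False
      then have "odd p" using p prime_odd_nat[of p] prime_ge_2_nat[OF p(1)] by simp
      then obtain i where i: "p = 2 * i + 1" by (elim oddE)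
      moreover have "i \<noteq> 0" using p(1) i by (intro notI) simp
      ultimately show ?thesis using p(2) by auto
    qed (use p in auto)
  qed
  then have "card {p::nat. prime p \<and> p \<le> d} \<le> card ((if d \<ge> 2 then {2} else {}) \<union> (\<lambda>i. 2 * i + 1) ` {1..(d - 1) div 2})"
    by (rule card_mono[rotated]) auto
  also have "\<dots> \<le> (if d \<ge> 2 then 1 else 0) + card ((\<lambda>i. 2 * i + (1::nat)) ` {1..(d - 1) div 2})"
    by (rule order_trans[OF card_Un_le]) auto
  also have "\<dots> \<le> (if d \<ge> 2 then 1 else 0) + (d - 1) div 2"
    using card_image_le[of "{1..(d - 1) div 2}" "\<lambda>i. 2 * i + (1::nat)"] by simp
  finally have "card {p::nat. prime p \<and> p \<le> d} \<le> (if d \<ge> 2 then 1 else 0) + (d - 1) div 2" .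
  then show ?thesis by (cases "d \<ge> 2") presburger+
qed

lemma smooth_bound_le:
  assumes "V > 0"
  shows "smooth_bound d V \<le> V ^ card {p::nat. prime p \<and> p \<le> d}"
proof -
  have "p ^ Max {k. p ^ k \<le> V} \<le> V" if "prime p" for p
  proof -
    have "0 \<in> {k. p ^ k \<le> V}" using assms by simp
    then have "Max {k. p ^ k \<le> V} \<in> {k. p ^ k \<le> V}"
      using Max_in[OF finite_exponents[OF that]] by blast
    then show ?thesis by simp
  qed
  then show ?thesis unfolding smooth_bound_def
    using prod_le_power[of "{p. prime p \<and> p \<le> d}" "\<lambda>p. p ^ Max {k. p ^ k \<le> V}" V]  assms by auto
qed

lemma dvd_mult_smooth_bound:
  assumes "0 < a" "a \<le> V" "0 < b"
    and eq: "\<And>p. prime p \<Longrightarrow> p > d \<Longrightarrow> multiplicity p a = multiplicity p b"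
  shows "a dvd b * smooth_bound d V"
proof (rule multiplicity_le_imp_dvd)
  fix p :: nat assume p: "prime p"
  have s: "smooth_bound d V \<noteq> 0" using smooth_bound_pos[of d V] by simp
  have m: "multiplicity p (b * smooth_bound d V) = multiplicity p b + multiplicity p (smooth_bound d V)"
    using assms(3) s p by (intro prime_elem_multiplicity_mult_distrib) auto
  show "multiplicity p a \<le> multiplicity p (b * smooth_bound d V)"
  proof (cases "p > d")
    case True
    then show ?thesis using eq[OF p True] m by simp
  next
    case False
    have "p ^ multiplicity p a dvd a" by (rule multiplicity_dvd)
    then have "p ^ multiplicity p a \<le> V" using assms(1,2) dvd_imp_le le_trans by blast
    then have le: "multiplicity p a \<le> Max {k. p ^ k \<le> V}"
      using Max_ge[OF finite_exponents[OF p]] by simp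
    have "p ^ Max {k. p ^ k \<le> V} dvd smooth_bound d V"
      unfolding smooth_bound_def using p False by (intro dvd_prodI) auto
    then have "Max {k. p ^ k \<le> V} \<le> multiplicity p (smooth_bound d V)"
      using s p by (intro multiplicity_geI) (auto simp: prime_nat_iff)
    then show ?thesis using le m by simp
  qed
qed (use assms in simp)

text \<open>
A prime beyond \<open>d\<close> divides neither \<open>q\<close> nor \<open>q'\<close>.
\<close>

lemma large_prime_multiplicity_eq:
  fixes a b q q' :: nat
  assumes "prime p" "p > d" "a * q = b * q'" "0 < a" "0 < b" "0 < q" "q \<le> d" "0 < q'" "q' \<le> d"
  shows "multiplicity p a = multiplicity p b"
proof -
  have *: "multiplicity p x = 0" if "0 < x" "x \<le> d" for x
    using that assms(2) by (intro not_dvd_imp_multiplicity_0) (auto dest: dvd_imp_le)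
  have "multiplicity p (a * q) = multiplicity p a + multiplicity p q"
    "multiplicity p (b * q') = multiplicity p b + multiplicity p q'"
    using assms(1,4-6,8) prime_elem_multiplicity_mult_distrib[of p] by simp_all
  then show ?thesis using *[of q] *[of q'] assms(3,6-9) by simp
qed

text \<open>
One term of the exponential series is at most the whole sum.
\<close>

lemma power_le_fact_exp:
  assumes "0 \<le> (x::real)"
  shows "x ^ d \<le> fact d * exp x"
proof -
  have "x ^ d / fact d \<le> exp x"
    using sum_le_suminf[OF summable_exp_generic[of x], of "{d}"] assms
    by (simp add: exp_def scaleR_conv_of_real divide_inverse mult.commute)
  then show ?thesis by (simp add: field_simps)
qed

lemma ln2_ge: "ln (2::real) \<ge> 4 / 9"
proof -
  have "exp (4/9 :: real) ^ 9 = exp 1 ^ 4" by (simp add: exp_of_nat_mult[symmetric])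
  also have "\<dots> \<le> (3::real) ^ 4" using exp_le by (intro power_mono) auto
  also have "\<dots> \<le> 2 ^ 9" by simp
  finally have "exp (4/9 :: real) ^ Suc 8 \<le> 2 ^ Suc 8" by simp
  then have "exp (4/9 :: real) \<le> 2" by (rule power_le_imp_le_base) simp
  then show ?thesis by (subst ln_ge_iff) auto
qed

text \<open>
With \<open>x = sqrt V\<close>, the count of primes gives \<open>smooth_bound d V \<le> x ^ (d + 1) \<le> x * d! * exp x\<close>,
and \<open>x * exp x\<close> is absorbed by the exponential factor since \<open>V \<ge> 2\<close>. The constant \<open>4 / 9\<close> in
the bound for \<open>ln 2\<close> is the one for which \<open>y = sqrt (ln V)\<close> is at least \<open>2 / 3\<close>.
\<close>

lemma vertex_bound:
  fixes V V1 V2 d L :: nat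
  assumes V: "V1 + V2 = V" "1 \<le> V1" "1 \<le> V2" and L: "1 \<le> L" and a: "a \<le> V1"
  shows "real ((a * smooth_bound d V * fact d * L ^ d) * V2)
     \<le> (fact d)\<^sup>2 * real L ^ (2 * d) * (real V)\<^sup>2 * exp (2 * sqrt (real V * ln (real V)))"
proof -
  define x where "x = sqrt (real V)"
  have V2: "2 \<le> V" using V by simp
  have x1: "x \<ge> 1" using V2 by (simp add: x_def)
  have xx: "x * x = real V" by (simp add: x_def)
  let ?P = "card {p::nat. prime p \<and> p \<le> d}"
  have "real (smooth_bound d V) \<le> real V ^ ?P"
    using smooth_bound_le[of V d] V2 by (metis of_nat_le_iff of_nat_power pos2 less_le_trans)
  also have "\<dots> = x ^ (2 * ?P)" using xx by (simp add: power_mult power2_eq_square)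
  also have "\<dots> \<le> x ^ (d + 1)" using card_primes_le x1 by (intro power_increasing) auto
  also have "\<dots> = x * x ^ d" by simp
  also have "\<dots> \<le> x * (fact d * exp x)" using x1 power_le_fact_exp[of x d] by (intro mult_left_mono) auto
  finally have D: "real (smooth_bound d V) \<le> fact d * (x * exp x)" by (simp add: mult_ac)
  have "x * exp x \<le> exp (2 * sqrt (real V * ln (real V)))"
  proof -
    define y where "y = sqrt (ln (real V))"
    have lnV: "ln (real V) \<ge> 4 / 9" by (rule order_trans[OF ln2_ge]) (use V2 in simp)
    have "(2/3 :: real) = sqrt (4/9)" by (simp add: real_sqrt_divide)
    also have "\<dots> \<le> y" unfolding y_def using lnV by (rule real_sqrt_le_mono)
    finally have y: "2/3 \<le> y" .
    have yy: "y * y = ln (real V)" using lnV by (simp add: y_def)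
    have "ln (real V) \<le> real V" using ln_le_minus_one[of "real V"] V2 by simp
    then have yx: "y \<le> x" by (simp add: y_def x_def)
    have "ln x = y * y / 2" unfolding yy x_def using V2 by (simp add: ln_sqrt)
    then have "x * exp x = exp (y * y / 2 + x)" using x1 by (simp add: exp_add flip: \<open>ln x = y * y / 2\<close>)
    also have "y * y / 2 + x \<le> 2 * (x * y)"
    proof -
      have "y * y \<le> x * y" using yx y by (intro mult_right_mono) auto
      moreover have "x * (2/3) \<le> x * y" using y x1 by (intro mult_left_mono) auto
      ultimately show ?thesis by linarith
    qed
    also have "x * y = sqrt (real V * ln (real V))" by (simp add: x_def y_def real_sqrt_mult)
    finally show ?thesis by simp
  qed
  then have D': "real (smooth_bound d V) \<le> fact d * exp (2 * sqrt (real V * ln (real V)))"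
    using D order_trans[OF D mult_left_mono[of "x * exp x" _ "fact d"]] by simp
  let ?E = "exp (2 * sqrt (real V * ln (real V)))"
  have "real ((a * smooth_bound d V * fact d * L ^ d) * V2)
      = (real a * real V2) * (fact d * real L ^ d) * real (smooth_bound d V)" by (simp add: mult_ac)
  also have "\<dots> \<le> (real V * real V) * (fact d * real L ^ (2 * d)) * (fact d * ?E)"
    using a V L D' by (intro mult_mono power_increasing) auto
  finally show ?thesis by (simp add: power2_eq_square mult_ac)
qed

section \<open>Edge types and germs\<close>

locale covering_pair = category_triple C M1 M2
  for C :: "('o, 'm) cat" (structure) and M1 M2 :: "'m set" +
  fixes T :: "('v, 'e, 'o, 'm) goo"
    and X1 :: "('v1, 'e1, 'o, 'm) goo"
    and X2 :: "('v2, 'e2, 'o, 'm) goo"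
    and f1 :: "('v, 'e, 'v1, 'e1, 'm) goo_map"
    and f2 :: "('v, 'e, 'v2, 'e2, 'm) goo_map"
    and H :: "('v, 'e, 'v, 'e, 'm) goo_map set"
  assumes T: "graph_of_objects C M2 T" and X1: "graph_of_objects C M2 X1" and X2: "graph_of_objects C M2 X2"
    and f1: "goo_covering C M1 T X1 f1" and f2: "goo_covering C M1 T X2 f2"
    and fin1: "finite_graph (ugraph X1)" and fin2: "finite_graph (ugraph X2)"
    and tree: "is_tree (ugraph T)"
    and deck1: "deck_transformations C M1 T f1 \<subseteq> H" and deck2: "deck_transformations C M1 T f2 \<subseteq> H"
    and H: "subgroup H (goo_Aut C M1 T)"
    and fin_iso: "finite_edge_isotropy T H"
begin

text \<open>
Short names: \<open>hv h\<close> and \<open>he h\<close> for the action of \<open>h\<close> on the vertices and edges of the tree, and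
\<open>q\<close> and \<open>p\<close> for the coverings on vertices and edges.
\<close>

abbreviation "GT \<equiv> ugraph T"
abbreviation "G1 \<equiv> ugraph X1"
abbreviation "G2 \<equiv> ugraph X2"
abbreviation hv where "hv h \<equiv> vmap (umap h)"
abbreviation he where "he h \<equiv> emap (umap h)"
abbreviation p1 where "p1 \<equiv> emap (umap f1)"
abbreviation p2 where "p2 \<equiv> emap (umap f2)"
abbreviation q1 where "q1 \<equiv> vmap (umap f1)"
abbreviation q2 where "q2 \<equiv> vmap (umap f2)"
abbreviation gcomp (infixl "\<odot>" 70) where "g \<odot> h \<equiv> goo_comp C T g h"

lemma grT: "is_graph GT" and gr1: "is_graph G1" and gr2: "is_graph G2"
  using gooD(1)[OF T] gooD(1)[OF X1] gooD(1)[OF X2] by auto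

lemmas edgeT = is_graphD[OF grT]
lemmas edge2 = is_graphD[OF gr2]

lemma f1h: "goo_hom C M1 T X1 f1" and f1l: "local_iso GT G1 (umap f1)"
  and f2h: "goo_hom C M1 T X2 f2" and f2l: "local_iso GT G2 (umap f2)"
  using f1 f2 by (auto simp: goo_covering_def local_iso_of_covering)

lemmas f1D = goo_homD[OF f1h] and f2D = goo_homD[OF f2h]
lemmas f1G = graph_homD[OF f1D(1)] and f2G = graph_homD[OF f2D(1)]

lemma f1_surj: "q1 ` gverts GT = gverts G1" "p1 ` gedges GT = gedges G1"
  and f2_surj: "q2 ` gverts GT = gverts G2" "p2 ` gedges GT = gedges G2"
  using f1 f2 by (auto simp: goo_covering_def graph_covering_def)

lemma p1_star: "v \<in> gverts GT \<Longrightarrow> bij_betw p1 (star GT v) (star G1 (q1 v))"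
  and p2_star: "v \<in> gverts GT \<Longrightarrow> bij_betw p2 (star GT v) (star G2 (q2 v))"
  using f1l f2l by (auto simp: local_iso_def)

lemma p1_inj: "\<lbrakk>a \<in> gedges GT; b \<in> gedges GT; src GT a = src GT b; p1 a = p1 b\<rbrakk> \<Longrightarrow> a = b"
  using p1_star[OF edgeT(1)[of a]] by (auto simp: bij_betw_def inj_on_def)

lemma p2_inj: "\<lbrakk>a \<in> gedges GT; b \<in> gedges GT; src GT a = src GT b; p2 a = p2 b\<rbrakk> \<Longrightarrow> a = b"
  using p2_star[OF edgeT(1)[of a]] by (auto simp: bij_betw_def inj_on_def)

sublocale A: group "goo_Aut C M1 T" by (rule group_goo_Aut[OF T])

lemma Aut_simps [simp]: "monoid.mult (goo_Aut C M1 T) = goo_comp C T" "one (goo_Aut C M1 T) = goo_id C T"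
  by (simp_all add: goo_Aut_def)

lemma H_carrier: "h \<in> H \<Longrightarrow> h \<in> carrier (goo_Aut C M1 T)"
  using subgroup.subset[OF H] by blast

lemma H_hom: "h \<in> H \<Longrightarrow> goo_hom C M1 T T h" and H_aut: "h \<in> H \<Longrightarrow> graph_aut GT (umap h)"
  using H_carrier by (auto simp: goo_Aut_def)

lemma H_comp: "g \<in> H \<Longrightarrow> h \<in> H \<Longrightarrow> g \<odot> h \<in> H"
  using subgroup.m_closed[OF H, of g h] by simp

lemma H_id: "goo_id C T \<in> H"
  using subgroup.one_closed[OF H] by simp

lemma H_assoc: "f \<in> H \<Longrightarrow> g \<in> H \<Longrightarrow> h \<in> H \<Longrightarrow> (f \<odot> g) \<odot> h = f \<odot> (g \<odot> h)"
  using A.m_assoc[of f g h] H_carrier by simp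

definition hinv where "hinv h = inv\<^bsub>goo_Aut C M1 T\<^esub> h"

lemma hinv: assumes "h \<in> H" shows "hinv h \<in> H" "hinv h \<odot> h = goo_id C T" "h \<odot> hinv h = goo_id C T"
  using subgroup.m_inv_closed[OF H assms] A.l_inv[OF H_carrier[OF assms]] A.r_inv[OF H_carrier[OF assms]]
  by (simp_all add: hinv_def)

lemma H_id_comp: "h \<in> H \<Longrightarrow> goo_id C T \<odot> h = h" "h \<in> H \<Longrightarrow> h \<odot> goo_id C T = h"
  using A.l_one[OF H_carrier] A.r_one[OF H_carrier] by simp_all

lemma H_cancel: assumes "h \<in> H" "k \<in> H"
  shows "(h \<odot> hinv k) \<odot> k = h" "(h \<odot> k) \<odot> hinv k = h" "k \<odot> (hinv k \<odot> h) = h" "hinv k \<odot> (k \<odot> h) = h"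
  using assms hinv[OF assms(2)] H_assoc[of h "hinv k" k] H_assoc[of h k "hinv k"]
    H_assoc[of k "hinv k" h] H_assoc[of "hinv k" k h] H_id_comp by simp_all

lemmas HD = goo_homD[OF H_hom]
lemmas HG = graph_homD[OF HD(1)]

lemma hv_comp: "v \<in> gverts GT \<Longrightarrow> hv (g \<odot> h) v = hv g (hv h v)" by simp
lemma he_comp: "e \<in> gedges GT \<Longrightarrow> he (g \<odot> h) e = he g (he h e)" by simp
lemma emor_comp: "e \<in> gedges GT \<Longrightarrow> emor (g \<odot> h) e = emor g (he h e) \<cdot> emor h e" by simp

lemma id_apply: "v \<in> gverts GT \<Longrightarrow> hv (goo_id C T) v = v" "e \<in> gedges GT \<Longrightarrow> he (goo_id C T) e = e"
  "e \<in> gedges GT \<Longrightarrow> emor (goo_id C T) e = Ident C (eobj T e)"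
  by (simp_all add: goo_id_def)

lemma hinv_apply: assumes "h \<in> H"
  shows "v \<in> gverts GT \<Longrightarrow> hv (hinv h) (hv h v) = v" "v \<in> gverts GT \<Longrightarrow> hv h (hv (hinv h) v) = v"
    "e \<in> gedges GT \<Longrightarrow> he (hinv h) (he h e) = e" "e \<in> gedges GT \<Longrightarrow> he h (he (hinv h) e) = e"
  using hv_comp[of v "hinv h" h] hv_comp[of v h "hinv h"] he_comp[of e "hinv h" h] he_comp[of e h "hinv h"]
    hinv(2,3)[OF assms] id_apply by simp_all

lemma he_star: assumes "h \<in> H" "v \<in> gverts GT" shows "bij_betw (he h) (star GT v) (star GT (hv h v))"
proof (rule bij_betwI[where g = "he (hinv h)"])
  note hi = hinv(1)[OF assms(1)]
  show "he h \<in> star GT v \<rightarrow> star GT (hv h v)" using HG[OF assms(1)] by auto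
  show "he (hinv h) \<in> star GT (hv h v) \<rightarrow> star GT v"
    using HG[OF hi] hinv_apply(1)[OF assms] by auto
qed (use hinv_apply[OF assms(1)] in auto)

lemma deck1D:
  assumes "g \<in> deck_transformations C M1 T f1"
  shows "g \<in> H" "v \<in> gverts GT \<Longrightarrow> q1 (hv g v) = q1 v" "e \<in> gedges GT \<Longrightarrow> p1 (he g e) = p1 e"
    "v \<in> gverts GT \<Longrightarrow> vmor f1 (hv g v) \<cdot> vmor g v = vmor f1 v"
    "e \<in> gedges GT \<Longrightarrow> emor f1 (he g e) \<cdot> emor g e = emor f1 e"
  by (rule subsetD[OF deck1 assms])
    (rule deck_transformation_apply[OF T X1 f1h assms], assumption)+

lemma deck2D:
  assumes "g \<in> deck_transformations C M1 T f2"
  shows "g \<in> H" "v \<in> gverts GT \<Longrightarrow> q2 (hv g v) = q2 v" "e \<in> gedges GT \<Longrightarrow> p2 (he g e) = p2 e"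
    "v \<in> gverts GT \<Longrightarrow> vmor f2 (hv g v) \<cdot> vmor g v = vmor f2 v"
    "e \<in> gedges GT \<Longrightarrow> emor f2 (he g e) \<cdot> emor g e = emor f2 e"
  by (rule subsetD[OF deck2 assms])
    (rule deck_transformation_apply[OF T X2 f2h assms], assumption)+

lemmas deck1_v = deck_transitive[OF T X1 f1 tree] and deck1_e = deck_transitive_edge[OF T X1 f1 tree]
lemmas deck2_v = deck_transitive[OF T X2 f2 tree] and deck2_e = deck_transitive_edge[OF T X2 f2 tree]

text \<open>
The edge component of the composite of \<open>h\<close> with \<open>f2\<close>.
\<close>

definition over_mor where "over_mor h e = emor f2 (he h e) \<cdot> emor h e"

lemma over_mor: assumes "h \<in> H" "e \<in> gedges GT" shows "over_mor h e \<in> iso (eobj T e) (eobj X2 (p2 (he h e)))"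
  unfolding over_mor_def using iso_comp[OF HD(3)[OF assms] f2D(3)[OF HG(2)[OF assms]]] .

lemma over_mor_comp:
  assumes "h \<in> H" "k \<in> H" "e \<in> gedges GT"
  shows "over_mor (h \<odot> k) e = over_mor h (he k e) \<cdot> emor k e"
  unfolding over_mor_def he_comp[OF assms(3)] emor_comp[OF assms(3)]
  using arrow_assoc[OF iso_Mor[OF HD(3)[OF assms(2,3)]] iso_Mor[OF HD(3)[OF assms(1) HG(2)[OF assms(2,3)]]]
    iso_Mor[OF f2D(3)[OF HG(2)[OF assms(1) HG(2)[OF assms(2,3)]]]]] by simp

text \<open>
The comparison of \<open>f1\<close> with the composite of \<open>h\<close> and \<open>f2\<close> along the edge \<open>e\<close>.
\<close>

definition edge_type where "edge_type h e = (p1 e, p2 (he h e), over_mor h e \<cdot> minv (emor f1 e))"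

lemma edge_type_eq_iff:
  assumes "h \<in> H" "h' \<in> H" "e \<in> gedges GT"
  shows "edge_type h e = edge_type h' e \<longleftrightarrow> p2 (he h e) = p2 (he h' e) \<and> over_mor h e = over_mor h' e"
proof
  assume a: "edge_type h e = edge_type h' e"
  then have p: "p2 (he h e) = p2 (he h' e)" and q: "over_mor h e \<cdot> minv (emor f1 e) = over_mor h' e \<cdot> minv (emor f1 e)"
    by (auto simp: edge_type_def)
  have "over_mor h e = over_mor h' e"
    using iso_cancel_right[OF minv(1)[OF f1D(3)[OF assms(3)]] iso_Mor[OF over_mor[OF assms(1,3)]] _ q]
      iso_Mor[OF over_mor[OF assms(2,3)]] p by simp
  then show "p2 (he h e) = p2 (he h' e) \<and> over_mor h e = over_mor h' e" using p by simp
qed (simp add: edge_type_def)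

lemma edge_type_precomp:
  assumes "h \<in> H" "h' \<in> H" "k \<in> H" "e \<in> gedges GT" "edge_type h (he k e) = edge_type h' (he k e)"
  shows "edge_type (h \<odot> k) e = edge_type (h' \<odot> k) e"
proof -
  have ke: "he k e \<in> gedges GT" using HG(2)[OF assms(3,4)] .
  have "p2 (he h (he k e)) = p2 (he h' (he k e))" "over_mor h (he k e) = over_mor h' (he k e)"
    using edge_type_eq_iff[OF assms(1,2) ke] assms(5) by auto
  then show ?thesis
    using edge_type_eq_iff[OF H_comp[OF assms(1,3)] H_comp[OF assms(2,3)] assms(4)]
      over_mor_comp[OF assms(1,3,4)] over_mor_comp[OF assms(2,3,4)] assms(4) by simp
qed

text \<open>
Precomposition with a deck transformation of \<open>f1\<close> only moves the edge at which the type is taken, so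
the types and germs over an edge or vertex of \<open>X1\<close> can be computed at any lift of it.
\<close>

lemma edge_type_deck1:
  assumes "h \<in> H" "d \<in> deck_transformations C M1 T f1" "e \<in> gedges GT"
  shows "edge_type (h \<odot> d) e = edge_type h (he d e)"
proof -
  note d = deck1D[OF assms(2)]
  have de: "he d e \<in> gedges GT" using HG(2)[OF d(1) assms(3)] .
  note m = f1D(3)[OF assms(3)] and md = f1D(3)[OF de] and dm = HD(3)[OF d(1) assms(3)]
  have pe: "p1 (he d e) = p1 e" using d(3)[OF assms(3)] .
  have "emor d e \<cdot> minv (emor f1 e) = minv (emor f1 (he d e)) \<cdot> (emor f1 (he d e) \<cdot> (emor d e \<cdot> minv (emor f1 e)))"
    using minv_comp_cancel[OF md arrow_comp[OF iso_Mor[OF minv(1)[OF m]] iso_Mor[OF dm]]] by simp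
  also have "emor f1 (he d e) \<cdot> (emor d e \<cdot> minv (emor f1 e)) = emor f1 e \<cdot> minv (emor f1 e)"
    using arrow_assoc[OF iso_Mor[OF minv(1)[OF m]] iso_Mor[OF dm] iso_Mor[OF md]] d(5)[OF assms(3)] by simp
  also have "\<dots> = Ident C (eobj X1 (p1 (he d e)))" using minv(3)[OF m] pe by simp
  also have "minv (emor f1 (he d e)) \<cdot> \<dots> = minv (emor f1 (he d e))"
    using arrow_id(1)[OF iso_Mor[OF minv(1)[OF md]]] .
  finally have eq: "emor d e \<cdot> minv (emor f1 e) = minv (emor f1 (he d e))" .
  have "over_mor (h \<odot> d) e \<cdot> minv (emor f1 e) = over_mor h (he d e) \<cdot> (emor d e \<cdot> minv (emor f1 e))"
    unfolding over_mor_comp[OF assms(1) d(1) assms(3)]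
    using arrow_assoc[OF iso_Mor[OF minv(1)[OF m]] iso_Mor[OF dm] iso_Mor[OF over_mor[OF assms(1) de]]] .
  then show ?thesis using eq pe assms(3) by (simp add: edge_type_def)
qed

text \<open>
The type depends on \<open>h\<close> only through the composite with \<open>f2\<close>.
\<close>

lemma edge_type_deck2:
  assumes "h \<in> H" "d \<in> deck_transformations C M1 T f2" "e \<in> gedges GT"
  shows "edge_type (d \<odot> h) e = edge_type h e"
proof -
  note d = deck2D[OF assms(2)]
  have he: "he h e \<in> gedges GT" using HG(2)[OF assms(1,3)] .
  have "over_mor (d \<odot> h) e = over_mor d (he h e) \<cdot> emor h e" using over_mor_comp[OF d(1) assms(1,3)] .
  also have "over_mor d (he h e) = emor f2 (he h e)" unfolding over_mor_def using d(5)[OF he] .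
  finally have "over_mor (d \<odot> h) e = over_mor h e" by (simp add: over_mor_def)
  then show ?thesis using d(3)[OF he] assms(3) by (simp add: edge_type_def)
qed

definition germ where "germ h v = (q1 v, q2 (hv h v), edge_type h ` star GT v)"

text \<open>
No two edges of a star lie over the same edge of \<open>X1\<close>, so the set of types remembers which type
belongs to which edge.
\<close>

lemma germ_eq_iff:
  assumes "h \<in> H" "h' \<in> H" "v \<in> gverts GT"
  shows "germ h v = germ h' v \<longleftrightarrow> q2 (hv h v) = q2 (hv h' v) \<and> (\<forall>e \<in> star GT v. edge_type h e = edge_type h' e)"
proof
  assume g: "germ h v = germ h' v"
  have "edge_type h e = edge_type h' e" if e: "e \<in> star GT v" for e
  proof -
    have "edge_type h e \<in> edge_type h' ` star GT v" using g e by (auto simp: germ_def)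
    then obtain e' where e': "e' \<in> star GT v" "edge_type h e = edge_type h' e'" by blast
    then have "p1 e = p1 e'" by (simp add: edge_type_def)
    then have "e = e'" using p1_inj[of e e'] e e' by simp
    then show ?thesis using e' by simp
  qed
  then show "q2 (hv h v) = q2 (hv h' v) \<and> (\<forall>e \<in> star GT v. edge_type h e = edge_type h' e)" using g by (simp add: germ_def)
next
  assume "q2 (hv h v) = q2 (hv h' v) \<and> (\<forall>e \<in> star GT v. edge_type h e = edge_type h' e)"
  then show "germ h v = germ h' v" by (auto simp: germ_def intro!: image_cong)
qed

lemma germ_precomp:
  assumes "h \<in> H" "h' \<in> H" "k \<in> H" "u \<in> gverts GT" "germ h (hv k u) = germ h' (hv k u)"
  shows "germ (h \<odot> k) u = germ (h' \<odot> k) u"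
proof -
  have "hv k u \<in> gverts GT" using HG(1)[OF assms(3,4)] .
  then have g: "q2 (hv h (hv k u)) = q2 (hv h' (hv k u))" "\<forall>e \<in> star GT (hv k u). edge_type h e = edge_type h' e"
    using germ_eq_iff[OF assms(1,2)] assms(5) by auto
  have "edge_type (h \<odot> k) e = edge_type (h' \<odot> k) e" if e: "e \<in> star GT u" for e
  proof (rule edge_type_precomp[OF assms(1-3)])
    have "he k e \<in> star GT (hv k u)" using HG[OF assms(3)] e by auto
    then show "edge_type h (he k e) = edge_type h' (he k e)" using g(2) by blast
  qed (use e in simp)
  then show ?thesis using g(1) assms(4) germ_eq_iff[OF H_comp[OF assms(1,3)] H_comp[OF assms(2,3)] assms(4)] by simp
qed

lemma germ_precomp_iff:
  assumes "h \<in> H" "h' \<in> H" "k \<in> H" "u \<in> gverts GT"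
  shows "germ (h \<odot> k) u = germ (h' \<odot> k) u \<longleftrightarrow> germ h (hv k u) = germ h' (hv k u)"
proof
  assume a: "germ (h \<odot> k) u = germ (h' \<odot> k) u"
  let ?v = "hv k u"
  have v: "?v \<in> gverts GT" "hv (hinv k) ?v = u" using HG(1)[OF assms(3,4)] hinv_apply(1)[OF assms(3,4)] by auto
  have "germ ((h \<odot> k) \<odot> hinv k) ?v = germ ((h' \<odot> k) \<odot> hinv k) ?v"
    by (rule germ_precomp[OF H_comp[OF assms(1,3)] H_comp[OF assms(2,3)] hinv(1)[OF assms(3)] v(1)]) (use v a in simp)
  then show "germ h ?v = germ h' ?v" using H_cancel(2) assms by simp
qed (rule germ_precomp[OF assms])

lemma germ_deck1:
  assumes "h \<in> H" "d \<in> deck_transformations C M1 T f1" "v \<in> gverts GT"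
  shows "germ (h \<odot> d) v = germ h (hv d v)"
proof -
  note d = deck1D[OF assms(2)]
  have "edge_type (h \<odot> d) ` star GT v = edge_type h ` he d ` star GT v"
    unfolding image_image by (intro image_cong refl edge_type_deck1[OF assms(1,2)]) simp
  also have "he d ` star GT v = star GT (hv d v)" using he_star[OF d(1) assms(3)] by (simp add: bij_betw_def)
  finally show ?thesis using d(2) assms(3) by (simp add: germ_def)
qed

lemma germ_deck2:
  assumes "h \<in> H" "d \<in> deck_transformations C M1 T f2" "v \<in> gverts GT"
  shows "germ (d \<odot> h) v = germ h v"
proof -
  note d = deck2D[OF assms(2)]
  have "edge_type (d \<odot> h) ` star GT v = edge_type h ` star GT v"
    by (intro image_cong refl edge_type_deck2[OF assms(1,2)]) simp
  then show ?thesis using d(2)[OF HG(1)[OF assms(1,3)]] assms(3) by (simp add: germ_def)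
qed

end

section \<open>The number of germs at a vertex\<close>

context covering_pair
begin

text \<open>
The target \<open>w\<close> is singled out because the number of copies of a germ in the glued graph will
depend on its target only.
\<close>

definition germs_at where "germs_at v w = (\<lambda>h. germ h v) ` {h \<in> H. q2 (hv h v) = w}"

definition germs_into where "germs_into w = (\<Union>v \<in> gverts GT. germs_at v w)"

lemma germs_at_deck1:
  assumes "v \<in> gverts GT" "v' \<in> gverts GT" "q1 v = q1 v'"
  shows "germs_at v w \<subseteq> germs_at v' w"
proof
  fix s assume "s \<in> germs_at v w"
  then obtain h where h: "h \<in> H" "q2 (hv h v) = w" "s = germ h v" by (auto simp: germs_at_def)
  obtain d where d: "d \<in> deck_transformations C M1 T f1" "hv d v' = v"
    using deck1_v[OF assms(2,1)] assms(3) by auto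
  have "germ (h \<odot> d) v' = s" using germ_deck1[OF h(1) d(1) assms(2)] d(2) h(3) by simp
  moreover have "h \<odot> d \<in> H" using H_comp[OF h(1) deck1D(1)[OF d(1)]] .
  moreover have "q2 (hv (h \<odot> d) v') = w" using h(2) d(2) assms(2) by simp
  ultimately show "s \<in> germs_at v' w" unfolding germs_at_def by blast
qed

lemma card_germs_at_translate:
  assumes "k \<in> H" "u \<in> gverts GT"
  shows "card (germs_at u w) = card (germs_at (hv k u) w)"
proof -
  let ?A = "{h \<in> H. q2 (hv h (hv k u)) = w}"
  have "germs_at u w = (\<lambda>h. germ (h \<odot> k) u) ` ?A"
  proof (intro equalityI subsetI)
    fix s assume "s \<in> germs_at u w"
    then obtain h where h: "h \<in> H" "q2 (hv h u) = w" "s = germ h u" by (auto simp: germs_at_def)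
    let ?h = "h \<odot> hinv k"
    have 1: "?h \<odot> k = h" using H_cancel(1)[OF h(1) assms(1)] .
    have "hv (?h \<odot> k) u = hv ?h (hv k u)" by (rule hv_comp[OF assms(2)])
    then have "?h \<in> ?A" using 1 h H_comp[OF h(1) hinv(1)[OF assms(1)]] by auto
    then show "s \<in> (\<lambda>h. germ (h \<odot> k) u) ` ?A" using 1 h(3) by (intro image_eqI[of _ _ ?h]) simp_all
  next
    fix s assume "s \<in> (\<lambda>h. germ (h \<odot> k) u) ` ?A"
    then show "s \<in> germs_at u w" unfolding germs_at_def using H_comp[OF _ assms(1)] assms(2) by auto
  qed
  also have "card \<dots> = card ((\<lambda>h. germ h (hv k u)) ` ?A)"
    by (rule card_image_eq_card_image(1)) (use germ_precomp_iff assms in auto)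
  finally show ?thesis by (simp add: germs_at_def)
qed

text \<open>Divisibility.\<close>

text \<open>
A representative of the \<open>H\<close>-orbit of \<open>e\<close>, the same for the whole orbit.
\<close>

definition rep where "rep e = (SOME e'. \<exists>h \<in> H. he h e = e')"

lemma rep: "\<exists>h \<in> H. he h e = rep e"
  unfolding rep_def by (rule someI_ex) (use H_id in blast)

lemma rep_invariant:
  assumes "k \<in> H" "e \<in> gedges GT"
  shows "rep (he k e) = rep e"
proof -
  have "(\<exists>h \<in> H. he h (he k e) = e') \<longleftrightarrow> (\<exists>h \<in> H. he h e = e')" for e'
  proof
    assume "\<exists>h \<in> H. he h (he k e) = e'"
    then obtain h where h: "h \<in> H" "he h (he k e) = e'" by blast
    then have "he (h \<odot> k) e = e'" using assms(2) by simp
    then show "\<exists>h \<in> H. he h e = e'" using H_comp[OF h(1) assms(1)] by blast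
  next
    assume "\<exists>h \<in> H. he h e = e'"
    then obtain h where h: "h \<in> H" "he h e = e'" by blast
    have "he (h \<odot> hinv k) (he k e) = e'"
      using h(2) hinv_apply(3)[OF assms] HG(2)[OF assms] by simp
    then show "\<exists>h \<in> H. he h (he k e) = e'" using H_comp[OF h(1) hinv(1)[OF assms(1)]] by blast
  qed
  then show ?thesis unfolding rep_def by simp
qed

text \<open>
A torsor under the isotropy group of \<open>e\<close>. Since the target depends only on the orbit,
precomposition with \<open>h\<close> carries the torsor at \<open>h e\<close> to the torsor at \<open>e\<close>.
\<close>

definition rep_isos where "rep_isos e = {emor h e | h. h \<in> H \<and> he h e = rep e}"

lemma card_rep_isos:
  assumes e: "e \<in> gedges GT"
  shows "finite (rep_isos e)" "card (rep_isos e) = card (isotropy H e)"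
proof -
  obtain k where k: "k \<in> H" "he k e = rep e" using rep by blast
  note mk = HD(3)[OF k(1) e]
  have rep_isos: "rep_isos e = (\<lambda>a. emor k e \<cdot> a) ` isotropy H e"
  proof (intro equalityI subsetI)
    fix x assume "x \<in> rep_isos e"
    then obtain h where h: "h \<in> H" "he h e = rep e" "x = emor h e" by (auto simp: rep_isos_def)
    let ?h = "hinv k \<odot> h"
    have hh: "?h \<in> H" using H_comp[OF hinv(1)[OF k(1)] h(1)] .
    have ef: "he ?h e = e" using h(2) k(2) hinv_apply(3)[OF k(1) e] e by simp
    have "k \<odot> ?h = h" using H_cancel(3)[OF h(1) k(1)] .
    then have "emor k e \<cdot> emor ?h e = x" using emor_comp[OF e, of k ?h] ef h(3) by simp
    moreover have "emor ?h e \<in> isotropy H e" using hh ef by (auto simp: isotropy_def)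
    ultimately show "x \<in> (\<lambda>a. emor k e \<cdot> a) ` isotropy H e" by blast
  next
    fix x assume "x \<in> (\<lambda>a. emor k e \<cdot> a) ` isotropy H e"
    then obtain h where h: "h \<in> H" "he h e = e" "x = emor k e \<cdot> emor h e" by (auto simp: isotropy_def)
    have "emor (k \<odot> h) e = x" "he (k \<odot> h) e = rep e" using h k e by simp_all
    then show "x \<in> rep_isos e" using H_comp[OF k(1) h(1)] unfolding rep_isos_def by blast
  qed
  have "inj_on (\<lambda>a. emor k e \<cdot> a) (isotropy H e)"
  proof (rule inj_onI)
    fix a b assume ab: "a \<in> isotropy H e" "b \<in> isotropy H e" and eq: "emor k e \<cdot> a = emor k e \<cdot> b"
    have *: "x \<in> arrows C (Mor C) (eobj T e) (eobj T e)" if x: "x \<in> isotropy H e" for x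
    proof -
      obtain h where "h \<in> H" "he h e = e" "x = emor h e" using x by (auto simp: isotropy_def)
      then show ?thesis using iso_Mor[OF HD(3)[of h e]] e by simp
    qed
    show "a = b" by (rule iso_cancel_left[OF mk *[OF ab(1)] *[OF ab(2)] eq])
  qed
  then show "card (rep_isos e) = card (isotropy H e)" unfolding rep_isos by (rule card_image)
  show "finite (rep_isos e)" unfolding rep_isos using fin_iso e by (simp add: finite_edge_isotropy_def)
qed

lemma finite_star: "v \<in> gverts GT \<Longrightarrow> finite (star GT v)"
proof -
  assume v: "v \<in> gverts GT"
  have "finite (star G1 (q1 v))" using fin1 by (auto simp: finite_graph_def intro: finite_subset[of _ "gedges G1"])
  then show ?thesis using bij_betw_finite[OF p1_star[OF v]] by simp
qed

definition stab where "stab v = {h \<in> H. hv h v = v}"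

text \<open>
The stabiliser of \<open>v\<close> acts from the right on the pairs of an arbitrary permutation of the star and a
family of elements of the torsors. The permutations need not come from \<open>H\<close>; enlarging the set in
this way makes its size the product of a factorial and of isotropy orders.
\<close>

definition frames where "frames v = {\<beta>. \<beta> permutes star GT v} \<times> (\<Pi>\<^sub>E e \<in> star GT v. rep_isos e)"

definition frame_act where
  "frame_act v y h = ((\<lambda>e. if e \<in> star GT v then fst y (he h e) else e),
                (\<lambda>e \<in> star GT v. snd y (he h e) \<cdot> emor h e))"

lemma stab_star: "h \<in> stab v \<Longrightarrow> v \<in> gverts GT \<Longrightarrow> bij_betw (he h) (star GT v) (star GT v)"
  using he_star[of h v] by (simp add: stab_def)

lemma rep_isos_arrow: "e \<in> gedges GT \<Longrightarrow> x \<in> rep_isos e \<Longrightarrow> x \<in> iso (eobj T e) (eobj T (rep e))"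
proof -
  assume e: "e \<in> gedges GT" and "x \<in> rep_isos e"
  then obtain h where h: "h \<in> H" "x = emor h e" "he h e = rep e" by (auto simp: rep_isos_def)
  show ?thesis using HD(3)[OF h(1) e] h by simp
qed

lemma rep_isos_comp:
  assumes "h \<in> H" "e \<in> gedges GT" "x \<in> rep_isos (he h e)"
  shows "x \<cdot> emor h e \<in> rep_isos e"
proof -
  obtain k where k: "k \<in> H" "he k (he h e) = rep (he h e)" "x = emor k (he h e)"
    using assms(3) by (auto simp: rep_isos_def)
  have "x \<cdot> emor h e = emor (k \<odot> h) e" using k assms(2) by simp
  moreover have "he (k \<odot> h) e = rep e" using k rep_invariant[OF assms(1,2)] assms(2) by simp
  ultimately show ?thesis
    unfolding rep_isos_def mem_Collect_eq using H_comp[OF k(1) assms(1)] by (intro exI[of _ "k \<odot> h"] conjI)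
qed

lemma frames_snd: "y \<in> frames v \<Longrightarrow> e \<in> star GT v \<Longrightarrow> snd y e \<in> rep_isos e"
  unfolding frames_def mem_Times_iff by (elim conjE) (rule PiE_mem)

lemma frame_act_in:
  assumes v: "v \<in> gverts GT" and y: "y \<in> frames v" and h: "h \<in> stab v"
  shows "frame_act v y h \<in> frames v"
proof -
  have hH: "h \<in> H" using h by (simp add: stab_def)
  note b = stab_star[OF h v]
  have "bij_betw (fst y \<circ> he h) (star GT v) (star GT v)"
    using bij_betw_trans[OF b permutes_imp_bij] y by (auto simp: frames_def)
  then have "bij_betw (\<lambda>e. if e \<in> star GT v then fst y (he h e) else e) (star GT v) (star GT v)"
    by (subst bij_betw_cong[of _ _ "fst y \<circ> he h"]) auto
  then have "(\<lambda>e. if e \<in> star GT v then fst y (he h e) else e) permutes star GT v"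
    by (rule bij_imp_permutes) (simp del: in_out_arcs_conv)
  moreover have "snd y (he h e) \<cdot> emor h e \<in> rep_isos e" if e: "e \<in> star GT v" for e
  proof (rule rep_isos_comp[OF hH])
    have "he h e \<in> star GT v" using bij_betwE[OF b] e by blast
    then show "snd y (he h e) \<in> rep_isos (he h e)" by (rule frames_snd[OF y])
  qed (use e in simp)
  ultimately show ?thesis by (simp add: frames_def frame_act_def)
qed

lemma stab_comp: "v \<in> gverts GT \<Longrightarrow> h \<in> stab v \<Longrightarrow> k \<in> stab v \<Longrightarrow> h \<odot> k \<in> stab v"
  using H_comp by (simp add: stab_def)

lemma stab_inv: "v \<in> gverts GT \<Longrightarrow> h \<in> stab v \<Longrightarrow> hinv h \<in> stab v"
  using hinv(1)[of h] hinv_apply(1)[of h v] by (simp add: stab_def)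

lemma stab_id: "v \<in> gverts GT \<Longrightarrow> goo_id C T \<in> stab v"
  using H_id id_apply(1) by (simp add: stab_def)

lemma frame_act_frame_act:
  assumes v: "v \<in> gverts GT" and y: "y \<in> frames v" and h: "h \<in> stab v" and k: "k \<in> stab v"
  shows "frame_act v (frame_act v y h) k = frame_act v y (h \<odot> k)"
proof -
  have hH: "h \<in> H" and kH: "k \<in> H" using h k by (simp_all add: stab_def)
  have ke: "he k e \<in> star GT v" if "e \<in> star GT v" for e
    using bij_betwE[OF stab_star[OF k v]] that by blast
  have kE: "he k e \<in> gedges GT" if "e \<in> star GT v" for e using ke[OF that] by simp
  have hke: "he h (he k e) \<in> star GT v" if "e \<in> star GT v" for e
    using bij_betwE[OF stab_star[OF h v]] ke[OF that] by blast
  have "snd y (he h (he k e)) \<cdot> (emor h (he k e) \<cdot> emor k e) = (snd y (he h (he k e)) \<cdot> emor h (he k e)) \<cdot> emor k e"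
    if e: "e \<in> star GT v" for e
  proof -
    have "snd y (he h (he k e)) \<in> rep_isos (he h (he k e))" by (rule frames_snd[OF y hke[OF e]])
    then have a: "snd y (he h (he k e)) \<in> iso (eobj T (he h (he k e))) (eobj T (rep (he h (he k e))))"
      by (rule rep_isos_arrow[rotated]) (use hke[OF e] in simp)
    have "e \<in> gedges GT" using e by simp
    then show ?thesis
      using arrow_assoc[OF iso_Mor[OF HD(3)[OF kH]] iso_Mor[OF HD(3)[OF hH kE[OF e]]] iso_Mor[OF a]] by simp
  qed
  note assoc = this
  show ?thesis
    unfolding frame_act_def using ke assoc
    by (intro prod_eqI ext) (simp_all add: out_arcs_in_arcs del: in_out_arcs_conv)
qed

lemma frame_act_id:
  assumes v: "v \<in> gverts GT" and y: "y \<in> frames v"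
  shows "frame_act v y (goo_id C T) = y"
proof -
  have "fst y permutes star GT v" using y by (auto simp: frames_def)
  then have 1: "fst y e = e" if "e \<notin> star GT v" for e using that by (rule permutes_not_in)
  have 2: "snd y e = undefined" if "e \<notin> star GT v" for e
    using y that by (auto simp: frames_def PiE_def extensional_def)
  have "snd y e \<cdot> Ident C (eobj T e) = snd y e" if e: "e \<in> star GT v" for e
  proof -
    have "snd y e \<in> rep_isos e" by (rule frames_snd[OF y e])
    then show ?thesis using arrow_id(1)[OF iso_Mor[OF rep_isos_arrow[of e]]] e by simp
  qed
  then show ?thesis
    unfolding frame_act_def using 1 2 id_apply(2,3)
    by (intro prod_eqI ext) (simp_all add: out_arcs_in_arcs del: in_out_arcs_conv)
qed

lemma frame_act_eq_iff:
  assumes v: "v \<in> gverts GT" and y: "y \<in> frames v" and h: "h \<in> stab v" and k: "k \<in> stab v"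
  shows "frame_act v y h = frame_act v y k \<longleftrightarrow> (\<forall>e \<in> star GT v. he h e = he k e \<and> emor h e = emor k e)"
proof
  have hH: "h \<in> H" and kH: "k \<in> H" using h k by (simp_all add: stab_def)
  assume a: "frame_act v y h = frame_act v y k"
  show "\<forall>e \<in> star GT v. he h e = he k e \<and> emor h e = emor k e"
  proof
    fix e assume e: "e \<in> star GT v"
    have inj: "inj (fst y)" using y permutes_inj by (auto simp: frames_def)
    have "fst y (he h e) = fst y (he k e)"
      using fun_cong[OF arg_cong[OF a, of fst], of e] e by (simp add: frame_act_def)
    then have hk: "he h e = he k e" using inj by (simp add: inj_eq)
    have eq: "snd y (he h e) \<cdot> emor h e = snd y (he h e) \<cdot> emor k e"
      using fun_cong[OF arg_cong[OF a, of snd], of e] e hk by (simp add: frame_act_def)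
    have eE: "e \<in> gedges GT" using e by simp
    have "he h e \<in> star GT v" using bij_betwE[OF stab_star[OF h v]] e by blast
    then have "snd y (he h e) \<in> iso (eobj T (he h e)) (eobj T (rep (he h e)))"
      using rep_isos_arrow[of "he h e"] frames_snd[OF y] by simp
    then have "emor h e = emor k e"
      using iso_cancel_left[OF _ iso_Mor[OF HD(3)[OF hH eE]] _ eq] iso_Mor[OF HD(3)[OF kH eE]] hk by auto
    then show "he h e = he k e \<and> emor h e = emor k e" using hk by simp
  qed
next
  assume "\<forall>e \<in> star GT v. he h e = he k e \<and> emor h e = emor k e"
  then show "frame_act v y h = frame_act v y k"
    unfolding frame_act_def by (intro prod_eqI ext) (simp_all del: in_out_arcs_conv)
qed

lemma germ_postcomp_iff:
  assumes v: "v \<in> gverts GT" and h0: "h0 \<in> H" and h: "h \<in> stab v" and k: "k \<in> stab v"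
  shows "germ (h0 \<odot> h) v = germ (h0 \<odot> k) v \<longleftrightarrow> (\<forall>e \<in> star GT v. he h e = he k e \<and> emor h e = emor k e)"
proof -
  have hH: "h \<in> H" and kH: "k \<in> H" and hvv: "hv h v = v" "hv k v = v" using h k by (simp_all add: stab_def)
  have "edge_type (h0 \<odot> h) e = edge_type (h0 \<odot> k) e \<longleftrightarrow> he h e = he k e \<and> emor h e = emor k e" if e: "e \<in> star GT v" for e
  proof -
    have eE: "e \<in> gedges GT" using e by simp
    have hs: "he h e \<in> star GT v" and ks: "he k e \<in> star GT v"
      using bij_betwE[OF stab_star[OF h v]] bij_betwE[OF stab_star[OF k v]] e by blast+
    have "p2 (he h0 (he h e)) = p2 (he h0 (he k e)) \<longleftrightarrow> he h e = he k e"
    proof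
      assume a: "p2 (he h0 (he h e)) = p2 (he h0 (he k e))"
      have "he h0 (he h e) = he h0 (he k e)"
        using p2_inj[OF _ _ _ a] HG[OF h0] hs ks by simp
      then show "he h e = he k e" using hinv_apply(3)[OF h0] hs ks by (metis in_out_arcs_conv)
    qed simp
    moreover have "over_mor (h0 \<odot> h) e = over_mor (h0 \<odot> k) e \<longleftrightarrow> emor h e = emor k e" if hk: "he h e = he k e"
    proof
      have hE: "he h e \<in> gedges GT" using hs by simp
      assume "over_mor (h0 \<odot> h) e = over_mor (h0 \<odot> k) e"
      then have eq: "over_mor h0 (he h e) \<cdot> emor h e = over_mor h0 (he h e) \<cdot> emor k e"
        using over_mor_comp[OF h0 hH eE] over_mor_comp[OF h0 kH eE] hk by simp
      show "emor h e = emor k e"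
        using iso_cancel_left[OF over_mor[OF h0 hE] iso_Mor[OF HD(3)[OF hH eE]] _ eq] iso_Mor[OF HD(3)[OF kH eE]] hk by simp
    next
      assume "emor h e = emor k e"
      then show "over_mor (h0 \<odot> h) e = over_mor (h0 \<odot> k) e" using over_mor_comp[OF h0 hH eE] over_mor_comp[OF h0 kH eE] hk by simp
    qed
    ultimately show ?thesis
      using edge_type_eq_iff[OF H_comp[OF h0 hH] H_comp[OF h0 kH] eE] eE by auto
  qed
  then show ?thesis
    using germ_eq_iff[OF H_comp[OF h0 hH] H_comp[OF h0 kH] v] hvv v by simp
qed

lemma germs_at_eq_stab:
  assumes v: "v \<in> gverts GT" and h0: "h0 \<in> H" "q2 (hv h0 v) = w"
  shows "germs_at v w = (\<lambda>h. germ (h0 \<odot> h) v) ` stab v"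
proof (intro equalityI subsetI)
  fix s assume "s \<in> germs_at v w"
  then obtain h where h: "h \<in> H" "q2 (hv h v) = w" "s = germ h v" by (auto simp: germs_at_def)
  obtain d where d: "d \<in> deck_transformations C M1 T f2" "hv d (hv h v) = hv h0 v"
    using deck2_v[OF HG(1)[OF h(1) v] HG(1)[OF h0(1) v]] h(2) h0(2) by auto
  have dH: "d \<in> H" using deck2D(1)[OF d(1)] .
  let ?k = "hinv h0 \<odot> (d \<odot> h)"
  have kH: "?k \<in> H" using H_comp hinv(1) h0(1) h(1) dH by blast
  have k: "h0 \<odot> ?k = d \<odot> h" using H_cancel(3)[OF H_comp[OF dH h(1)] h0(1)] .
  have "hv ?k v = v" using d(2) hinv_apply(1)[OF h0(1) v] v by simp
  then have "?k \<in> stab v" using kH by (simp add: stab_def)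
  moreover have "s = germ (h0 \<odot> ?k) v" unfolding k using germ_deck2[OF h(1) d(1) v] h(3) by simp
  ultimately show "s \<in> (\<lambda>h. germ (h0 \<odot> h) v) ` stab v" by blast
next
  fix s assume "s \<in> (\<lambda>h. germ (h0 \<odot> h) v) ` stab v"
  then obtain h where h: "h \<in> H" "hv h v = v" "s = germ (h0 \<odot> h) v" by (auto simp: stab_def)
  have "q2 (hv (h0 \<odot> h) v) = w" using h(2) h0(2) v by simp
  then show "s \<in> germs_at v w" unfolding germs_at_def using h(3) H_comp[OF h0(1) h(1)] by blast
qed

lemma finite_frames: "v \<in> gverts GT \<Longrightarrow> finite (frames v)"
  unfolding frames_def using finite_star card_rep_isos(1) by (auto intro!: finite_PiE simp: finite_permutations)

lemma card_frames: "v \<in> gverts GT \<Longrightarrow> card (frames v) = fact (card (star GT v)) * (\<Prod>e \<in> star GT v. card (isotropy H e))"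
  unfolding frames_def using finite_star[of v] card_rep_isos(2) by (simp add: card_cartesian_product card_permutations card_PiE)

lemma rep_isos_nonempty: "rep_isos e \<noteq> {}"
  using rep[of e] by (auto simp: rep_isos_def)

text \<open>
By \<open>frame_act_eq_iff\<close> and \<open>germ_postcomp_iff\<close>, moving a frame by a stabiliser element and
composing it with a fixed \<open>h0\<close> both remember exactly the same data, namely what the element does
on the star. So every orbit of frames has as many elements as there are germs, and the orbits
partition the frames.
\<close>

lemma germs_at_finite_dvd:
  assumes v: "v \<in> gverts GT" and eclass: "germs_at v w \<noteq> {}"
  shows "finite (germs_at v w)"
    "card (germs_at v w) dvd fact (card (star GT v)) * (\<Prod>e \<in> star GT v. card (isotropy H e))"
proof -
  obtain h0 where h0: "h0 \<in> H" "q2 (hv h0 v) = w" using eclass by (auto simp: germs_at_def)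
  let ?orb = "\<lambda>y. frame_act v y ` stab v"
  note eq = card_image_eq_card_image[of "stab v" "frame_act v y" "\<lambda>h. germ (h0 \<odot> h) v" for y]
  have card_orb: "card (?orb y) = card (germs_at v w)" and fin_orb: "finite (?orb y) \<longleftrightarrow> finite (germs_at v w)" if "y \<in> frames v" for y
    unfolding germs_at_eq_stab[OF v h0]
    by (rule eq, simp add: frame_act_eq_iff[OF v that] germ_postcomp_iff[OF v h0(1)])+
  have sub: "?orb y \<subseteq> frames v" if "y \<in> frames v" for y using frame_act_in[OF v that] by blast
  have "(\<lambda>e \<in> star GT v. SOME x. x \<in> rep_isos e) \<in> (\<Pi>\<^sub>E e \<in> star GT v. rep_isos e)"
    using rep_isos_nonempty by (simp add: some_in_eq)
  then have "(id, \<lambda>e \<in> star GT v. SOME x. x \<in> rep_isos e) \<in> frames v" by (auto simp: frames_def permutes_id)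
  then obtain y0 where y0: "y0 \<in> frames v" by (rule that)
  show "finite (germs_at v w)" using fin_orb[OF y0] finite_subset[OF sub[OF y0] finite_frames[OF v]] by simp
  have self: "y \<in> ?orb y" if "y \<in> frames v" for y
    using frame_act_id[OF v that] by (intro image_eqI[where x = "goo_id C T"] stab_id[OF v]) simp
  have un: "\<Union> (?orb ` frames v) = frames v"
  proof
    show "\<Union> (?orb ` frames v) \<subseteq> frames v" using sub by (rule UN_least)
    show "frames v \<subseteq> \<Union> (?orb ` frames v)" using self by (intro subsetI) (rule UN_I)
  qed
  have orb_sub: "?orb (frame_act v y h) \<subseteq> ?orb y" if "y \<in> frames v" "h \<in> stab v" for y h
  proof
    fix x assume "x \<in> ?orb (frame_act v y h)"
    then obtain k where k: "k \<in> stab v" "x = frame_act v (frame_act v y h) k" by blast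
    then show "x \<in> ?orb y" using frame_act_frame_act[OF v that k(1)] stab_comp[OF v that(2) k(1)] by simp
  qed
  have orb_eq: "?orb (frame_act v y h) = ?orb y" if y: "y \<in> frames v" and h: "h \<in> stab v" for y h
  proof
    have hH: "h \<in> H" using h by (simp add: stab_def)
    have "frame_act v (frame_act v y h) (hinv h) = y"
      using frame_act_frame_act[OF v y h stab_inv[OF v h]] hinv(3)[OF hH] frame_act_id[OF v y] by simp
    then show "?orb y \<subseteq> ?orb (frame_act v y h)"
      using orb_sub[OF frame_act_in[OF v y h] stab_inv[OF v h]] by simp
  qed (rule orb_sub[OF y h])
  have "card (germs_at v w) dvd card (\<Union> (?orb ` frames v))"
  proof (rule dvd_partition)
    show "finite (\<Union> (?orb ` frames v))" unfolding un by (rule finite_frames[OF v])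
    show "\<forall>c \<in> ?orb ` frames v. card (germs_at v w) dvd card c" using card_orb by auto
    show "\<forall>c1 \<in> ?orb ` frames v. \<forall>c2 \<in> ?orb ` frames v. c1 \<noteq> c2 \<longrightarrow> c1 \<inter> c2 = {}"
    proof (intro ballI impI equals0I)
      fix c1 c2 z assume c: "c1 \<in> ?orb ` frames v" "c2 \<in> ?orb ` frames v" "c1 \<noteq> c2" "z \<in> c1 \<inter> c2"
      obtain y1 where y1: "y1 \<in> frames v" "c1 = ?orb y1" using c(1) by blast
      obtain y2 where y2: "y2 \<in> frames v" "c2 = ?orb y2" using c(2) by blast
      obtain h1 where "h1 \<in> stab v" "z = frame_act v y1 h1" using c(4) y1(2) by blast
      then have "?orb z = c1" using orb_eq[OF y1(1)] y1(2) by simp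
      moreover obtain h2 where "h2 \<in> stab v" "z = frame_act v y2 h2" using c(4) y2(2) by blast
      then have "?orb z = c2" using orb_eq[OF y2(1)] y2(2) by simp
      ultimately show False using c(3) by simp
    qed
  qed
  then show "card (germs_at v w) dvd fact (card (star GT v)) * (\<Prod>e \<in> star GT v. card (isotropy H e))"
    unfolding un card_frames[OF v] .
qed

end

section \<open>Sizes of the classes of vertices and edges\<close>

context covering_pair
begin

text \<open>
Since \<open>H\<close> contains the deck group of \<open>f1\<close>, its orbits in the tree induce classes of
vertices and of edges of \<open>X1\<close>. These are the sizes of the classes.
\<close>

definition vclass where "vclass u = card {a. \<exists>v \<in> gverts GT. \<exists>h \<in> H. q1 v = a \<and> hv h v = u}"

definition eclass where "eclass e = card {a. \<exists>b \<in> gedges GT. \<exists>h \<in> H. p1 b = a \<and> he h b = e}"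

lemma vclass_set_sub: "{a. \<exists>v \<in> gverts GT. \<exists>h \<in> H. q1 v = a \<and> hv h v = u} \<subseteq> gverts G1"
  using f1G(1) by auto

lemma fin_G: "finite (gverts G1)" "finite (gedges G1)" "finite (gverts G2)" "finite (gedges G2)"
  using fin1 fin2 by (auto simp: finite_graph_def)

lemma vclass_bounds:
  assumes "u \<in> gverts GT"
  shows "0 < vclass u" "vclass u \<le> card (gverts G1)"
proof -
  have "q1 u \<in> {a. \<exists>v \<in> gverts GT. \<exists>h \<in> H. q1 v = a \<and> hv h v = u}"
    using assms H_id id_apply(1)[OF assms] by blast
  then have "{a. \<exists>v \<in> gverts GT. \<exists>h \<in> H. q1 v = a \<and> hv h v = u} \<noteq> {}" by (rule ex_in_conv[THEN iffD1, OF exI])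
  then show "0 < vclass u"
    unfolding vclass_def card_gt_0_iff using finite_subset[OF vclass_set_sub fin_G(1)] by (rule conjI)
  show "vclass u \<le> card (gverts G1)" unfolding vclass_def by (rule card_mono[OF fin_G(1) vclass_set_sub])
qed

text \<open>
Germs are counted by the vertex of \<open>X1\<close> at which they start. It runs through the class of \<open>u\<close>, and
elements of \<open>H\<close> carry the germs at one lift bijectively to those at another.
\<close>

lemma card_germs_into:
  assumes u: "u \<in> gverts GT"
  shows "finite (germs_into (q2 u))" "card (germs_into (q2 u)) = vclass u * card (germs_at u (q2 u))" "0 < card (germs_at u (q2 u))"
proof -
  let ?w = "q2 u"
  let ?A = "{a. \<exists>v \<in> gverts GT. \<exists>h \<in> H. q1 v = a \<and> hv h v = u}"
  have "germ (goo_id C T) u \<in> germs_at u ?w" unfolding germs_at_def using H_id id_apply(1)[OF u] by auto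
  then have eclass: "germs_at u ?w \<noteq> {}" by blast
  show pos: "0 < card (germs_at u ?w)" using germs_at_finite_dvd(1)[OF u eclass] eclass by (simp add: card_gt_0_iff)
  define l where "l a = (SOME v. v \<in> gverts GT \<and> (\<exists>h \<in> H. q1 v = a \<and> hv h v = u))" for a
  have l: "l a \<in> gverts GT \<and> (\<exists>h \<in> H. q1 (l a) = a \<and> hv h (l a) = u)" if "a \<in> ?A" for a
    unfolding l_def by (rule someI_ex) (use that in blast)
  have cl: "card (germs_at (l a) ?w) = card (germs_at u ?w)" if a: "a \<in> ?A" for a
  proof -
    obtain h where "h \<in> H" "hv h (l a) = u" using l[OF a] by blast
    then show ?thesis using card_germs_at_translate[of h "l a" ?w] l[OF a] by simp
  qed
  have fl: "finite (germs_at (l a) ?w)" if a: "a \<in> ?A" for a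
  proof -
    have "germs_at (l a) ?w \<noteq> {}" using cl[OF a] pos by (metis card.empty less_numeral_extra(3))
    then show ?thesis using germs_at_finite_dvd(1)[of "l a" ?w] l[OF a] by simp
  qed
  have eq: "germs_into ?w = (\<Union>a \<in> ?A. germs_at (l a) ?w)"
  proof (intro equalityI subsetI)
    fix s assume "s \<in> germs_into ?w"
    then obtain v where v: "v \<in> gverts GT" "s \<in> germs_at v ?w" by (auto simp: germs_into_def)
    then obtain h where h: "h \<in> H" "q2 (hv h v) = ?w" by (auto simp: germs_at_def)
    obtain d where d: "d \<in> deck_transformations C M1 T f2" "hv d (hv h v) = u"
      using deck2_v[OF HG(1)[OF h(1) v(1)] u] h(2) by auto
    have "d \<odot> h \<in> H" "hv (d \<odot> h) v = u" using H_comp[OF deck2D(1)[OF d(1)] h(1)] d(2) v(1) by auto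
    then have a: "q1 v \<in> ?A" using v(1) by blast
    have "germs_at v ?w \<subseteq> germs_at (l (q1 v)) ?w" by (rule germs_at_deck1) (use v(1) l[OF a] in auto)
    then show "s \<in> (\<Union>a \<in> ?A. germs_at (l a) ?w)" using a v(2) by blast
  next
    fix s assume "s \<in> (\<Union>a \<in> ?A. germs_at (l a) ?w)"
    then obtain a where a: "a \<in> ?A" "s \<in> germs_at (l a) ?w" by blast
    then show "s \<in> germs_into ?w" unfolding germs_into_def using l[OF a(1)] by blast
  qed
  have fA: "finite ?A" using finite_subset[OF vclass_set_sub fin_G(1)] .
  show "finite (germs_into ?w)" unfolding eq using fA fl by blast
  have disj: "germs_at (l a) ?w \<inter> germs_at (l b) ?w = {}" if "a \<in> ?A" "b \<in> ?A" "a \<noteq> b" for a b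
  proof -
    have "q1 (l a) \<noteq> q1 (l b)" using l[OF that(1)] l[OF that(2)] that(3) by metis
    then show ?thesis by (auto simp: germs_at_def germ_def)
  qed
  have "card (germs_into ?w) = (\<Sum>a \<in> ?A. card (germs_at (l a) ?w))"
    unfolding eq by (rule card_UN_disjoint[OF fA]) (use fl disj in auto)
  also have "\<dots> = card ?A * card (germs_at u ?w)" using cl by simp
  finally show "card (germs_into ?w) = vclass u * card (germs_at u ?w)" by (simp add: vclass_def)
qed

lemma eclass_rev: assumes e: "e \<in> gedges GT" shows "eclass (rev_edge GT e) = eclass e"
proof -
  let ?A = "\<lambda>e. {a. \<exists>b \<in> gedges GT. \<exists>h \<in> H. p1 b = a \<and> he h b = e}"
  have sub: "rev_edge G1 ` ?A e \<subseteq> ?A (rev_edge GT e)" for e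
  proof
    fix x assume "x \<in> rev_edge G1 ` ?A e"
    then obtain b h where b: "b \<in> gedges GT" "h \<in> H" "x = rev_edge G1 (p1 b)" "he h b = e" by blast
    have "p1 (rev_edge GT b) = x" "he h (rev_edge GT b) = rev_edge GT e" "rev_edge GT b \<in> gedges GT"
      using b f1G(5)[OF b(1)] HG(5)[OF b(2,1)] edgeT(3)[OF b(1)] by auto
    then show "x \<in> ?A (rev_edge GT e)" using b(2) by blast
  qed
  have inj: "inj_on (rev_edge G1) S" for S by (rule inj_on_inverseI[where g = "rev_edge G1"]) (rule rev_rev_edge[OF gr1])
  have fin: "finite (?A e)" for e by (rule finite_subset[OF _ fin_G(2)]) (use f1G(2) in auto)
  have le: "card (?A e) \<le> card (?A (rev_edge GT e))" for e
    by (rule card_inj_on_le[OF inj sub fin])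
  show ?thesis unfolding eclass_def using le[of e] le[of "rev_edge GT e"] rev_rev_edge[OF grT] by simp
qed

definition class_degree where "class_degree e = card {b \<in> star GT (src GT e). \<exists>h \<in> H. he h b = e}"

text \<open>
Each vertex of the class of the initial vertex is the start of equally many edges of the class
of \<open>e\<close>.
\<close>

lemma eclass_eq: assumes e: "e \<in> gedges GT" shows "eclass e = vclass (src GT e) * class_degree e"
proof -
  let ?u = "src GT e"
  note u = edgeT(1)[OF e]
  let ?A = "{a. \<exists>v \<in> gverts GT. \<exists>h \<in> H. q1 v = a \<and> hv h v = ?u}"
  let ?E = "{a. \<exists>b \<in> gedges GT. \<exists>h \<in> H. p1 b = a \<and> he h b = e}"
  have finE: "finite ?E" by (rule finite_subset[OF _ fin_G(2)]) (use f1G(2) in auto)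
  have "card ?E = (\<Sum>a \<in> ?A. card {x \<in> ?E. src G1 x = a})"
  proof -
    have "?E = (\<Union>a \<in> ?A. {x \<in> ?E. src G1 x = a})"
    proof (intro equalityI subsetI)
      fix x assume x: "x \<in> ?E"
      then obtain b h where b: "b \<in> gedges GT" "h \<in> H" "x = p1 b" "he h b = e" by blast
      have "q1 (src GT b) = src G1 x" "hv h (src GT b) = ?u"
        using b f1G(3)[OF b(1)] HG(3)[OF b(2,1)] by auto
      then have "src G1 x \<in> ?A" using b(2) edgeT(1)[OF b(1)] by blast
      then show "x \<in> (\<Union>a \<in> ?A. {x \<in> ?E. src G1 x = a})" using x by blast
    qed blast
    also have "card \<dots> = (\<Sum>a \<in> ?A. card {x \<in> ?E. src G1 x = a})"
      by (rule card_UN_disjoint) (use finite_subset[OF vclass_set_sub fin_G(1)] finE in auto)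
    finally show ?thesis .
  qed
  also have "\<dots> = (\<Sum>a \<in> ?A. class_degree e)"
  proof (rule sum.cong[OF refl])
    fix a assume "a \<in> ?A"
    then obtain v h where v: "v \<in> gverts GT" "h \<in> H" "q1 v = a" "hv h v = ?u" by blast
    let ?B = "{b \<in> star GT v. \<exists>k \<in> H. he k b = e}"
    have "{x \<in> ?E. src G1 x = a} = p1 ` ?B"
    proof (intro equalityI subsetI)
      fix x assume "x \<in> {x \<in> ?E. src G1 x = a}"
      then obtain b k where b: "b \<in> gedges GT" "k \<in> H" "x = p1 b" "he k b = e" "src G1 x = a" by blast
      have sb: "q1 (src GT b) = q1 v" using f1G(3)[OF b(1)] b v(3) by simp
      obtain d where d: "d \<in> deck_transformations C M1 T f1" "hv d v = src GT b"
        using deck1_v[OF v(1) edgeT(1)[OF b(1)]] sb by auto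
      note dH = deck1D(1)[OF d(1)]
      have "b \<in> he d ` star GT v" using he_star[OF dH v(1)] d(2) b(1) by (auto simp: bij_betw_def)
      then obtain c where c: "c \<in> star GT v" "b = he d c" by blast
      have "he (k \<odot> d) c = e" using b(4) c by simp
      moreover have "p1 c = x" using deck1D(3)[OF d(1)] c b(3) by simp
      ultimately show "x \<in> p1 ` ?B" using c(1) H_comp[OF b(2) dH] by blast
    next
      fix x assume "x \<in> p1 ` ?B"
      then obtain b k where b: "b \<in> star GT v" "k \<in> H" "he k b = e" "x = p1 b" by blast
      then show "x \<in> {x \<in> ?E. src G1 x = a}" using f1G(3)[of b] v(3) by auto
    qed
    moreover have "inj_on p1 ?B" using p1_star[OF v(1)] by (auto simp: bij_betw_def inj_on_def)
    ultimately have "card {x \<in> ?E. src G1 x = a} = card ?B" by (simp add: card_image)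
    also have "\<dots> = card (he h ` ?B)"
      using he_star[OF v(2,1)] by (intro card_image[symmetric]) (auto simp: bij_betw_def inj_on_def)
    also have "he h ` ?B = {b \<in> star GT ?u. \<exists>k \<in> H. he k b = e}"
    proof (intro equalityI subsetI)
      fix x assume "x \<in> he h ` ?B"
      then obtain b k where b: "b \<in> star GT v" "k \<in> H" "he k b = e" "x = he h b" by blast
      have bE: "b \<in> gedges GT" using b(1) by simp
      have "he (k \<odot> hinv h) x = e" using b hinv_apply(3)[OF v(2) bE] HG(2)[OF v(2) bE] by simp
      moreover have "x \<in> star GT ?u" using bij_betwE[OF he_star[OF v(2,1)]] b v(4) by auto
      ultimately show "x \<in> {b \<in> star GT ?u. \<exists>k \<in> H. he k b = e}" using H_comp[OF b(2) hinv(1)[OF v(2)]] by blast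
    next
      fix x assume "x \<in> {b \<in> star GT ?u. \<exists>k \<in> H. he k b = e}"
      then obtain k where k: "x \<in> star GT ?u" "k \<in> H" "he k x = e" by blast
      have "x \<in> he h ` star GT v" using he_star[OF v(2,1)] v(4) k(1) by (simp add: bij_betw_def)
      then obtain b where b: "b \<in> star GT v" "x = he h b" by blast
      have "he (k \<odot> h) b = e" using k(3) b by simp
      then show "x \<in> he h ` ?B" using b H_comp[OF k(2) v(2)] by blast
    qed
    finally show "card {x \<in> ?E. src G1 x = a} = class_degree e" by (simp add: class_degree_def)
  qed
  finally show ?thesis by (simp add: eclass_def vclass_def)
qed

definition maxdeg where "maxdeg = max_degree GT"

lemma degree_le: assumes v: "v \<in> gverts GT" shows "card (star GT v) \<le> maxdeg"
proof -
  have "(\<lambda>v. card (star GT v)) ` gverts GT \<subseteq> (\<lambda>a. card (star G1 a)) ` gverts G1"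
    using bij_betw_same_card[OF p1_star] f1G(1) by auto
  then have "finite ((\<lambda>v. card (star GT v)) ` gverts GT)" by (rule finite_subset) (simp add: fin_G(1))
  then show ?thesis unfolding maxdeg_def max_degree_def using v by (intro Max_ge) auto
qed

lemma class_degree_bounds: assumes e: "e \<in> gedges GT" shows "0 < class_degree e" "class_degree e \<le> maxdeg"
proof -
  note u = edgeT(1)[OF e]
  let ?B = "{b \<in> star GT (src GT e). \<exists>h \<in> H. he h b = e}"
  have "e \<in> ?B" using e H_id id_apply(2)[OF e] by auto
  then have "?B \<noteq> {}" by (rule ex_in_conv[THEN iffD1, OF exI])
  moreover have "finite ?B" by (rule finite_subset[OF _ finite_star[OF u]]) auto
  ultimately show "0 < class_degree e" unfolding class_degree_def card_gt_0_iff by (rule conjI)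
  have "card ?B \<le> card (star GT (src GT e))" by (rule card_mono[OF finite_star[OF u]]) auto
  then show "class_degree e \<le> maxdeg" unfolding class_degree_def using degree_le[OF u] by simp
qed

text \<open>
Counting a class of edges from both ends relates the classes of adjacent vertices by factors that are
at most the maximal degree; connectedness spreads this over the tree.
\<close>

lemma vclass_large_prime:
  assumes "prime p" "maxdeg < p" "r \<in> gverts GT" "u \<in> gverts GT"
  shows "multiplicity p (vclass u) = multiplicity p (vclass r)"
  using tree assms(3,4)
proof (induction rule: tree_induct)
  case (edge e)
  note e = edge(1) and r = edgeT[OF edge(1)]
  have "vclass (tgt GT e) * class_degree (rev_edge GT e) = vclass (src GT e) * class_degree e"
    using eclass_eq[OF e] eclass_eq[OF r(3)] eclass_rev[OF e] r(5) by simp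
  then have "multiplicity p (vclass (tgt GT e)) = multiplicity p (vclass (src GT e))"
    by (rule large_prime_multiplicity_eq[OF assms(1,2)])
      (use vclass_bounds(1)[OF r(1)] vclass_bounds(1)[OF r(2)] class_degree_bounds[OF e] class_degree_bounds[OF r(3)] in auto)
  then show ?case using edge(2) by simp
qed simp

definition iso_lcm where "iso_lcm = (LCM e \<in> gedges GT. card (isotropy H e))"

lemma isotropy_pos: "e \<in> gedges GT \<Longrightarrow> 0 < card (isotropy H e)"
proof -
  assume e: "e \<in> gedges GT"
  have "emor (goo_id C T) e \<in> isotropy H e" using H_id id_apply(2)[OF e] by (auto simp: isotropy_def)
  then show ?thesis using fin_iso e unfolding card_gt_0_iff finite_edge_isotropy_def by blast
qed

lemma isotropy_translate_le:
  assumes "k \<in> H" "e \<in> gedges GT"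
  shows "card (isotropy H e) = card (isotropy H (he k e))"
proof -
  have "rep_isos e = (\<lambda>x. x \<cdot> emor k e) ` rep_isos (he k e)"
  proof (intro equalityI subsetI)
    fix x assume "x \<in> rep_isos e"
    then obtain h where h: "h \<in> H" "he h e = rep e" "x = emor h e" by (auto simp: rep_isos_def)
    let ?h = "h \<odot> hinv k"
    have ke: "he k e \<in> gedges GT" using HG(2)[OF assms] .
    have "?h \<odot> k = h" by (rule H_cancel(1)[OF h(1) assms(1)])
    then have "x = emor ?h (he k e) \<cdot> emor k e" using emor_comp[OF assms(2), of ?h k] h(3) by simp
    moreover have "he ?h (he k e) = rep (he k e)"
      using h(2) hinv_apply(3)[OF assms] ke rep_invariant[OF assms] by simp
    then have "emor ?h (he k e) \<in> rep_isos (he k e)" unfolding rep_isos_def using H_comp[OF h(1) hinv(1)[OF assms(1)]] by blast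
    ultimately show "x \<in> (\<lambda>x. x \<cdot> emor k e) ` rep_isos (he k e)" by (rule image_eqI)
  next
    fix x assume "x \<in> (\<lambda>x. x \<cdot> emor k e) ` rep_isos (he k e)"
    then show "x \<in> rep_isos e" using rep_isos_comp[OF assms] by auto
  qed
  moreover have "inj_on (\<lambda>x. x \<cdot> emor k e) (rep_isos (he k e))"
  proof (rule inj_onI)
    fix x y assume xy: "x \<in> rep_isos (he k e)" "y \<in> rep_isos (he k e)" "x \<cdot> emor k e = y \<cdot> emor k e"
    have ke: "he k e \<in> gedges GT" using HG(2)[OF assms] .
    show "x = y"
      by (rule iso_cancel_right[OF HD(3)[OF assms] iso_Mor[OF rep_isos_arrow[OF ke xy(1)]] iso_Mor[OF rep_isos_arrow[OF ke xy(2)]] xy(3)])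
  qed
  ultimately have "card (rep_isos e) = card (rep_isos (he k e))" by (simp add: card_image)
  then show ?thesis using card_rep_isos(2)[OF assms(2)] card_rep_isos(2)[OF HG(2)[OF assms]] by simp
qed

text \<open>
Isotropy orders are constant on fibres of \<open>f1\<close>, so only finitely many occur.
\<close>

lemma iso_lcm_pos: "0 < iso_lcm"
proof -
  let ?f = "\<lambda>e. card (isotropy H e)"
  define l where "l a = (SOME e. e \<in> gedges GT \<and> p1 e = a)" for a
  have "?f ` gedges GT \<subseteq> (?f \<circ> l) ` gedges G1"
  proof
    fix x assume "x \<in> ?f ` gedges GT"
    then obtain e where e: "e \<in> gedges GT" "x = ?f e" by blast
    have l: "l (p1 e) \<in> gedges GT \<and> p1 (l (p1 e)) = p1 e"
      unfolding l_def by (rule someI_ex) (use e in blast)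
    then obtain d where d: "d \<in> deck_transformations C M1 T f1" "he d e = l (p1 e)"
      using deck1_e[OF e(1), of "l (p1 e)"] by auto
    have "x = ?f (l (p1 e))" using isotropy_translate_le[OF deck1D(1)[OF d(1)] e(1)] d(2) e(2) by simp
    then show "x \<in> (?f \<circ> l) ` gedges G1" using f1G(2)[OF e(1)] by auto
  qed
  then have "finite (?f ` gedges GT)" by (rule finite_subset) (simp add: fin_G(2))
  moreover have "0 \<notin> ?f ` gedges GT"
  proof
    assume "0 \<in> ?f ` gedges GT"
    then obtain e where "e \<in> gedges GT" "0 = ?f e" by blast
    then show False using isotropy_pos[of e] by simp
  qed
  ultimately show ?thesis unfolding iso_lcm_def by (metis Lcm_0_iff gr0I)
qed

lemma germs_at_dvd:
  assumes u: "u \<in> gverts GT"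
  shows "card (germs_at u (q2 u)) dvd fact maxdeg * iso_lcm ^ maxdeg"
proof -
  have "germs_at u (q2 u) \<noteq> {}" using card_germs_into(3)[OF u] by auto
  from germs_at_finite_dvd(2)[OF u this]
  have "card (germs_at u (q2 u)) dvd fact (card (star GT u)) * (\<Prod>e \<in> star GT u. card (isotropy H e))" .
  also have "\<dots> dvd fact maxdeg * iso_lcm ^ maxdeg"
  proof (rule mult_dvd_mono)
    show "(fact (card (star GT u)) :: nat) dvd fact maxdeg" using degree_le[OF u] by (rule fact_dvd)
    have "(\<Prod>e \<in> star GT u. card (isotropy H e)) dvd (\<Prod>e \<in> star GT u. iso_lcm)"
      unfolding iso_lcm_def by (rule prod_dvd_prod) (auto intro!: dvd_Lcm)
    also have "\<dots> = iso_lcm ^ card (star GT u)" by simp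
    also have "\<dots> dvd iso_lcm ^ maxdeg" using degree_le[OF u] by (rule le_imp_power_dvd)
    finally show "(\<Prod>e \<in> star GT u. card (isotropy H e)) dvd iso_lcm ^ maxdeg" .
  qed
  finally show ?thesis .
qed

text \<open>
The common multiple that determines the number of vertices of the glued graph.
\<close>

lemma germs_into_dvd:
  assumes r: "r \<in> gverts GT" and w: "w \<in> gverts G2" and V: "card (gverts G1) \<le> V"
  shows "card (germs_into w) dvd vclass r * smooth_bound maxdeg V * (fact maxdeg * iso_lcm ^ maxdeg)" "0 < card (germs_into w)" "finite (germs_into w)"
proof -
  have "w \<in> q2 ` gverts GT" using w f2_surj(1) by simp
  then obtain u where u: "u \<in> gverts GT" "q2 u = w" by blast
  have "vclass u dvd vclass r * smooth_bound maxdeg V"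
    by (rule dvd_mult_smooth_bound) (use vclass_bounds[OF u(1)] vclass_bounds[OF r] V vclass_large_prime[OF _ _ r u(1)] in auto)
  then show "card (germs_into w) dvd vclass r * smooth_bound maxdeg V * (fact maxdeg * iso_lcm ^ maxdeg)"
    using card_germs_into(2)[OF u(1)] germs_at_dvd[OF u(1)] u(2) by (simp add: mult_dvd_mono)
  show "0 < card (germs_into w)" "finite (germs_into w)"
    using card_germs_into[OF u(1)] vclass_bounds(1)[OF u(1)] u(2) by simp_all
qed

end

section \<open>Germs through a given edge type\<close>

context covering_pair
begin

text \<open>
Types are sorted by their second edge, to match germs that are sorted by their target.
\<close>

definition types_over where
  "types_over e2 = {\<epsilon>. \<exists>h \<in> H. \<exists>e \<in> gedges GT. \<epsilon> = edge_type h e \<and> p2 (he h e) = e2}"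

definition germs_through where "germs_through \<epsilon> = {s \<in> germs_into (src G2 (fst (snd \<epsilon>))). \<epsilon> \<in> snd (snd s)}"

lemma germs_into_iff: "s \<in> germs_into w \<longleftrightarrow> (\<exists>v \<in> gverts GT. \<exists>h \<in> H. q2 (hv h v) = w \<and> s = germ h v)"
  by (auto simp: germs_into_def germs_at_def)

lemma germs_into_proj: "s \<in> germs_into w \<Longrightarrow> fst (snd s) = w"
  by (auto simp: germs_into_iff germ_def)

lemma p2_src: assumes "h \<in> H" "e \<in> gedges GT" shows "src G2 (p2 (he h e)) = q2 (hv h (src GT e))"
  using f2G(3)[OF HG(2)[OF assms]] HG(3)[OF assms] by simp

text \<open>
All germs through the type of \<open>h\<close> at \<open>e\<close> can be taken at the initial vertex of \<open>e\<close>, by moving with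
a deck transformation of \<open>f1\<close>.
\<close>

lemma germs_through_eq_image:
  assumes h: "h \<in> H" and e: "e \<in> gedges GT"
  shows "germs_through (edge_type h e) = (\<lambda>q. germ q (src GT e)) ` {q \<in> H. edge_type q e = edge_type h e}"
proof (intro equalityI subsetI)
  let ?\<epsilon> = "edge_type h e" and ?v = "src GT e"
  note v = edgeT(1)[OF e]
  fix s assume "s \<in> germs_through ?\<epsilon>"
  then have s: "s \<in> germs_into (src G2 (p2 (he h e)))" "?\<epsilon> \<in> snd (snd s)" by (simp_all add: germs_through_def edge_type_def)
  then obtain u q where q: "u \<in> gverts GT" "q \<in> H" "s = germ q u" by (auto simp: germs_into_iff)
  then have "?\<epsilon> \<in> edge_type q ` star GT u" using s(2) by (simp add: germ_def)
  then obtain a where a: "a \<in> star GT u" "?\<epsilon> = edge_type q a" by blast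
  then have aE: "a \<in> gedges GT" and pa: "p1 a = p1 e" by (simp_all add: edge_type_def)
  obtain d where d: "d \<in> deck_transformations C M1 T f1" "he d e = a" using deck1_e[OF e aE] pa by auto
  note dH = deck1D(1)[OF d(1)]
  have "edge_type (q \<odot> d) e = ?\<epsilon>" using edge_type_deck1[OF q(2) d(1) e] d(2) a(2) by simp
  moreover have "hv d ?v = u" using HG(3)[OF dH e] d(2) a(1) by simp
  then have "germ (q \<odot> d) ?v = s" using germ_deck1[OF q(2) d(1) v] q(3) by simp
  ultimately show "s \<in> (\<lambda>q. germ q ?v) ` {q \<in> H. edge_type q e = ?\<epsilon>}" using H_comp[OF q(2) dH] by blast
next
  let ?\<epsilon> = "edge_type h e" and ?v = "src GT e"
  note v = edgeT(1)[OF e]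
  fix s assume "s \<in> (\<lambda>q. germ q ?v) ` {q \<in> H. edge_type q e = ?\<epsilon>}"
  then obtain q where q: "q \<in> H" "edge_type q e = ?\<epsilon>" "s = germ q ?v" by blast
  have "p2 (he q e) = p2 (he h e)" using q(2) by (simp add: edge_type_def)
  then have "q2 (hv q ?v) = src G2 (p2 (he h e))" using p2_src[OF q(1) e] by simp
  then have "s \<in> germs_into (src G2 (p2 (he h e)))" unfolding germs_into_iff using q v by blast
  moreover have "?\<epsilon> \<in> snd (snd s)" unfolding q(3) germ_def q(2)[symmetric] using e by simp
  ultimately show "s \<in> germs_through ?\<epsilon>" by (simp add: germs_through_def edge_type_def)
qed

text \<open>
Two types over \<open>e2\<close> are represented by edges in the same \<open>H\<close>-orbit, and precomposition with an
element \<open>k\<close> of \<open>H\<close> between them matches the germs through one with the germs through the other.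
\<close>

lemma card_germs_through_eq:
  assumes "\<epsilon> \<in> types_over e2" "\<epsilon>' \<in> types_over e2"
  shows "card (germs_through \<epsilon>') = card (germs_through \<epsilon>)"
proof -
  obtain h e where h: "h \<in> H" "e \<in> gedges GT" "\<epsilon> = edge_type h e" "p2 (he h e) = e2"
    using assms(1) by (auto simp: types_over_def)
  obtain h0 e' where h0: "h0 \<in> H" "e' \<in> gedges GT" "\<epsilon>' = edge_type h0 e'" "p2 (he h0 e') = e2"
    using assms(2) by (auto simp: types_over_def)
  \<comment> \<open>correct \<open>h0\<close> by a deck transformation of \<open>f2\<close>, so that \<open>e\<close> and \<open>e'\<close> have the same image in the tree\<close>
  obtain d where d: "d \<in> deck_transformations C M1 T f2" "he d (he h0 e') = he h e"
    using deck2_e[OF HG(2)[OF h0(1,2)] HG(2)[OF h(1,2)]] h(4) h0(4) by auto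
  note dH = deck2D(1)[OF d(1)]
  define k where "k = hinv h \<odot> (d \<odot> h0)"
  have kH: "k \<in> H" unfolding k_def using H_comp hinv(1) h(1) h0(1) dH by blast
  have hk: "h \<odot> k = d \<odot> h0" unfolding k_def using H_cancel(3)[OF H_comp[OF dH h0(1)] h(1)] .
  have ke: "he k e' = e" unfolding k_def using d(2) hinv_apply(3)[OF h(1,2)] h0(2) by simp
  have \<epsilon>': "\<epsilon>' = edge_type (h \<odot> k) e'" unfolding hk h0(3) using edge_type_deck2[OF h0(1) d(1) h0(2)] by simp
  let ?v = "src GT e" and ?v' = "src GT e'"
  have vk: "hv k ?v' = ?v" using HG(3)[OF kH h0(2)] ke by simp
  let ?B = "{q \<in> H. edge_type q e = edge_type h e}"
  have B': "{q \<in> H. edge_type q e' = edge_type (h \<odot> k) e'} = (\<lambda>q. q \<odot> k) ` ?B"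
  proof (intro equalityI subsetI)
    fix q assume "q \<in> {q \<in> H. edge_type q e' = edge_type (h \<odot> k) e'}"
    then have q: "q \<in> H" "edge_type q e' = edge_type (h \<odot> k) e'" by auto
    note ki = hinv(1)[OF kH]
    have e'k: "he (hinv k) e = e'" using hinv_apply(3)[OF kH h0(2)] ke by simp
    have "edge_type (q \<odot> hinv k) e = edge_type ((h \<odot> k) \<odot> hinv k) e"
      by (rule edge_type_precomp[OF q(1) H_comp[OF h(1) kH] ki h(2)]) (use q(2) e'k in simp)
    then have "q \<odot> hinv k \<in> ?B" using H_cancel(2)[OF h(1) kH] H_comp[OF q(1) ki] by simp
    moreover have "(q \<odot> hinv k) \<odot> k = q" using H_cancel(1)[OF q(1) kH] .
    ultimately show "q \<in> (\<lambda>q. q \<odot> k) ` ?B" by (intro image_eqI[where x = "q \<odot> hinv k"]) simp_all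
  next
    fix q assume "q \<in> (\<lambda>q. q \<odot> k) ` ?B"
    then obtain r where r: "r \<in> H" "edge_type r e = edge_type h e" "q = r \<odot> k" by blast
    have "edge_type (r \<odot> k) e' = edge_type (h \<odot> k) e'"
      by (rule edge_type_precomp[OF r(1) h(1) kH h0(2)]) (use r(2) ke in simp)
    then show "q \<in> {q \<in> H. edge_type q e' = edge_type (h \<odot> k) e'}" using r H_comp[OF r(1) kH] by simp
  qed
  have "germs_through \<epsilon>' = (\<lambda>q. germ (q \<odot> k) ?v') ` ?B"
    unfolding \<epsilon>' germs_through_eq_image[OF H_comp[OF h(1) kH] h0(2)] B' image_image ..
  also have "card \<dots> = card ((\<lambda>q. germ q (hv k ?v')) ` ?B)"
    by (rule card_image_eq_card_image(1)) (use germ_precomp_iff kH edgeT(1)[OF h0(2)] in auto)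
  also have "\<dots> = card (germs_through \<epsilon>)" unfolding h(3) germs_through_eq_image[OF h(1,2)] vk ..
  finally show ?thesis .
qed

text \<open>
A germ into the initial vertex of \<open>e2\<close> covers its star, so it has exactly one type over \<open>e2\<close>.
\<close>

lemma germ_type_unique:
  assumes s: "s \<in> germs_into (src G2 e2)" and e2: "e2 \<in> gedges G2"
  shows "\<exists>!\<epsilon>. \<epsilon> \<in> snd (snd s) \<and> fst (snd \<epsilon>) = e2" "\<And>\<epsilon>. \<epsilon> \<in> snd (snd s) \<Longrightarrow> \<epsilon> \<in> types_over (fst (snd \<epsilon>))"
    "finite (snd (snd s))"
proof -
  obtain v h where v: "v \<in> gverts GT" "h \<in> H" "q2 (hv h v) = src G2 e2" "s = germ h v"
    using s by (auto simp: germs_into_iff)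
  have S: "snd (snd s) = edge_type h ` star GT v" using v(4) by (simp add: germ_def)
  show "finite (snd (snd s))" unfolding S using finite_star[OF v(1)] by simp
  show "\<epsilon> \<in> types_over (fst (snd \<epsilon>))" if "\<epsilon> \<in> snd (snd s)" for \<epsilon>
  proof -
    obtain a where a: "a \<in> star GT v" "\<epsilon> = edge_type h a" using \<open>\<epsilon> \<in> snd (snd s)\<close> unfolding S by blast
    then have "fst (snd \<epsilon>) = p2 (he h a)" "a \<in> gedges GT" by (simp_all add: edge_type_def)
    then show ?thesis unfolding types_over_def using a(2) v(2) by auto
  qed
  have b: "bij_betw (p2 \<circ> he h) (star GT v) (star G2 (src G2 e2))"
    using bij_betw_trans[OF he_star[OF v(2,1)] p2_star[OF HG(1)[OF v(2,1)]]] v(3) by simp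
  have "e2 \<in> (p2 \<circ> he h) ` star GT v" using b e2 by (simp add: bij_betw_def)
  then obtain a where a: "a \<in> star GT v" "p2 (he h a) = e2" by auto
  show "\<exists>!\<epsilon>. \<epsilon> \<in> snd (snd s) \<and> fst (snd \<epsilon>) = e2"
  proof (rule ex1I[of _ "edge_type h a"])
    show "edge_type h a \<in> snd (snd s) \<and> fst (snd (edge_type h a)) = e2" unfolding S
      using imageI[OF a(1), of "edge_type h"] a(2) by (intro conjI) (assumption, simp add: edge_type_def)
    fix \<epsilon> assume "\<epsilon> \<in> snd (snd s) \<and> fst (snd \<epsilon>) = e2"
    then obtain b' where b': "b' \<in> star GT v" "\<epsilon> = edge_type h b'" "p2 (he h b') = e2"
      unfolding S by (auto simp: edge_type_def)
    have "b' = a" by (rule inj_onD[OF bij_betw_imp_inj_on[OF b]]) (use b' a in simp_all)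
    then show "\<epsilon> = edge_type h a" using b'(2) by simp
  qed
qed

lemma finite_types_over:
  assumes e2: "e2 \<in> gedges G2" and fin: "finite (germs_into (src G2 e2))"
  shows "finite (types_over e2)"
proof (rule finite_subset)
  show "types_over e2 \<subseteq> (\<Union>s \<in> germs_into (src G2 e2). snd (snd s))"
  proof
    fix \<epsilon> assume "\<epsilon> \<in> types_over e2"
    then obtain h e where h: "h \<in> H" "e \<in> gedges GT" "\<epsilon> = edge_type h e" "p2 (he h e) = e2" by (auto simp: types_over_def)
    have "germ h (src GT e) \<in> germs_into (src G2 e2)"
      unfolding germs_into_iff using h edgeT(1)[OF h(2)] p2_src[OF h(1,2)] by auto
    moreover have "\<epsilon> \<in> snd (snd (germ h (src GT e)))" using h(2,3) by (simp add: germ_def)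
    ultimately show "\<epsilon> \<in> (\<Union>s \<in> germs_into (src G2 e2). snd (snd s))" by blast
  qed
  show "finite (\<Union>s \<in> germs_into (src G2 e2). snd (snd s))"
    by (rule finite_UN_I[OF fin germ_type_unique(3)[OF _ e2]])
qed

lemma card_germs_into_types_over:
  assumes e2: "e2 \<in> gedges G2" and fin: "finite (germs_into (src G2 e2))" and \<epsilon>: "\<epsilon> \<in> types_over e2"
  shows "card (germs_into (src G2 e2)) = card (types_over e2) * card (germs_through \<epsilon>)"
proof -
  let ?w = "src G2 e2"
  have pr: "fst (snd \<delta>) = e2" if "\<delta> \<in> types_over e2" for \<delta> using that by (auto simp: types_over_def edge_type_def)
  have sub: "germs_through \<delta> \<subseteq> germs_into ?w" if "\<delta> \<in> types_over e2" for \<delta> using pr[OF that] by (auto simp: germs_through_def)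
  have "germs_into ?w = (\<Union>\<delta> \<in> types_over e2. germs_through \<delta>)"
  proof
    show "germs_into ?w \<subseteq> (\<Union>\<delta> \<in> types_over e2. germs_through \<delta>)"
    proof
      fix s assume s: "s \<in> germs_into ?w"
      obtain \<delta> where d: "\<delta> \<in> snd (snd s)" "fst (snd \<delta>) = e2" using germ_type_unique(1)[OF s e2] by blast
      then have "\<delta> \<in> types_over e2" using germ_type_unique(2)[OF s e2 d(1)] by simp
      moreover have "s \<in> germs_through \<delta>" using d s by (simp add: germs_through_def)
      ultimately show "s \<in> (\<Union>\<delta> \<in> types_over e2. germs_through \<delta>)" by blast
    qed
    show "(\<Union>\<delta> \<in> types_over e2. germs_through \<delta>) \<subseteq> germs_into ?w" using sub by (rule UN_least)
  qed
  also have "card \<dots> = (\<Sum>\<delta> \<in> types_over e2. card (germs_through \<delta>))"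
  proof (rule card_UN_disjoint)
    show "finite (types_over e2)" by (rule finite_types_over[OF e2 fin])
    show "\<forall>i \<in> types_over e2. finite (germs_through i)" using sub finite_subset[OF _ fin] by blast
    show "\<forall>i \<in> types_over e2. \<forall>j \<in> types_over e2. i \<noteq> j \<longrightarrow> germs_through i \<inter> germs_through j = {}"
    proof (intro ballI impI equals0I)
      fix i j s assume ij: "i \<in> types_over e2" "j \<in> types_over e2" "i \<noteq> j" "s \<in> germs_through i \<inter> germs_through j"
      then have "s \<in> germs_into ?w" "i \<in> snd (snd s)" "j \<in> snd (snd s)" using pr by (auto simp: germs_through_def)
      then show False using germ_type_unique(1)[of s, OF _ e2] pr[OF ij(1)] pr[OF ij(2)] ij(3) by blast
    qed
  qed
  also have "\<dots> = (\<Sum>\<delta> \<in> types_over e2. card (germs_through \<epsilon>))" using card_germs_through_eq[OF \<epsilon>] by (intro sum.cong) simp_all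
  finally show ?thesis by simp
qed

lemma edge_type_rev:
  assumes "h \<in> H" "e \<in> gedges GT"
  shows "edge_type h (rev_edge GT e) = type_rev G1 G2 (edge_type h e)"
  unfolding edge_type_def type_rev_def over_mor_def
  using assms f1G(5) HG(5)[OF assms] HG(2)[OF assms] f2G(5) f1D(4) f2D(4) HD(4)[OF assms] by simp

lemma types_over_rev:
  assumes "\<epsilon> \<in> types_over e2"
  shows "type_rev G1 G2 \<epsilon> \<in> types_over (rev_edge G2 e2)"
proof -
  obtain h e where h: "h \<in> H" "e \<in> gedges GT" "\<epsilon> = edge_type h e" "p2 (he h e) = e2"
    using assms by (auto simp: types_over_def)
  have "type_rev G1 G2 \<epsilon> = edge_type h (rev_edge GT e)" using edge_type_rev[OF h(1,2)] h(3) by simp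
  moreover have "p2 (he h (rev_edge GT e)) = rev_edge G2 e2"
    using HG(5)[OF h(1,2)] f2G(5)[OF HG(2)[OF h(1,2)]] h(4) by simp
  ultimately show ?thesis unfolding types_over_def using h(1) edgeT(3)[OF h(2)] by blast
qed

lemma type_rev_rev: "type_rev G1 G2 (type_rev G1 G2 \<epsilon>) = \<epsilon>"
  using rev_rev_edge[OF gr1] rev_rev_edge[OF gr2] by (simp add: type_rev_def)

lemma card_types_over_rev: "card (types_over (rev_edge G2 e2)) = card (types_over e2)"
proof (rule bij_betw_same_card)
  show "bij_betw (type_rev G1 G2) (types_over (rev_edge G2 e2)) (types_over e2)"
    by (rule bij_betwI[where g = "type_rev G1 G2"])
      (use types_over_rev[of _ "rev_edge G2 e2"] types_over_rev[of _ e2] rev_rev_edge[OF gr2] type_rev_rev in auto)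
qed

text \<open>
The vertex morphism that belongs to the germ of \<open>h\<close> at \<open>v\<close>. It depends on \<open>h\<close> and \<open>v\<close>, not only on
the germ.
\<close>

definition germ_mor where "germ_mor h v = (vmor f2 (hv h v) \<cdot> vmor h v) \<cdot> minv (vmor f1 v)"

lemma vm_iso:
  assumes "h \<in> H" "v \<in> gverts GT"
  shows "vmor f2 (hv h v) \<cdot> vmor h v \<in> iso (vobj T v) (vobj X2 (q2 (hv h v)))"
  using iso_comp[OF HD(2)[OF assms] f2D(2)[OF HG(1)[OF assms]]] .

lemma germ_is_germ:
  assumes h: "h \<in> H" and v: "v \<in> gverts GT"
  shows "is_germ X1 X2 (q1 v) (q2 (hv h v)) (edge_type h ` star GT v) (germ_mor h v)"
  unfolding is_germ_def
proof (intro conjI ballI)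
  show "q1 v \<in> gverts G1" "q2 (hv h v) \<in> gverts G2" using f1G(1)[OF v] f2G(1)[OF HG(1)[OF h v]] .
  have inj: "inj_on (edge_type h) (star GT v)"
    by (rule inj_onI) (use p1_inj in \<open>auto simp: edge_type_def\<close>)
  have tb: "bij_betw (edge_type h) (star GT v) (edge_type h ` star GT v)" using inj by (simp add: bij_betw_def)
  have "bij_betw (fst \<circ> edge_type h) (star GT v) (star G1 (q1 v))"
    using p1_star[OF v] by (simp add: edge_type_def comp_def)
  then show "bij_betw fst (edge_type h ` star GT v) (star G1 (q1 v))" using bij_betw_comp_iff[OF tb] by blast
  have "bij_betw ((\<lambda>\<epsilon>. fst (snd \<epsilon>)) \<circ> edge_type h) (star GT v) (star G2 (q2 (hv h v)))"
    using bij_betw_trans[OF he_star[OF h v] p2_star[OF HG(1)[OF h v]]] by (simp add: edge_type_def comp_def)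
  then show "bij_betw (\<lambda>\<epsilon>. fst (snd \<epsilon>)) (edge_type h ` star GT v) (star G2 (q2 (hv h v)))"
    using bij_betw_comp_iff[OF tb] by blast
  show "germ_mor h v \<in> iso (vobj X1 (q1 v)) (vobj X2 (q2 (hv h v)))"
    unfolding germ_mor_def using iso_comp[OF minv(1)[OF f1D(2)[OF v]] vm_iso[OF h v]] .
  fix \<epsilon> assume "\<epsilon> \<in> edge_type h ` star GT v"
  then obtain e where e: "e \<in> gedges GT" "src GT e = v" "\<epsilon> = edge_type h e" by auto
  note he = HG(2)[OF h e(1)]
  have \<epsilon>: "fst \<epsilon> = p1 e" "fst (snd \<epsilon>) = p2 (he h e)" "snd (snd \<epsilon>) = over_mor h e \<cdot> minv (emor f1 e)"
    by (simp_all add: e(3) edge_type_def)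
  note m1 = f1D(3)[OF e(1)] and n1 = f1D(2)[OF v]
  show "snd (snd \<epsilon>) \<in> iso (eobj X1 (fst \<epsilon>)) (eobj X2 (fst (snd \<epsilon>)))"
    unfolding \<epsilon> using iso_comp[OF minv(1)[OF m1] over_mor[OF h e(1)]] .
  let ?a = "vmor f1 v" and ?b = "emor f1 e" and ?c = "vmor f2 (hv h v) \<cdot> vmor h v"
  let ?pT = "\<phi>0 T e" and ?p1 = "\<phi>0 X1 (p1 e)" and ?p2 = "\<phi>0 X2 (p2 (he h e))"
  have pT: "?pT \<in> arrows C (Mor C) (eobj T e) (vobj T v)"
    using M2_arrow_Mor[OF gooD(5)[OF T e(1)]] e(2) by simp
  have p1: "?p1 \<in> arrows C (Mor C) (eobj X1 (p1 e)) (vobj X1 (q1 v))"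
    using M2_arrow_Mor[OF gooD(5)[OF X1 f1G(2)[OF e(1)]]] f1G(3)[OF e(1)] e(2) by simp
  have p2: "?p2 \<in> arrows C (Mor C) (eobj X2 (p2 (he h e))) (vobj X2 (q2 (hv h v)))"
    using M2_arrow_Mor[OF gooD(5)[OF X2 f2G(2)[OF he]]] p2_src[OF h e(1)] e(2) by simp
  note ib = iso_Mor[OF minv(1)[OF m1]] and ia = iso_Mor[OF minv(1)[OF n1]]
  have com1: "?a \<cdot> ?pT = ?p1 \<cdot> ?b" using f1D(5)[OF e(1)] e(2) by simp
  have "?a \<cdot> (?pT \<cdot> minv ?b) = (?p1 \<cdot> ?b) \<cdot> minv ?b"
    using arrow_assoc[OF ib pT iso_Mor[OF n1]] com1 by simp
  also have "\<dots> = ?p1" using arrow_assoc[OF ib iso_Mor[OF m1] p1] minv(3)[OF m1] arrow_id(1)[OF p1] by simp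
  finally have "minv ?a \<cdot> ?p1 = ?pT \<cdot> minv ?b"
    using minv_comp_cancel[OF n1 arrow_comp[OF ib pT]] by simp
  then have 1: "(?c \<cdot> minv ?a) \<cdot> ?p1 = ?c \<cdot> (?pT \<cdot> minv ?b)"
    using arrow_assoc[OF p1 ia iso_Mor[OF vm_iso[OF h v]]] by simp
  have com2: "?c \<cdot> ?pT = ?p2 \<cdot> over_mor h e"
    using goo_homD(5)[OF goo_hom_comp[OF T T X2 H_hom[OF h] f2h] e(1)] e v by (simp add: over_mor_def)
  have "?c \<cdot> (?pT \<cdot> minv ?b) = (?p2 \<cdot> over_mor h e) \<cdot> minv ?b"
    using arrow_assoc[OF ib pT iso_Mor[OF vm_iso[OF h v]]] com2 by simp
  also have "\<dots> = ?p2 \<cdot> (over_mor h e \<cdot> minv ?b)" using arrow_assoc[OF ib iso_Mor[OF over_mor[OF h e(1)]] p2] .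
  finally show "germ_mor h v \<cdot> \<phi>0 X1 (fst \<epsilon>) = \<phi>0 X2 (fst (snd \<epsilon>)) \<cdot> snd (snd \<epsilon>)"
    unfolding \<epsilon> germ_mor_def using 1 by simp
qed

end

section \<open>The common cover\<close>

context covering_pair
begin

definition germs where "germs = (\<Union>w \<in> gverts G2. germs_into w)"

text \<open>
Each germ \<open>s\<close> into \<open>w\<close> receives \<open>c div card (germs_into w)\<close> labels. A type over \<open>e2\<close> then occurs
\<open>c / card (types_over e2)\<close> times, which is the same for its reverse.
\<close>

lemma germs_labelling:
  assumes c: "0 < c" "\<And>w. w \<in> gverts G2 \<Longrightarrow> card (germs_into w) dvd c"
    and germs_into: "\<And>w. w \<in> gverts G2 \<Longrightarrow> 0 < card (germs_into w)" "\<And>w. w \<in> gverts G2 \<Longrightarrow> finite (germs_into w)"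
  shows "\<exists>lab. (\<forall>x < c * card (gverts G2). lab x \<in> germs) \<and> germs \<subseteq> lab ` {..<c * card (gverts G2)} \<and>
    (\<forall>\<epsilon>. card {x. x < c * card (gverts G2) \<and> \<epsilon> \<in> snd (snd (lab x))}
       = card {x. x < c * card (gverts G2) \<and> type_rev G1 G2 \<epsilon> \<in> snd (snd (lab x))})"
proof -
  define m where "m s = c div card (germs_into (fst (snd s)))" for s :: "'v1 \<times> 'v2 \<times> ('e1 \<times> 'e2 \<times> 'm) set"
  define W where "W = (SIGMA s:germs. {..<m s})"
  have fg: "finite germs" unfolding germs_def using fin_G(3) germs_into(2) by (rule finite_UN_I)
  have mpos: "0 < m s" if s: "s \<in> germs" for s
  proof -
    obtain w where w: "w \<in> gverts G2" "s \<in> germs_into w" using s by (auto simp: germs_def)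
    then have "m s = c div card (germs_into w)" using germs_into_proj[OF w(2)] by (simp add: m_def)
    then show ?thesis using c(2)[OF w(1)] c(1) germs_into(1)[OF w(1)] by (simp add: dvd_imp_le div_greater_zero_iff)
  qed
  have finW: "finite W" unfolding W_def using fg by blast
  have sum_germs_into: "(\<Sum>s \<in> germs_into w. m s) = c" if w: "w \<in> gverts G2" for w
  proof -
    have "(\<Sum>s \<in> germs_into w. m s) = (\<Sum>s \<in> germs_into w. c div card (germs_into w))"
      by (intro sum.cong refl) (simp add: m_def germs_into_proj)
    then show ?thesis using c(2)[OF w] by simp
  qed
  have "card W = (\<Sum>s \<in> germs. m s)" unfolding W_def using fg by simp
  also have "\<dots> = (\<Sum>w \<in> gverts G2. \<Sum>s \<in> germs_into w. m s)"
    unfolding germs_def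
  proof (rule sum.UNION_disjoint)
    show "\<forall>i \<in> gverts G2. \<forall>j \<in> gverts G2. i \<noteq> j \<longrightarrow> germs_into i \<inter> germs_into j = {}" using germs_into_proj by blast
  qed (use fin_G(3) germs_into(2) in blast)+
  also have "\<dots> = c * card (gverts G2)" using sum_germs_into by simp
  finally have cW: "card W = c * card (gverts G2)" .
  obtain b where b: "bij_betw b {..<c * card (gverts G2)} W"
    using ex_bij_betw_nat_finite[OF finW] unfolding cW atLeast0LessThan by blast
  define lab where "lab x = fst (b x)" for x
  let ?n = "c * card (gverts G2)"
  have count: "card {x. x < ?n \<and> \<epsilon> \<in> snd (snd (lab x))} = (\<Sum>s \<in> {s \<in> germs. \<epsilon> \<in> snd (snd s)}. m s)" for \<epsilon>
  proof -
    have "bij_betw b {x. x < ?n \<and> \<epsilon> \<in> snd (snd (lab x))} (SIGMA s:{s \<in> germs. \<epsilon> \<in> snd (snd s)}. {..<m s})"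
    proof (rule bij_betw_subset[OF b])
      have "b ` {x. x < ?n \<and> \<epsilon> \<in> snd (snd (lab x))} = {y \<in> b ` {..<?n}. \<epsilon> \<in> snd (snd (fst y))}"
        by (auto simp: lab_def)
      also have "\<dots> = (SIGMA s:{s \<in> germs. \<epsilon> \<in> snd (snd s)}. {..<m s})"
        unfolding bij_betw_imp_surj_on[OF b] W_def by auto
      finally show "b ` {x. x < ?n \<and> \<epsilon> \<in> snd (snd (lab x))} = (SIGMA s:{s \<in> germs. \<epsilon> \<in> snd (snd s)}. {..<m s})" .
    qed auto
    from bij_betw_same_card[OF this] show ?thesis using fg by simp
  qed
  have count_type: "card {x. x < ?n \<and> \<epsilon> \<in> snd (snd (lab x))} * card (types_over e2) = c"
    if \<epsilon>: "\<epsilon> \<in> types_over e2" for \<epsilon> e2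
  proof -
    obtain h e where h: "h \<in> H" "e \<in> gedges GT" "\<epsilon> = edge_type h e" "p2 (he h e) = e2" using \<epsilon> by (auto simp: types_over_def)
    have e2: "e2 \<in> gedges G2" using f2G(2)[OF HG(2)[OF h(1,2)]] h(4) by simp
    have pr: "fst (snd \<epsilon>) = e2" using h by (simp add: edge_type_def)
    let ?w = "src G2 e2"
    have w: "?w \<in> gverts G2" using edge2(1)[OF e2] .
    have "{s \<in> germs. \<epsilon> \<in> snd (snd s)} = germs_through \<epsilon>"
    proof (intro equalityI subsetI)
      fix s assume "s \<in> {s \<in> germs. \<epsilon> \<in> snd (snd s)}"
      then obtain w' where s: "s \<in> germs_into w'" "\<epsilon> \<in> snd (snd s)" by (auto simp: germs_def)
      then obtain v q where q: "v \<in> gverts GT" "q \<in> H" "q2 (hv q v) = w'" "s = germ q v" by (auto simp: germs_into_iff)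
      then obtain a where a: "a \<in> gedges GT" "src GT a = v" "\<epsilon> = edge_type q a" using s(2) by (auto simp: germ_def)
      have "p2 (he q a) = e2" using a(3) pr by (simp add: edge_type_def)
      then have "w' = ?w" using p2_src[OF q(2) a(1)] a(2) q(3) by simp
      then show "s \<in> germs_through \<epsilon>" using s pr by (simp add: germs_through_def)
    next
      fix s assume "s \<in> germs_through \<epsilon>"
      then show "s \<in> {s \<in> germs. \<epsilon> \<in> snd (snd s)}" using w pr by (auto simp: germs_through_def germs_def)
    qed
    then have "card {x. x < ?n \<and> \<epsilon> \<in> snd (snd (lab x))} = (\<Sum>s \<in> germs_through \<epsilon>. m s)"
      unfolding count by (rule arg_cong)
    also have "\<dots> = (\<Sum>s \<in> germs_through \<epsilon>. c div card (germs_into ?w))"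
    proof (rule sum.cong[OF refl])
      fix s assume "s \<in> germs_through \<epsilon>"
      then have "s \<in> germs_into ?w" using pr by (simp add: germs_through_def)
      then show "m s = c div card (germs_into ?w)" unfolding m_def by (simp add: germs_into_proj)
    qed
    finally have "card {x. x < ?n \<and> \<epsilon> \<in> snd (snd (lab x))} * card (types_over e2)
        = (card (types_over e2) * card (germs_through \<epsilon>)) * (c div card (germs_into ?w))" by simp
    also have "\<dots> = c" unfolding card_germs_into_types_over[OF e2 germs_into(2)[OF w] \<epsilon>, symmetric] using c(2)[OF w] by simp
    finally show ?thesis .
  qed
  have lab_germs: "lab x \<in> germs" if "x < ?n" for x
  proof -
    have "b x \<in> W" using bij_betwE[OF b] that by simp
    then show ?thesis by (cases "b x") (simp add: lab_def W_def)
  qed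
  have lab_types_over: "\<epsilon> \<in> types_over (fst (snd \<epsilon>))" if x: "x < ?n" "\<epsilon> \<in> snd (snd (lab x))" for x \<epsilon>
  proof -
    obtain w where "w \<in> gverts G2" "lab x \<in> germs_into w" using lab_germs[OF x(1)] by (auto simp: germs_def)
    then obtain v q where q: "v \<in> gverts GT" "q \<in> H" "lab x = germ q v" by (auto simp: germs_into_iff)
    then obtain a where a: "a \<in> gedges GT" "\<epsilon> = edge_type q a" using x(2) by (auto simp: germ_def)
    then have "fst (snd \<epsilon>) = p2 (he q a)" by (simp add: edge_type_def)
    then show ?thesis unfolding types_over_def using a q(2) by auto
  qed
  have bal: "card {x. x < ?n \<and> \<epsilon> \<in> snd (snd (lab x))} = card {x. x < ?n \<and> type_rev G1 G2 \<epsilon> \<in> snd (snd (lab x))}" for \<epsilon>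
  proof (cases "\<epsilon> \<in> types_over (fst (snd \<epsilon>))")
    case True
    let ?e2 = "fst (snd \<epsilon>)"
    have "card {x. x < ?n \<and> \<epsilon> \<in> snd (snd (lab x))} * card (types_over ?e2)
        = card {x. x < ?n \<and> type_rev G1 G2 \<epsilon> \<in> snd (snd (lab x))} * card (types_over ?e2)"
      using count_type[OF True] count_type[OF types_over_rev[OF True]] card_types_over_rev by simp
    moreover have "card (types_over ?e2) \<noteq> 0" using count_type[OF True] c(1) by (intro notI) simp
    ultimately show ?thesis by simp
  next
    case False
    have "\<epsilon> \<in> types_over (fst (snd \<epsilon>))" if "type_rev G1 G2 \<epsilon> \<in> types_over (fst (snd (type_rev G1 G2 \<epsilon>)))"
      using types_over_rev[OF that] rev_rev_edge[OF gr2] unfolding type_rev_rev by (simp add: type_rev_def)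
    then have "{x. x < ?n \<and> \<epsilon> \<in> snd (snd (lab x))} = {}" "{x. x < ?n \<and> type_rev G1 G2 \<epsilon> \<in> snd (snd (lab x))} = {}"
      using False lab_types_over by blast+
    then show ?thesis by (metis card.empty)
  qed
  have "germs \<subseteq> lab ` {..<?n}"
  proof
    fix s assume s: "s \<in> germs"
    then have "(s, 0) \<in> b ` {..<?n}" unfolding bij_betw_imp_surj_on[OF b] W_def using mpos[OF s] by simp
    then obtain x where "x < ?n" "b x = (s, 0)" by auto
    then show "s \<in> lab ` {..<?n}" by (intro image_eqI[where x = x]) (auto simp: lab_def)
  qed
  then show ?thesis using lab_germs bal by (intro exI[of _ lab]) simp
qed

lemma verts_nonempty: "gverts GT \<noteq> {}"
  using tree by (auto simp: is_tree_def connected_conv)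

text \<open>
The germ at the image of \<open>v\<close> in the glued graph comes from some \<open>h\<close> at some \<open>u\<close>. Deck transformations
of \<open>f1\<close> and \<open>f2\<close>, which lie in \<open>H\<close>, move \<open>v\<close> to \<open>u\<close> and the image of \<open>u\<close> to that of \<open>v\<close> under \<open>g\<close>.
\<close>

lemma closure_vertex:
  assumes v: "v \<in> gverts GT" and g: "goo_hom C M1 T T g"
    and h: "h \<in> H" and u: "u \<in> gverts GT" and q: "q1 u = q1 v" "q2 (hv h u) = q2 (hv g v)"
    and m: "germ_mor h u \<cdot> vmor f1 v = vmor f2 (hv g v) \<cdot> vmor g v"
  shows "\<exists>k \<in> H. hv g v = hv k v \<and> vmor g v = vmor k v"
proof -
  note gD = goo_homD[OF g] and gG = graph_homD[OF goo_homD(1)[OF g]]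
  obtain d where d: "d \<in> deck_transformations C M1 T f1" "hv d v = u" using deck1_v[OF v u] q(1) by auto
  obtain d' where d': "d' \<in> deck_transformations C M1 T f2" "hv d' (hv h u) = hv g v"
    using deck2_v[OF HG(1)[OF h u] gG(1)[OF v]] q(2) by auto
  note dH = deck1D(1)[OF d(1)] and d'H = deck2D(1)[OF d'(1)]
  let ?k = "d' \<odot> (h \<odot> d)"
  have hd: "h \<odot> d \<in> H" and kH: "?k \<in> H" using H_comp dH d'H h by blast+
  have kv: "hv ?k v = hv g v" using d(2) d'(2) v by simp
  have hu: "hv h u \<in> gverts GT" using HG(1)[OF h u] .
  note iu = f1D(2)[OF u] and id = HD(2)[OF dH v] and ih = vm_iso[OF h u]
  have du: "vmor d v \<in> arrows C (Mor C) (vobj T v) (vobj T u)" using iso_Mor[OF id] d(2) by simp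
  have "vmor f2 (hv g v) \<cdot> vmor ?k v = vmor f2 (hv g v) \<cdot> (vmor d' (hv h u) \<cdot> (vmor h u \<cdot> vmor d v))"
    using d(2) v by simp
  also have "\<dots> = (vmor f2 (hv g v) \<cdot> vmor d' (hv h u)) \<cdot> (vmor h u \<cdot> vmor d v)"
  proof (rule arrow_assoc[symmetric])
    show "vmor h u \<cdot> vmor d v \<in> arrows C (Mor C) (vobj T v) (vobj T (hv h u))"
      by (rule arrow_comp[OF du iso_Mor[OF HD(2)[OF h u]]])
    show "vmor d' (hv h u) \<in> arrows C (Mor C) (vobj T (hv h u)) (vobj T (hv g v))"
      using iso_Mor[OF HD(2)[OF d'H hu]] d'(2) by simp
    show "vmor f2 (hv g v) \<in> arrows C (Mor C) (vobj T (hv g v)) (vobj X2 (q2 (hv g v)))"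
      using iso_Mor[OF f2D(2)[OF gG(1)[OF v]]] .
  qed
  also have "vmor f2 (hv g v) \<cdot> vmor d' (hv h u) = vmor f2 (hv h u)" using deck2D(4)[OF d'(1) hu] d'(2) by simp
  also have "vmor f2 (hv h u) \<cdot> (vmor h u \<cdot> vmor d v) = (vmor f2 (hv h u) \<cdot> vmor h u) \<cdot> vmor d v"
    using arrow_assoc[OF du iso_Mor[OF HD(2)[OF h u]] iso_Mor[OF f2D(2)[OF hu]]] by simp
  also have "\<dots> = (vmor f2 (hv h u) \<cdot> vmor h u) \<cdot> (minv (vmor f1 u) \<cdot> vmor f1 v)"
    using minv_comp_cancel[OF iu du] deck1D(4)[OF d(1) v] d(2) by simp
  also have "\<dots> = germ_mor h u \<cdot> vmor f1 v"
    unfolding germ_mor_def using arrow_assoc[OF _ iso_Mor[OF minv(1)[OF iu]] iso_Mor[OF ih]] iso_Mor[OF f1D(2)[OF v]] q(1) by simp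
  finally have "vmor f2 (hv g v) \<cdot> vmor ?k v = vmor f2 (hv g v) \<cdot> vmor g v" using m by simp
  moreover have "vmor ?k v \<in> arrows C (Mor C) (vobj T v) (vobj T (hv g v))"
    using iso_Mor[OF HD(2)[OF kH v]] kv by simp
  ultimately have "vmor ?k v = vmor g v"
    using iso_cancel_left[OF f2D(2)[OF gG(1)[OF v]] _ iso_Mor[OF gD(2)[OF v]]] by blast
  then show ?thesis using kH kv by (intro bexI[of _ ?k]) simp_all
qed

lemma closure_edge:
  assumes e: "e \<in> gedges GT" and g: "goo_hom C M1 T T g"
    and h: "h \<in> H" and a: "a \<in> gedges GT" and q: "p1 a = p1 e" "p2 (he h a) = p2 (he g e)"
    and m: "(over_mor h a \<cdot> minv (emor f1 a)) \<cdot> emor f1 e = emor f2 (he g e) \<cdot> emor g e"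
  shows "\<exists>k \<in> H. he g e = he k e \<and> emor g e = emor k e"
proof -
  note gD = goo_homD[OF g] and gG = graph_homD[OF goo_homD(1)[OF g]]
  obtain d where d: "d \<in> deck_transformations C M1 T f1" "he d e = a" using deck1_e[OF e a] q(1) by auto
  obtain d' where d': "d' \<in> deck_transformations C M1 T f2" "he d' (he h a) = he g e"
    using deck2_e[OF HG(2)[OF h a] gG(2)[OF e]] q(2) by auto
  note dH = deck1D(1)[OF d(1)] and d'H = deck2D(1)[OF d'(1)]
  let ?k = "d' \<odot> (h \<odot> d)"
  have hd: "h \<odot> d \<in> H" and kH: "?k \<in> H" using H_comp dH d'H h by blast+
  have kv: "he ?k e = he g e" using d(2) d'(2) e by simp
  have edge_type_k: "edge_type ?k e = edge_type h a" using edge_type_deck2[OF hd d'(1) e] edge_type_deck1[OF h d(1) e] d(2) by simp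
  then have "over_mor ?k e \<cdot> minv (emor f1 e) = over_mor h a \<cdot> minv (emor f1 a)" by (simp add: edge_type_def)
  then have "(over_mor ?k e \<cdot> minv (emor f1 e)) \<cdot> emor f1 e = emor f2 (he g e) \<cdot> emor g e" using m by simp
  moreover have "(over_mor ?k e \<cdot> minv (emor f1 e)) \<cdot> emor f1 e = over_mor ?k e"
    using arrow_assoc[OF iso_Mor[OF f1D(3)[OF e]] iso_Mor[OF minv(1)[OF f1D(3)[OF e]]] iso_Mor[OF over_mor[OF kH e]]]
      minv(2)[OF f1D(3)[OF e]] arrow_id(1)[OF iso_Mor[OF over_mor[OF kH e]]] by simp
  ultimately have "emor f2 (he g e) \<cdot> emor ?k e = emor f2 (he g e) \<cdot> emor g e"
    using kv by (simp add: over_mor_def)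
  moreover have "emor ?k e \<in> arrows C (Mor C) (eobj T e) (eobj T (he g e))"
    using iso_Mor[OF HD(3)[OF kH e]] kv by simp
  ultimately have "emor ?k e = emor g e"
    using iso_cancel_left[OF f2D(3)[OF gG(2)[OF e]] _ iso_Mor[OF gD(3)[OF e]]] by blast
  then show ?thesis using kH kv by (intro bexI[of _ ?k]) simp_all
qed

text \<open>
The labels of \<open>germs_labelling\<close> feed \<open>glue_germs\<close>. The germ of the identity at a vertex \<open>r\<close> lies over
the image of \<open>r\<close> in \<open>X1\<close> and provides the base point for the lift.
\<close>

theorem symmetry_restricted_leighton:
  "\<exists>(X :: (nat, nat, 'o, 'm) goo) \<mu>1 \<mu>2 \<nu>1 \<nu>2 g.
      graph_of_objects C M2 X \<and> finite_graph (ugraph X) \<and>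
      goo_covering C M1 X X1 \<mu>1 \<and> goo_covering C M1 X X2 \<mu>2 \<and>
      goo_covering C M1 T X \<nu>1 \<and> goo_covering C M1 T X \<nu>2 \<and>
      g \<in> sym_restricted_closure C M1 T H \<and>
      f1 = goo_comp C T \<mu>1 \<nu>1 \<and> f2 = goo_comp C T \<mu>2 \<nu>2 \<and> \<nu>1 = goo_comp C T \<nu>2 g \<and>
      (let V = card (gverts (ugraph X1) <+> gverts (ugraph X2));
           d = max_degree (ugraph T);
           L = (LCM e \<in> gedges (ugraph T). card (isotropy H e))
       in real (card (gverts (ugraph X)))
            \<le> (fact d)\<^sup>2 * real L ^ (2 * d) * (real V)\<^sup>2 * exp (2 * sqrt (real V * ln (real V))))"
proof -
  obtain r where r: "r \<in> gverts GT" using verts_nonempty by blast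
  define V where "V = card (gverts G1) + card (gverts G2)"
  define c where "c = vclass r * smooth_bound maxdeg V * (fact maxdeg * iso_lcm ^ maxdeg)"
  have cpos: "0 < c" unfolding c_def using vclass_bounds(1)[OF r] smooth_bound_pos iso_lcm_pos by simp
  define n where "n = c * card (gverts G2)"
  note germs_into = germs_into_dvd[OF r _ , of _ V, folded c_def]
  have "card (gverts G1) \<le> V" by (simp add: V_def)
  from germs_labelling[OF cpos germs_into(1)[OF _ this] germs_into(2)[OF _ this] germs_into(3)[OF _ this], folded n_def]
  obtain lab where lab: "\<And>x. x < n \<Longrightarrow> lab x \<in> germs" "germs \<subseteq> lab ` {..<n}"
    "\<And>\<epsilon>. card {x. x < n \<and> \<epsilon> \<in> snd (snd (lab x))} = card {x. x < n \<and> type_rev G1 G2 \<epsilon> \<in> snd (snd (lab x))}"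
    by blast
  have "\<exists>h v. x < n \<longrightarrow> h \<in> H \<and> v \<in> gverts GT \<and> lab x = germ h v" for x
    using lab(1)[of x] unfolding germs_def UN_iff germs_into_iff by blast
  then obtain hs vs where hs: "\<And>x. x < n \<Longrightarrow> hs x \<in> H" "\<And>x. x < n \<Longrightarrow> vs x \<in> gverts GT"
    "\<And>x. x < n \<Longrightarrow> lab x = germ (hs x) (vs x)" by metis
  have S: "snd (snd (lab x)) = edge_type (hs x) ` star GT (vs x)" "fst (lab x) = q1 (vs x)"
    "fst (snd (lab x)) = q2 (hv (hs x) (vs x))" if "x < n" for x
    using hs(3)[OF that] by (simp_all add: germ_def)
  have "is_germ X1 X2 (fst (lab x)) (fst (snd (lab x))) (snd (snd (lab x))) (germ_mor (hs x) (vs x))" if x: "x < n" for x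
    unfolding S[OF x] by (rule germ_is_germ[OF hs(1,2)[OF x]])
  from glue_germs[OF X1 X2 fin_G(2) this lab(3)]
  obtain Xh :: "(nat, nat, 'o, 'm) goo" and \<mu>1 \<mu>2 where
    Xh: "graph_of_objects C M2 Xh" "gverts (ugraph Xh) = {..<n}" "finite (gedges (ugraph Xh))"
    and m1: "goo_hom C M1 Xh X1 \<mu>1" "local_iso (ugraph Xh) G1 (umap \<mu>1)"
    and m2: "goo_hom C M1 Xh X2 \<mu>2" "local_iso (ugraph Xh) G2 (umap \<mu>2)"
    and mV: "\<And>x. x < n \<Longrightarrow> vmap (umap \<mu>1) x = fst (lab x) \<and> vmap (umap \<mu>2) x = fst (snd (lab x)) \<and>
       vmor \<mu>1 x = Ident C (vobj X1 (fst (lab x))) \<and> vmor \<mu>2 x = germ_mor (hs x) (vs x)"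
    and mE: "\<And>e. e \<in> gedges (ugraph Xh) \<Longrightarrow>
      (emap (umap \<mu>1) e, emap (umap \<mu>2) e, emor \<mu>2 e) \<in> snd (snd (lab (src (ugraph Xh) e))) \<and>
       emor \<mu>1 e = Ident C (eobj X1 (emap (umap \<mu>1) e))"
    by blast
  have "germ (goo_id C T) r \<in> germs_into (q2 r)" unfolding germs_into_iff
    using r H_id id_apply(1)[OF r] by (intro bexI[of _ r] bexI[of _ "goo_id C T"]) simp_all
  then have "germ (goo_id C T) r \<in> germs" unfolding germs_def using f2G(1)[OF r] by blast
  then obtain x0 where x0: "x0 < n" "lab x0 = germ (goo_id C T) r" using lab(2) by auto
  have "x0 \<in> gverts (ugraph Xh)" "vmap (umap \<mu>1) x0 = q1 r"
    using x0 mV[OF x0(1)] Xh(2) by (simp_all add: germ_def)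
  from common_cover_of_glued[OF T X1 X2 Xh(1) f1 f2 tree m1 m2 r this]
  obtain X :: "(nat, nat, 'o, 'm) goo" and \<mu>1' \<mu>2' \<nu>1 \<nu>2 g where
    X: "graph_of_objects C M2 X" "gverts (ugraph X) \<subseteq> gverts (ugraph Xh)" "gedges (ugraph X) \<subseteq> gedges (ugraph Xh)"
      "goo_covering C M1 X X1 \<mu>1'" "goo_covering C M1 X X2 \<mu>2'"
      "goo_covering C M1 T X \<nu>1" "goo_covering C M1 T X \<nu>2"
      "f1 = goo_comp C T \<mu>1' \<nu>1" "f2 = goo_comp C T \<mu>2' \<nu>2" "\<nu>1 = goo_comp C T \<nu>2 g"
    and gA: "g \<in> carrier (goo_Aut C M1 T)" and n1: "goo_hom C M1 T Xh \<nu>1"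
    and fc: "f1 = goo_comp C T \<mu>1 \<nu>1" "goo_comp C T f2 g = goo_comp C T \<mu>2 \<nu>1"
    by blast
  have g: "goo_hom C M1 T T g" using gA by (simp add: goo_Aut_def)
  note nD = goo_homD[OF n1] and nG = graph_homD[OF goo_homD(1)[OF n1]]
  note m1D = goo_homD[OF m1(1)]
  have "g \<in> sym_restricted_closure C M1 T H"
    unfolding sym_restricted_closure_def
  proof (intro CollectI conjI ballI)
    show "g \<in> carrier (goo_Aut C M1 T)" by fact
  next
    fix v assume v: "v \<in> gverts GT"
    let ?x = "hv \<nu>1 v"
    have x: "?x \<in> gverts (ugraph Xh)" "?x < n" using nG(1)[OF v] Xh(2) by auto
    have 1: "q1 v = vmap (umap \<mu>1) ?x" "q2 (hv g v) = vmap (umap \<mu>2) ?x"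
      using graph_comp_apply(1)[OF v] fc by (metis goo_comp_apply(1))+
    \<comment> \<open>the first map of the glued graph has identity components, so the lift and \<open>f1\<close> have the same components\<close>
    have "vmor \<mu>1 ?x = Ident C (vobj X1 (q1 v))" using mV[OF x(2)] 1 by simp
    moreover have ix: "vmor \<mu>1 ?x \<in> iso (vobj Xh ?x) (vobj X1 (q1 v))" using m1D(2)[OF x(1)] 1 by simp
    moreover have "Dom C (Ident C (vobj X1 (q1 v))) = vobj X1 (q1 v)" using Dom_Ident[OF gooD(2)[OF X1 f1G(1)[OF v]]] .
    ultimately have "vobj Xh ?x = vobj X1 (q1 v)" by (simp add: arrows_def)
    then have "vmor \<mu>1 ?x \<cdot> vmor \<nu>1 v = vmor \<nu>1 v"
      using arrow_id(2)[OF iso_Mor[OF nD(2)[OF v]]] \<open>vmor \<mu>1 ?x = _\<close> by simp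
    then have n1f: "vmor \<nu>1 v = vmor f1 v" using goo_comp_apply(2)[OF v, of \<mu>1 \<nu>1] fc(1) by simp
    have "germ_mor (hs ?x) (vs ?x) \<cdot> vmor f1 v = vmor f2 (hv g v) \<cdot> vmor g v"
      using goo_comp_apply(2)[OF v, of \<mu>2 \<nu>1] goo_comp_apply(2)[OF v, of f2 g] fc(2) n1f mV[OF x(2)] by simp
    then show "\<exists>h \<in> H. hv g v = hv h v \<and> vmor g v = vmor h v"
      by (rule closure_vertex[OF v g hs(1,2)[OF x(2)], rotated 2]) (use 1 mV[OF x(2)] S[OF x(2)] in simp_all)
  next
    fix e assume e: "e \<in> gedges GT"
    let ?x = "he \<nu>1 e"
    have x: "?x \<in> gedges (ugraph Xh)" using nG(2)[OF e] .
    let ?s = "src (ugraph Xh) ?x"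
    have s: "?s < n" using is_graphD(1)[OF gooD(1)[OF Xh(1)] x] Xh(2) by simp
    have 1: "p1 e = emap (umap \<mu>1) ?x" "p2 (he g e) = emap (umap \<mu>2) ?x"
      using graph_comp_apply(2)[OF e] fc by (metis goo_comp_apply(1))+
    have "emor \<mu>1 ?x = Ident C (eobj X1 (p1 e))" using mE[OF x] 1 by simp
    moreover have ix: "emor \<mu>1 ?x \<in> iso (eobj Xh ?x) (eobj X1 (p1 e))" using m1D(3)[OF x] 1 by simp
    moreover have "Dom C (Ident C (eobj X1 (p1 e))) = eobj X1 (p1 e)" using Dom_Ident[OF gooD(3)[OF X1 f1G(2)[OF e]]] .
    ultimately have "eobj Xh ?x = eobj X1 (p1 e)" by (simp add: arrows_def)
    then have "emor \<mu>1 ?x \<cdot> emor \<nu>1 e = emor \<nu>1 e"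
      using arrow_id(2)[OF iso_Mor[OF nD(3)[OF e]]] \<open>emor \<mu>1 ?x = _\<close> by simp
    then have n1f: "emor \<nu>1 e = emor f1 e" using goo_comp_apply(3)[OF e, of \<mu>1 \<nu>1] fc(1) by simp
    have "(emap (umap \<mu>1) ?x, emap (umap \<mu>2) ?x, emor \<mu>2 ?x) \<in> edge_type (hs ?s) ` star GT (vs ?s)"
      using mE[OF x] S(1)[OF s] by simp
    then obtain a where a: "a \<in> gedges GT" "(emap (umap \<mu>1) ?x, emap (umap \<mu>2) ?x, emor \<mu>2 ?x) = edge_type (hs ?s) a"
      by auto
    have edge_type: "p1 a = p1 e" "p2 (he (hs ?s) a) = p2 (he g e)" "emor \<mu>2 ?x = over_mor (hs ?s) a \<cdot> minv (emor f1 a)"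
      using a(2) 1 by (simp_all add: edge_type_def)
    have "(over_mor (hs ?s) a \<cdot> minv (emor f1 a)) \<cdot> emor f1 e = emor f2 (he g e) \<cdot> emor g e"
      using goo_comp_apply(3)[OF e, of \<mu>2 \<nu>1] goo_comp_apply(3)[OF e, of f2 g] fc(2) n1f edge_type(3) by simp
    then show "\<exists>h \<in> H. he g e = he h e \<and> emor g e = emor h e"
      by (rule closure_edge[OF e g hs(1)[OF s] a(1) edge_type(1,2)])
  qed
  moreover have "finite_graph (ugraph X)"
    unfolding finite_graph_def using finite_subset[OF X(2)] finite_subset[OF X(3) Xh(3)] Xh(2) by simp
  moreover have "real (card (gverts (ugraph X)))
      \<le> (fact maxdeg)\<^sup>2 * real iso_lcm ^ (2 * maxdeg) * (real V)\<^sup>2 * exp (2 * sqrt (real V * ln (real V)))"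
  proof -
    have "card (gverts (ugraph X)) \<le> n" using card_mono[OF _ X(2)] Xh(2) by simp
    then have "real (card (gverts (ugraph X))) \<le> real n" by simp
    also have "real n = real ((vclass r * smooth_bound maxdeg V * fact maxdeg * iso_lcm ^ maxdeg) * card (gverts G2))"
      by (simp add: n_def c_def mult_ac)
    also have "\<dots> \<le> (fact maxdeg)\<^sup>2 * real iso_lcm ^ (2 * maxdeg) * (real V)\<^sup>2 * exp (2 * sqrt (real V * ln (real V)))"
    proof (rule vertex_bound)
      show "card (gverts G1) + card (gverts G2) = V" by (simp add: V_def)
      have "gverts G1 \<noteq> {}" "gverts G2 \<noteq> {}" using f1G(1)[OF r] f2G(1)[OF r] by auto
      then show "1 \<le> card (gverts G1)" "1 \<le> card (gverts G2)" using fin_G by (simp_all add: Suc_le_eq card_gt_0_iff)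
      show "1 \<le> iso_lcm" using iso_lcm_pos by simp
      show "vclass r \<le> card (gverts G1)" by (rule vclass_bounds(2)[OF r])
    qed
    finally show ?thesis .
  qed
  moreover have "card (gverts G1 <+> gverts G2) = V" using card_Plus[OF fin_G(1,3)] by (simp add: V_def)
  ultimately show ?thesis
    using X(1,4-10)
    by (intro exI[of _ X] exI[of _ \<mu>1'] exI[of _ \<mu>2'] exI[of _ \<nu>1] exI[of _ \<nu>2] exI[of _ g] conjI)
      (assumption | simp only: Let_def maxdeg_def iso_lcm_def)+
qed

end

theorem theorem6p3:
  fixes C :: "('o, 'm) cat" and M1 M2 :: "'m set"
    and Xt :: "('v, 'e, 'o, 'm) goo"
    and X1 :: "('v1, 'e1, 'o, 'm) goo"
    and X2 :: "('v2, 'e2, 'o, 'm) goo"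
    and f1 :: "('v, 'e, 'v1, 'e1, 'm) goo_map"
    and f2 :: "('v, 'e, 'v2, 'e2, 'm) goo_map"
    and H :: "('v, 'e, 'v, 'e, 'm) goo_map set"
  assumes "category_triple C M1 M2"
    and "graph_of_objects C M2 Xt" "graph_of_objects C M2 X1" "graph_of_objects C M2 X2"
    and "goo_covering C M1 Xt X1 f1" "goo_covering C M1 Xt X2 f2"
    and "finite_graph (ugraph X1)" "finite_graph (ugraph X2)"
    and "is_tree (ugraph Xt)"
    and "deck_transformations C M1 Xt f1 \<subseteq> H" "deck_transformations C M1 Xt f2 \<subseteq> H"
    and "subgroup H (goo_Aut C M1 Xt)"
    and "finite_edge_isotropy Xt H"
  shows "\<exists>(X :: (nat, nat, 'o, 'm) goo) \<mu>1 \<mu>2 \<nu>1 \<nu>2 g.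
      graph_of_objects C M2 X \<and> finite_graph (ugraph X) \<and>
      goo_covering C M1 X X1 \<mu>1 \<and> goo_covering C M1 X X2 \<mu>2 \<and>
      goo_covering C M1 Xt X \<nu>1 \<and> goo_covering C M1 Xt X \<nu>2 \<and>
      g \<in> sym_restricted_closure C M1 Xt H \<and>
      f1 = goo_comp C Xt \<mu>1 \<nu>1 \<and> f2 = goo_comp C Xt \<mu>2 \<nu>2 \<and> \<nu>1 = goo_comp C Xt \<nu>2 g \<and>
      (let V = card (gverts (ugraph X1) <+> gverts (ugraph X2));
           d = max_degree (ugraph Xt);
           L = (LCM e \<in> gedges (ugraph Xt). card (isotropy H e))
       in real (card (gverts (ugraph X)))
            \<le> (fact d)\<^sup>2 * real L ^ (2 * d) * (real V)\<^sup>2 * exp (2 * sqrt (real V * ln (real V))))"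
proof -
  interpret covering_pair C M1 M2 Xt X1 X2 f1 f2 H
    by (rule covering_pair.intro[OF assms(1)], rule covering_pair_axioms.intro) (fact assms)+
  show ?thesis by (rule symmetry_restricted_leighton)
qed

end
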